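(* Fix $\beta>0$. Let $f:\mathbb R\to\mathbb C$ be continuous with $f(x)\to0$ as $|x|\to\infty$, and suppose $F=f\circ T\in H^s(\mathbb T)$. With constants depending only on the indicated parameters (and on $\beta$), and not on $n$, $k$ or $f$, the following hold for all integers $n>1$. 1. For $\epsilon>0$, $s>1+\epsilon$ and $t\le s$, $$\|\mathcal F(\mathcal R_nf-f)\,(1+|\cdot|)^t\|_{L^2(\mathbb R)}=\|\mathcal R_nf-f\|_{H^t(\mathbb R)}\le\left[C_{\epsilon,s}\,n^{1+\epsilon-s}+C_{s,t}\,n^{t-s}\right]\|F\|_{H^s(\mathbb T)}.$$ 2. For $\epsilon>0$, $s>3/2+\epsilon$ and all $k\in\mathbb R$, $$|\mathcal F\mathcal R_nf(k)-\mathcal Ff(k)|\le C_{\epsilon,s}\,n^{3/2+\epsilon-s}\,\|F\|_{H^s(\mathbb T)}.$$ 3. For every integer $j$ with $0<j\le s$ and every real $k$ with $|k|>0$, $$|\mathcal F\mathcal R_nf(k)-\mathcal Ff(k)|\le|k|^{-j}\,\|\mathcal D^j[\mathcal R_nf-f]\|_{L^1(\mathbb R)}\le C_{j,s}\,|k|^{-j}\,n^{j-s}\,\|F\|_{H^s(\mathbb T)}.$$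
   Context: The Fourier transform is $\mathcal F f(k)=\int_{\mathbb R}e^{-ikx}f(x)\,dx$; in items 2 and 3 the difference of transforms is understood as the principal value $\mathcal F\mathcal R_nf(k)-\mathcal Ff(k)=\lim_{R\to\infty}\int_{-R}^Re^{-ikx}(\mathcal R_nf(x)-f(x))\,dx$, and in item 1 $\mathcal F$ is the $L^2$ Fourier transform. $\mathcal D$ denotes differentiation. $H^t(\mathbb R)$ is the space of $f\in L^2(\mathbb R)$ with $\|f\|_{H^t(\mathbb R)}=\big(\int_{\mathbb R}(1+|k|)^{2t}|\mathcal F f(k)|^2dk\big)^{1/2}<\infty$. $\mathbb T=[0,2\pi)$ is the periodic interval. With $\hat F_k=\frac1{2\pi}\int_0^{2\pi}e^{-ik\theta}F(\theta)\,d\theta$, $H^s(\mathbb T)$ is the space of $F\in L^2(\mathbb T)$ with $\|F\|_{H^s(\mathbb T)}=\big(\sum_{k\in\mathbb Z}(1+|k|)^{2s}|\hat F_k|^2\big)^{1/2}<\infty$. For $\beta>0$ let $M_\beta(z)=\frac{z-i\beta}{z+i\beta}$, $M_\beta^{-1}(z)=\frac{\beta}{i}\frac{z+1}{z-1}$, and $T(\theta)=M_\beta^{-1}(e^{i\theta})$, a bijection from $(0,2\pi)$ to $\mathbb R$; $F(\theta)=f(T(\theta))$ for $\theta\in(0,2\pi)$ and $F(0)=F(2\pi)=0$. For $n\in\mathbb N$ let $\theta_\ell=2\pi\ell/n$ ($\ell=0,\dots,n-1$), $n_+=\lfloor n/2\rfloor$, $n_-=\lfloor(n-1)/2\rfloor$,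 $\tilde F_k=\frac1n\sum_{\ell=0}^{n-1}e^{-ik\theta_\ell}F(\theta_\ell)$, and $\mathcal I_nF(\theta)=\sum_{k=-n_-}^{n_+}e^{ik\theta}\tilde F_k$. The rational interpolant of $f$ is $\mathcal R_nf(x)=\mathcal I_nF(T^{-1}(x))=\sum_{k=-n_-}^{n_+}\tilde F_k\,M_\beta(x)^k$. *)

theory Defs
  imports "HOL-Analysis.Analysis"
begin

section \<open>Square-integrable functions and the Fourier transform\<close>

definition L2_on :: "real set \<Rightarrow> (real \<Rightarrow> complex) \<Rightarrow> bool" where
  "L2_on A f \<longleftrightarrow> set_borel_measurable lborel A f
     \<and> set_integrable lborel A (\<lambda>x. (norm (f x))\<^sup>2)"

definition L2_norm :: "(real \<Rightarrow> complex) \<Rightarrow> real" where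
  "L2_norm f = sqrt (LINT x|lborel. (norm (f x))\<^sup>2)"

definition L1_norm :: "(real \<Rightarrow> complex) \<Rightarrow> real" where
  "L1_norm f = (LINT x|lborel. norm (f x))"

definition truncated_fourier :: "real \<Rightarrow> (real \<Rightarrow> complex) \<Rightarrow> real \<Rightarrow> complex" where
  "truncated_fourier R f k = (LINT x:{-R..R}|lborel. exp (- (\<i> * of_real k * of_real x)) * f x)"

text \<open>The principal value of the Fourier integral of \<open>f\<close> at \<open>k\<close> exists and equals \<open>L\<close>.\<close>

definition has_pv_fourier :: "(real \<Rightarrow> complex) \<Rightarrow> real \<Rightarrow> complex \<Rightarrow> bool" where
  "has_pv_fourier f k L \<longleftrightarrow> ((\<lambda>R. truncated_fourier R f k) \<longlongrightarrow> L) at_top"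

text \<open>The \<open>L\<^sup>2\<close> Fourier transform is the \<open>L\<^sup>2\<close> limit of the truncated Fourier integrals. It is
  determined only up to a null set, so the function below picks a representative. Convergence is
  stated with the extended nonnegative integral, which (unlike the Bochner integral) does not
  default to 0 when the difference is not square-integrable.\<close>

definition is_fourier_L2 :: "(real \<Rightarrow> complex) \<Rightarrow> (real \<Rightarrow> complex) \<Rightarrow> bool" where
  "is_fourier_L2 f g \<longleftrightarrow> L2_on UNIV f \<and> L2_on UNIV g \<and>
     ((\<lambda>R. \<integral>\<^sup>+k. ennreal ((norm (truncated_fourier R f k - g k))\<^sup>2) \<partial>lborel) \<longlongrightarrow> 0) at_top"

definition fourier_L2 :: "(real \<Rightarrow> complex) \<Rightarrow> real \<Rightarrow> complex" where
  "fourier_L2 f = (SOME g. is_fourier_L2 f g)"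

section \<open>Sobolev spaces on the line and on the circle\<close>

definition sobolev_line :: "real \<Rightarrow> (real \<Rightarrow> complex) set" where
  "sobolev_line t = {f. L2_on UNIV f \<and>
     integrable lborel (\<lambda>k. (1 + \<bar>k\<bar>) powr (2 * t) * (norm (fourier_L2 f k))\<^sup>2)}"

definition sobolev_line_norm :: "real \<Rightarrow> (real \<Rightarrow> complex) \<Rightarrow> real" where
  "sobolev_line_norm t f =
     sqrt (LINT k|lborel. (1 + \<bar>k\<bar>) powr (2 * t) * (norm (fourier_L2 f k))\<^sup>2)"

definition fourier_coeff :: "(real \<Rightarrow> complex) \<Rightarrow> int \<Rightarrow> complex" where
  "fourier_coeff F k = 1 / (2 * of_real pi) *
     (LINT \<theta>:{0..<2 * pi}|lborel. exp (- (\<i> * of_int k * of_real \<theta>)) * F \<theta>)"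

definition sobolev_circle :: "real \<Rightarrow> (real \<Rightarrow> complex) set" where
  "sobolev_circle s = {F. L2_on {0..<2 * pi} F \<and>
     (\<lambda>k::int. (1 + \<bar>real_of_int k\<bar>) powr (2 * s) * (norm (fourier_coeff F k))\<^sup>2) summable_on UNIV}"

definition sobolev_circle_norm :: "real \<Rightarrow> (real \<Rightarrow> complex) \<Rightarrow> real" where
  "sobolev_circle_norm s F =
     sqrt (\<Sum>\<^sub>\<infinity>k::int. (1 + \<bar>real_of_int k\<bar>) powr (2 * s) * (norm (fourier_coeff F k))\<^sup>2)"

section \<open>Weak derivatives\<close>

definition test_function :: "(real \<Rightarrow> real) \<Rightarrow> bool" where
  "test_function \<phi> \<longleftrightarrow> (\<forall>m x. (deriv ^^ m) \<phi> field_differentiable (at x))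
     \<and> (\<exists>R. \<forall>x. \<bar>x\<bar> > R \<longrightarrow> \<phi> x = 0)"

definition locally_integrable :: "(real \<Rightarrow> complex) \<Rightarrow> bool" where
  "locally_integrable f \<longleftrightarrow> (\<forall>a b. set_integrable lborel {a..b} f)"

definition weak_deriv :: "nat \<Rightarrow> (real \<Rightarrow> complex) \<Rightarrow> (real \<Rightarrow> complex) \<Rightarrow> bool" where
  "weak_deriv j f g \<longleftrightarrow> locally_integrable f \<and> locally_integrable g \<and>
     (\<forall>\<phi>. test_function \<phi> \<longrightarrow>
        (LINT x|lborel. f x * of_real ((deriv ^^ j) \<phi> x))
          = (-1) ^ j * (LINT x|lborel. g x * of_real (\<phi> x)))"

section \<open>The Moebius map and rational interpolation\<close>

definition moebius :: "real \<Rightarrow> complex \<Rightarrow> complex" where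
  "moebius \<beta> z = (z - \<i> * of_real \<beta>) / (z + \<i> * of_real \<beta>)"

definition moebius_inv :: "real \<Rightarrow> complex \<Rightarrow> complex" where
  "moebius_inv \<beta> z = of_real \<beta> / \<i> * ((z + 1) / (z - 1))"

text \<open>On the unit circle without 1 the inverse Moebius map is real-valued (see
  \<open>of_real_circle_to_line\<close> below), so taking the real part only changes the type.\<close>

definition circle_to_line :: "real \<Rightarrow> real \<Rightarrow> real" where
  "circle_to_line \<beta> \<theta> = Re (moebius_inv \<beta> (exp (\<i> * of_real \<theta>)))"

definition pullback :: "real \<Rightarrow> (real \<Rightarrow> complex) \<Rightarrow> real \<Rightarrow> complex" where
  "pullback \<beta> f \<theta> = (if 0 < \<theta> \<and> \<theta> < 2 * pi then f (circle_to_line \<beta> \<theta>) else 0)"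

definition discrete_coeff :: "nat \<Rightarrow> (real \<Rightarrow> complex) \<Rightarrow> int \<Rightarrow> complex" where
  "discrete_coeff n F k = 1 / of_nat n *
     (\<Sum>l<n. exp (- (\<i> * of_int k * of_real (2 * pi * real l / real n))) * F (2 * pi * real l / real n))"

definition trig_interp :: "nat \<Rightarrow> (real \<Rightarrow> complex) \<Rightarrow> real \<Rightarrow> complex" where
  "trig_interp n F \<theta> =
     (\<Sum>k = - int ((n - 1) div 2)..int (n div 2). exp (\<i> * of_int k * of_real \<theta>) * discrete_coeff n F k)"

definition rational_interp :: "real \<Rightarrow> nat \<Rightarrow> (real \<Rightarrow> complex) \<Rightarrow> real \<Rightarrow> complex" where
  "rational_interp \<beta> n f x =
     (\<Sum>k = - int ((n - 1) div 2)..int (n div 2).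
        discrete_coeff n (pullback \<beta> f) k * moebius \<beta> (of_real x) powi k)"

definition interp_error :: "real \<Rightarrow> nat \<Rightarrow> (real \<Rightarrow> complex) \<Rightarrow> real \<Rightarrow> complex" where
  "interp_error \<beta> n f x = rational_interp \<beta> n f x - f x"

lemma exp_i_neq_1:
  assumes "0 < \<theta>" "\<theta> < 2 * pi"
  shows "exp (\<i> * of_real \<theta>) \<noteq> 1"
proof
  assume "exp (\<i> * of_real \<theta>) = 1"
  then obtain m :: int where "\<theta> = of_int (2 * m) * pi"
    by (auto simp: exp_eq_1)
  with assms have "0 < of_int (2 * m) * pi" "of_int (2 * m) * pi < 2 * pi" by auto
  then have "0 < m" "m < 1" by (auto simp: zero_less_mult_iff)
  then show False by simp
qed

lemma of_real_circle_to_line: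
  assumes "0 < \<theta>" "\<theta> < 2 * pi"
  shows "complex_of_real (circle_to_line \<beta> \<theta>) = moebius_inv \<beta> (exp (\<i> * of_real \<theta>))"
proof -
  define z where "z = exp (\<i> * complex_of_real \<theta>)"
  have z1: "z \<noteq> 1" unfolding z_def using exp_i_neq_1[OF assms] .
  have zz: "z * cnj z = 1" by (simp add: z_def exp_cnj flip: exp_add)
  then have z0: "z \<noteq> 0" by auto
  with zz have "cnj z = 1 / z" by (simp add: field_simps)
  with z0 have "cnj (moebius_inv \<beta> z) = moebius_inv \<beta> z"
    using z1 unfolding moebius_inv_def by (simp add: divide_simps) (simp add: algebra_simps)
  then show ?thesis
    unfolding circle_to_line_def z_def[symmetric] by (simp add: complex_eq_iff)
qed

lemma moebius_circle_to_line:
  assumes "\<beta> > 0" "0 < \<theta>" "\<theta> < 2 * pi"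
  shows "moebius \<beta> (of_real (circle_to_line \<beta> \<theta>)) = exp (\<i> * of_real \<theta>)"
proof -
  define z where "z = exp (\<i> * complex_of_real \<theta>)"
  have z1: "z - 1 \<noteq> 0" unfolding z_def using exp_i_neq_1[OF assms(2,3)] by simp
  define w where "w = moebius_inv \<beta> z"
  have "\<i> * w * (z - 1) = of_real \<beta> * (z + 1)"
    unfolding w_def moebius_inv_def using z1 by (simp add: field_simps)
  then have "(w - \<i> * of_real \<beta>) * (z - 1) = - 2 * \<i> * of_real \<beta> * z"
    "(w + \<i> * of_real \<beta>) * (z - 1) = - 2 * \<i> * of_real \<beta>"
    using i_squared by algebra+
  then have "(w - \<i> * of_real \<beta>) * (z - 1) = z * ((w + \<i> * of_real \<beta>) * (z - 1))"
    and ne: "w + \<i> * of_real \<beta> \<noteq> 0" using assms(1) by auto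
  then have "w - \<i> * of_real \<beta> = z * (w + \<i> * of_real \<beta>)" using z1 by auto
  with ne show ?thesis
    unfolding of_real_circle_to_line[OF assms(2,3)] moebius_def z_def[symmetric] w_def[symmetric]
    by (simp add: field_simps)
qed

text \<open>The two descriptions of the rational interpolant agree.\<close>

lemma rational_interp_circle_to_line:
  assumes "\<beta> > 0" "0 < \<theta>" "\<theta> < 2 * pi"
  shows "rational_interp \<beta> n f (circle_to_line \<beta> \<theta>) = trig_interp n (pullback \<beta> f) \<theta>"
proof -
  have "exp (\<i> * of_real \<theta>) powi k = exp (\<i> * of_int k * of_real \<theta>)" for k
    by (simp add: exp_power_int mult_ac)
  then show ?thesis
    unfolding rational_interp_def trig_interp_def moebius_circle_to_line[OF assms]
    by (simp add: mult.commute)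
qed

end

theory Submission
  imports Defs "HOL-Probability.Sinc_Integral" "HOL-Real_Asymp.Real_Asymp"
begin

text \<open>On the circle the error is \<open>\<Sum> E\<^sub>k e\<^sup>i\<^sup>k\<^sup>\<theta>\<close>, where aliasing expresses \<open>E\<^sub>k\<close> through the Fourier
  coefficients of \<open>F\<close> at the indices \<open>k + mn\<close>; this bounds every weighted \<open>\<ell>\<^sup>2\<close> norm of \<open>E\<close>
  by \<open>n\<^sup>r\<^sup>-\<^sup>s \<parallel>F\<parallel>\<close>. Since \<open>\<theta> = 0\<close> is a node, \<open>\<Sum> E\<^sub>k = 0\<close>, so on the line the error is the series
  \<open>\<Sum> E\<^sub>k (M\<^sup>k - 1)\<close>.

  Because \<open>M' = (1 - M)\<^sup>2 / (2\<i>\<beta>)\<close>, the derivative acts on the coefficients as the multiplication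
  by \<open>k\<close> followed by a second difference, and \<open>|1 - M|\<^sup>2 dx = 2\<beta> d\<theta>\<close> turns the \<open>L\<^sup>1\<close> and \<open>L\<^sup>2\<close>
  norms of the derivatives into weighted \<open>\<ell>\<^sup>2\<close> norms of \<open>E\<close>. Item 3 follows by integrating by parts.
  Item 1 needs in addition \<open>\<parallel>M\<^sup>k - 1\<parallel>\<^sub>2\<^sup>2 = O(|k|)\<close>, real interpolation for fractional orders, and the
  inequality \<open>\<le>\<close> of Plancherel's theorem, which is a consequence of Bessel's inequality. Item 2 holds
  because the truncated transforms of \<open>M\<^sup>k - 1\<close> are \<open>O(|k|)\<close> uniformly in the frequency and in
  the truncation.\<close>

section \<open>The energy inequality for the Fourier transform\<close>

text \<open>The error need not be integrable, because M^k - 1 decays only like 1/x. Its first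
  derivative \<open>G\<close> is integrable, so away from k = 0 the transform of the error is read
  off as the transform of \<open>G\<close> divided by ik. Nor need the error be classically
  differentiable: derivative estimates are proved for finitely supported coefficients, with
  constants independent of the support, and reach the error through finite cuts of its series.

  A second difference of coefficients gains nothing in a weighted l2 norm but loses only a constant
  factor, so a derivative costs just the one order contributed by the factor k. The surplus in 1 +
  \<epsilon> and 3/2 + \<epsilon> has one origin: Cauchy-Schwarz sets the Sobolev weight against
  |k|, the growth of the squared L2 norms, or against k^2, the squared bound on the truncated
  transforms, and both leave the sum of (1+|k|)^(-1-2\<epsilon>). Only upper bounds are wanted,
  which is why Bessel's inequality suffices where Plancherel's identity would be expected.\<close>

lemma nn_integral_tendsto_le:
  fixes f :: "nat \<Rightarrow> 'a \<Rightarrow> ennreal"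
  assumes meas: "\<And>n. f n \<in> borel_measurable M"
    and lim: "AE x in M. (\<lambda>n. f n x) \<longlonglongrightarrow> F x"
    and le: "\<And>n. (\<integral>\<^sup>+x. f n x \<partial>M) \<le> B"
  shows "(\<integral>\<^sup>+x. F x \<partial>M) \<le> B"
proof -
  have "(\<integral>\<^sup>+x. F x \<partial>M) = (\<integral>\<^sup>+x. liminf (\<lambda>n. f n x) \<partial>M)"
    by (intro nn_integral_cong_AE eventually_mono[OF lim]) (simp add: lim_imp_Liminf)
  also have "\<dots> \<le> liminf (\<lambda>n. \<integral>\<^sup>+x. f n x \<partial>M)"
    by (rule nn_integral_liminf[OF meas])
  also have "\<dots> \<le> B"
    using le by (intro Liminf_le) auto
  finally show ?thesis .
qed

lemma tendsto_ennreal_norm_sq: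
  fixes a :: "'a::real_normed_vector"
  assumes "(f \<longlongrightarrow> a) F"
  shows "((\<lambda>n. ennreal ((norm (f n))\<^sup>2)) \<longlongrightarrow> ennreal ((norm a)\<^sup>2)) F"
  by (intro tendsto_ennrealI tendsto_power tendsto_norm assms)

lemma integral_FTC_line:
  fixes f F :: "real \<Rightarrow> 'a::euclidean_space"
  assumes F: "\<And>x. (F has_vector_derivative f x) (at x)"
    and f: "continuous_on UNIV f" "integrable lborel f"
    and lim: "(F \<longlongrightarrow> A) at_bot" "(F \<longlongrightarrow> B) at_top"
  shows "(LINT x|lborel. f x) = B - A"
proof -
  have "(LBINT x=-\<infinity>..\<infinity>. f x) = B - A"
    using assms
    by (intro interval_integral_FTC_integrable)
       (auto simp: continuous_on_eq_continuous_at set_integrable_def ereal_tendsto_simps)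
  then show ?thesis by (simp add: interval_lebesgue_integral_def set_lebesgue_integral_def)
qed

section \<open>The transform of integrable functions\<close>

definition fourier_L1 :: "(real \<Rightarrow> complex) \<Rightarrow> real \<Rightarrow> complex" where
  "fourier_L1 g k = (LINT x|lborel. exp (- (\<i> * of_real k * of_real x)) * g x)"

lemma norm_exp_imaginary [simp]: "norm (exp (- (\<i> * of_real k * of_real x))) = 1"
proof -
  have "exp (- (\<i> * of_real k * of_real x)) = exp (\<i> * of_real (- (k * x)))" by (simp add: mult.assoc)
  then show ?thesis by (simp only: norm_exp_i_times)
qed

lemma exp_mult_measurable [measurable]:
  assumes [measurable]: "g \<in> borel_measurable borel"
  shows "(\<lambda>x. exp (- (\<i> * of_real k * of_real x)) * g x :: complex) \<in> borel_measurable borel"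
proof -
  have [measurable]: "(\<lambda>x. exp (- (\<i> * of_real k * of_real x)) :: complex) \<in> borel_measurable borel"
    by (intro borel_measurable_continuous_onI continuous_intros)
  show ?thesis by measurable
qed

lemma integrable_exp_mult:
  assumes "integrable lborel g"
  shows "integrable lborel (\<lambda>x. exp (- (\<i> * of_real k * of_real x)) * g x :: complex)"
proof (rule Bochner_Integration.integrable_bound[OF assms])
  show "(\<lambda>x. exp (- (\<i> * of_real k * of_real x)) * g x :: complex) \<in> borel_measurable lborel"
    using borel_measurable_integrable[OF assms] by simp
qed (simp add: norm_mult)

lemma norm_fourier_L1_le:
  "norm (fourier_L1 g k) \<le> (LINT x|lborel. norm (g x))"
  unfolding fourier_L1_def
  by (rule order_trans[OF integral_norm_bound]) (simp add: norm_mult)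

lemma fourier_L1_diff:
  assumes "integrable lborel f" "integrable lborel g"
  shows "fourier_L1 (\<lambda>x. f x - g x) k = fourier_L1 f k - fourier_L1 g k"
  using integrable_exp_mult[OF assms(1), of k] integrable_exp_mult[OF assms(2), of k]
  by (simp add: fourier_L1_def right_diff_distrib)

lemma fourier_L1_add:
  assumes "integrable lborel f" "integrable lborel g"
  shows "fourier_L1 (\<lambda>x. f x + g x) k = fourier_L1 f k + fourier_L1 g k"
  using integrable_exp_mult[OF assms(1), of k] integrable_exp_mult[OF assms(2), of k]
  by (simp add: fourier_L1_def distrib_left)

lemma fourier_L1_measurable [measurable]:
  assumes [measurable]: "g \<in> borel_measurable borel"
  shows "fourier_L1 g \<in> borel_measurable borel"
proof -
  have [measurable]: "(\<lambda>p. exp (- (\<i> * of_real (fst p) * of_real (snd p))) :: complex)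
      \<in> borel_measurable (borel \<Otimes>\<^sub>M borel)"
    unfolding borel_prod by (intro borel_measurable_continuous_onI continuous_intros)
  have "(\<lambda>(k, x). exp (- (\<i> * of_real k * of_real x)) * g x)
      \<in> borel_measurable (borel \<Otimes>\<^sub>M lborel)"
    unfolding case_prod_beta by measurable
  then have "(\<lambda>k. LINT x|lborel. exp (- (\<i> * of_real k * of_real x)) * g x) \<in> borel_measurable borel"
    by (rule lborel.borel_measurable_lebesgue_integral)
  then show ?thesis by (simp add: fourier_L1_def[abs_def])
qed

text \<open>Presents a truncation as the transform of the cut-off function, so that linearity,
  measurability and the energy inequality of \<open>fourier_L1\<close> apply to it.\<close>

lemma truncated_fourier_eq:
  "truncated_fourier R f k = fourier_L1 (\<lambda>x. indicator {-R..R} x * f x) k"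
  unfolding truncated_fourier_def fourier_L1_def set_lebesgue_integral_def
  by (intro Bochner_Integration.integral_cong) (auto simp: indicator_def)

section \<open>Bessel's inequality and the energy bound\<close>

lemma integral_exp_orthogonal:
  assumes A: "A > 0"
  shows "(LINT x:{-A..A}|lborel. exp (\<i> * of_real (pi * of_int m / A * x)))
    = (if m = 0 then 2 * of_real A else 0)"
proof (cases "m = 0")
  case True
  then show ?thesis using A by (simp add: set_lebesgue_integral_def scaleR_conv_of_real)
next
  case False
  define w where "w = pi * of_int m / A"
  have w: "w \<noteq> 0" "w * A = pi * of_int m" using False A by (auto simp: w_def)
  have "(LINT x|lborel. indicator {-A..A} x *\<^sub>R exp (\<i> * of_real (w * x)))
     = exp (\<i> * of_real (w * A)) / (\<i> * of_real w) - exp (\<i> * of_real (w * (-A))) / (\<i> * of_real w)"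
    using A w
    by (intro integral_FTC_atLeastAtMost)
       (auto intro!: derivative_eq_intros continuous_intros has_vector_derivative_real_field simp: field_simps)
  \<comment> \<open>Since \<open>w * A\<close> is a multiple of pi, the two endpoint arguments
    differ by whole turns.\<close>
  also have "exp (\<i> * of_real (w * A)) = exp (\<i> * of_real (w * (-A)))"
  proof -
    have "\<i> * of_real (w * A) = \<i> * of_real (w * (-A)) + \<i> * of_real (2 * (w * A))"
      by (simp add: algebra_simps)
    also have "\<i> * complex_of_real (2 * (w * A)) = of_int m * (2 * of_real pi * \<i>)"
      unfolding w(2) by simp
    finally have "exp (\<i> * of_real (w * A)) = exp (\<i> * of_real (w * (-A))) * exp (of_int m * (2 * of_real pi * \<i>))"
      by (simp only: exp_add)
    also have "exp (of_int m * (2 * of_real pi * \<i>)) = 1"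
      using exp_integer_2pi[of "of_int m"] by (simp add: mult_ac)
    finally show ?thesis by simp
  qed
  finally show ?thesis using False by (simp add: set_lebesgue_integral_def w_def)
qed

text \<open>The values of the transform on the lattice are inner products of \<open>g\<close> with
  exponentials that are orthogonal on \<open>{-A..A}\<close> and have squared norm 2A. The function
  \<open>p\<close> is the projection of \<open>g\<close> onto their span; both cross terms and the
  squared norm of \<open>p\<close> equal T/(2A), so the squared distance from \<open>g\<close> to
  \<open>p\<close> is the squared norm of \<open>g\<close> minus T/(2A), and it is
  nonnegative.\<close>

lemma bessel_fourier_L1:
  fixes g :: "real \<Rightarrow> complex" and S :: "int set"
  assumes A: "A > 0" and g: "integrable lborel g" and g2: "integrable lborel (\<lambda>x. (norm (g x))\<^sup>2)"
    and supp: "\<And>x. x \<notin> {-A..A} \<Longrightarrow> g x = 0" and S: "finite S"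
  shows "(\<Sum>m\<in>S. (norm (fourier_L1 g (\<xi> + pi * m / A)))\<^sup>2) \<le> 2 * A * (LINT x|lborel. (norm (g x))\<^sup>2)"
proof -
  define w where "w m = \<xi> + pi * of_int m / A" for m :: int
  define \<phi> where "\<phi> m x = indicator {-A..A} x * exp (\<i> * of_real (w m) * of_real x)" for m x
  define c where "c m = fourier_L1 g (w m)" for m
  define p where "p x = (\<Sum>m\<in>S. c m / (2 * of_real A) * \<phi> m x)" for x
  have cnj_exp: "cnj (exp (\<i> * of_real a * of_real x)) = exp (- (\<i> * of_real a * of_real x))" for a x :: real
    by (simp add: exp_cnj)
  have c: "(g x * cnj (\<phi> m x)) = exp (- (\<i> * of_real (w m) * of_real x)) * g x" for m x
    using supp[of x] by (auto simp: \<phi>_def cnj_exp indicator_def)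
  have int_gphi: "integrable lborel (\<lambda>x. g x * cnj (\<phi> m x))" for m
    unfolding c by (rule integrable_exp_mult[OF g])
  have gphi: "(LINT x|lborel. g x * cnj (\<phi> m x)) = c m" for m
    unfolding c by (simp add: c_def fourier_L1_def)
  have pp: "\<phi> m x * cnj (\<phi> l x) = indicator {-A..A} x *\<^sub>R exp (\<i> * of_real (pi * of_int (m - l) / A * x))" for m l x
  proof -
    have "exp (\<i> * of_real (w m) * of_real x) * exp (- (\<i> * of_real (w l) * of_real x))
        = exp (\<i> * of_real (pi * of_int (m - l) / A * x))"
      by (simp flip: exp_add) (simp add: w_def field_simps diff_divide_distrib)
    then show ?thesis by (auto simp: \<phi>_def cnj_exp indicator_def)
  qed
  have int_pp: "integrable lborel (\<lambda>x. \<phi> m x * cnj (\<phi> l x))" for m l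
    unfolding pp set_integrable_def[symmetric]
    using A by (intro borel_integrable_atLeastAtMost' continuous_intros) auto
  have val_pp: "(LINT x|lborel. \<phi> m x * cnj (\<phi> l x)) = (if m = l then 2 * of_real A else 0)" for m l
    unfolding pp using integral_exp_orthogonal[OF A, of "m - l"] by (simp add: set_lebesgue_integral_def)
  have cnjp: "cnj (p x) = (\<Sum>m\<in>S. cnj (c m) / (2 * of_real A) * cnj (\<phi> m x))" for x
    by (simp add: p_def)
  have gp: "g x * cnj (p x) = (\<Sum>m\<in>S. cnj (c m) / (2 * of_real A) * (g x * cnj (\<phi> m x)))" for x
    unfolding cnjp by (simp add: sum_distrib_left mult_ac)
  have pcp: "p x * cnj (p x) = (\<Sum>m\<in>S. \<Sum>l\<in>S. c m * cnj (c l) / (4 * of_real (A\<^sup>2)) * (\<phi> m x * cnj (\<phi> l x)))" for x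
    unfolding cnjp unfolding p_def sum_product by (intro sum.cong refl) (simp add: power2_eq_square)
  define T where "T = (\<Sum>m\<in>S. (norm (c m))\<^sup>2)"
  have I1: "integrable lborel (\<lambda>x. g x * cnj (p x))" unfolding gp by (intro Bochner_Integration.integrable_sum integrable_mult_right int_gphi)
  have I1': "integrable lborel (\<lambda>x. p x * cnj (g x))" using integrable_cnj[OF I1] by (simp add: mult.commute)
  have I2: "integrable lborel (\<lambda>x. p x * cnj (p x))" unfolding pcp by (intro Bochner_Integration.integrable_sum integrable_mult_right int_pp)
  have I0: "integrable lborel (\<lambda>x. g x * cnj (g x))"
    using integrable_of_real[OF g2, where ?'a = complex] by (simp only: complex_norm_square)
  have v1: "(LINT x|lborel. g x * cnj (p x)) = of_real (T / (2 * A))"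
  proof -
    have "(LINT x|lborel. g x * cnj (p x)) = (\<Sum>m\<in>S. cnj (c m) / (2 * of_real A) * c m)"
      unfolding gp by (subst Bochner_Integration.integral_sum) (simp_all only: integral_mult_right_zero gphi integrable_mult_right int_gphi)
    then show ?thesis
      by (simp add: T_def sum_divide_distrib complex_norm_square mult_ac del: of_real_power)
  qed
  have v1': "(LINT x|lborel. p x * cnj (g x)) = of_real (T / (2 * A))"
  proof -
    have "(LINT x|lborel. p x * cnj (g x)) = (LINT x|lborel. cnj (g x * cnj (p x)))" by (simp add: mult.commute)
    also have "\<dots> = cnj (LINT x|lborel. g x * cnj (p x))" by (rule Bochner_Integration.integral_cnj)
    finally show ?thesis using v1 by simp
  qed
  have v2: "(LINT x|lborel. p x * cnj (p x)) = of_real (T / (2 * A))"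
  proof -
    have "(LINT x|lborel. p x * cnj (p x))
        = (\<Sum>m\<in>S. \<Sum>l\<in>S. c m * cnj (c l) / (4 * of_real (A\<^sup>2)) * (if m = l then 2 * of_real A else 0))"
      unfolding pcp by (simp add: Bochner_Integration.integral_sum int_pp val_pp integrable_mult_right)
    also have "\<dots> = (\<Sum>m\<in>S. c m * cnj (c m) / (4 * of_real (A\<^sup>2)) * (2 * of_real A))"
      using S by (simp add: if_distrib[where f = "\<lambda>y. _ * y"] cong: if_cong)
    also have "\<dots> = of_real (T / (2 * A))"
      unfolding T_def of_real_divide of_real_sum complex_norm_square sum_divide_distrib
      using A by (intro sum.cong refl) (simp add: power2_eq_square field_simps)
    finally show ?thesis .
  qed
  have "complex_of_real (LINT x|lborel. (norm (g x - p x))\<^sup>2)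
      = (LINT x|lborel. g x * cnj (g x) - g x * cnj (p x) - p x * cnj (g x) + p x * cnj (p x))"
    unfolding integral_complex_of_real[symmetric]
    by (intro Bochner_Integration.integral_cong refl) (simp only: complex_norm_square complex_cnj_diff ring_distribs diff_diff_eq2 diff_diff_eq, simp add: algebra_simps)
  also have "\<dots> = (LINT x|lborel. g x * cnj (g x)) - of_real (T / (2 * A))"
    using I0 I1 I1' I2 by (simp add: v1 v1' v2)
  also have "(LINT x|lborel. g x * cnj (g x)) = of_real (LINT x|lborel. (norm (g x))\<^sup>2)"
    unfolding integral_complex_of_real[symmetric] by (simp only: complex_norm_square)
  finally have "complex_of_real (LINT x|lborel. (norm (g x - p x))\<^sup>2)
      = of_real ((LINT x|lborel. (norm (g x))\<^sup>2) - T / (2 * A))" by simp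
  then have "(LINT x|lborel. (norm (g x))\<^sup>2) - T / (2 * A) = (LINT x|lborel. (norm (g x - p x))\<^sup>2)"
    unfolding of_real_eq_iff by (rule sym)
  also have "\<dots> \<ge> 0" by simp
  finally have "0 \<le> (LINT x|lborel. (norm (g x))\<^sup>2) - T / (2 * A)" .
  then show ?thesis using A by (simp add: T_def c_def w_def field_simps)
qed

text \<open>Bessel's inequality on \<open>{-A..A}\<close> holds for every shift of the frequency lattice
  \<open>\<pi>/A \<cdot> \<int>\<close>; integrating over the shifts turns the sum into an integral over the line.\<close>

lemma fourier_L1_energy_compact:
  fixes g :: "real \<Rightarrow> complex"
  assumes A: "A > 0" and g: "integrable lborel g" and g2: "integrable lborel (\<lambda>x. (norm (g x))\<^sup>2)"
    and supp: "\<And>x. x \<notin> {-A..A} \<Longrightarrow> g x = 0"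
  shows "(\<integral>\<^sup>+k. ennreal ((norm (fourier_L1 g k))\<^sup>2) \<partial>lborel) \<le> ennreal (2 * pi * (LINT x|lborel. (norm (g x))\<^sup>2))"
proof -
  have [measurable]: "g \<in> borel_measurable borel" using borel_measurable_integrable[OF g] by simp
  define d where "d = pi / A"
  have d: "d > 0" using A by (simp add: d_def)
  define h where "h k = ennreal ((norm (fourier_L1 g k))\<^sup>2)" for k
  have h [measurable]: "h \<in> borel_measurable borel" unfolding h_def by measurable
  define G where "G = (LINT x|lborel. (norm (g x))\<^sup>2)"
  have G0: "G \<ge> 0" by (simp add: G_def)
  have bound: "(\<integral>\<^sup>+k. h k * indicator {- real N * d..<real N * d} k \<partial>lborel) \<le> ennreal (2 * pi * G)" for N :: nat
  proof -
    \<comment> \<open>The window of half-width \<open>N * d\<close> consists of 2N lattice cells of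
      length \<open>d\<close>; translation by \<open>m * d\<close> carries \<open>{0..<d}\<close>
      onto cell \<open>m\<close>.\<close>
    let ?S = "{- int N..<int N}"
    have "h k * indicator {- real N * d..<real N * d} k \<le> (\<Sum>m\<in>?S. h k * indicator {of_int m * d..<(of_int m + 1) * d} k)" for k
    proof (cases "k \<in> {- real N * d..<real N * d}")
      case True
      define m where "m = \<lfloor>k / d\<rfloor>"
      have "- real N \<le> k / d" "k / d < real N" using True d by (auto simp: field_simps)
      then have m: "m \<in> ?S" unfolding m_def by (auto simp: le_floor_iff floor_less_iff)
      have "k \<in> {of_int m * d..<(of_int m + 1) * d}"
        using d floor_correct[of "k / d"] pos_le_divide_eq[OF d, of "of_int m" k] pos_divide_less_eq[OF d, of k "of_int m + 1"]
        unfolding m_def by simp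
      then have "h k * indicator {- real N * d..<real N * d} k = h k * indicator {of_int m * d..<(of_int m + 1) * d} k"
        using True by simp
      also have "\<dots> \<le> (\<Sum>m\<in>?S. h k * indicator {of_int m * d..<(of_int m + 1) * d} k)"
        by (rule member_le_sum[OF m]) auto
      finally show ?thesis .
    qed simp
    then have "(\<integral>\<^sup>+k. h k * indicator {- real N * d..<real N * d} k \<partial>lborel)
        \<le> (\<integral>\<^sup>+k. (\<Sum>m\<in>?S. h k * indicator {of_int m * d..<(of_int m + 1) * d} k) \<partial>lborel)"
      by (intro nn_integral_mono) auto
    also have "\<dots> = (\<Sum>m\<in>?S. \<integral>\<^sup>+k. h k * indicator {of_int m * d..<(of_int m + 1) * d} k \<partial>lborel)"
      by (rule nn_integral_sum) simp
    also have "\<dots> = (\<Sum>m\<in>?S. \<integral>\<^sup>+\<xi>. h (\<xi> + pi * of_int m / A) * indicator {0..<d} \<xi> \<partial>lborel)"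
    proof (intro sum.cong refl)
      fix m :: int
      have "(\<integral>\<^sup>+k. h k * indicator {of_int m * d..<(of_int m + 1) * d} k \<partial>lborel)
          = (\<integral>\<^sup>+\<xi>. h (of_int m * d + 1 * \<xi>) * indicator {of_int m * d..<(of_int m + 1) * d} (of_int m * d + 1 * \<xi>) \<partial>lborel)"
        using nn_integral_real_affine[of "\<lambda>k. h k * indicator {of_int m * d..<(of_int m + 1) * d} k" 1 "of_int m * d"] by simp
      also have "\<dots> = (\<integral>\<^sup>+\<xi>. h (\<xi> + pi * of_int m / A) * indicator {0..<d} \<xi> \<partial>lborel)"
        by (intro nn_integral_cong) (auto simp: indicator_def d_def algebra_simps)
      finally show "(\<integral>\<^sup>+k. h k * indicator {of_int m * d..<(of_int m + 1) * d} k \<partial>lborel)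
          = (\<integral>\<^sup>+\<xi>. h (\<xi> + pi * of_int m / A) * indicator {0..<d} \<xi> \<partial>lborel)" .
    qed
    also have "\<dots> = (\<integral>\<^sup>+\<xi>. (\<Sum>m\<in>?S. h (\<xi> + pi * of_int m / A) * indicator {0..<d} \<xi>) \<partial>lborel)"
      by (rule nn_integral_sum[symmetric]) simp
    also have "\<dots> \<le> (\<integral>\<^sup>+\<xi>. ennreal (2 * A * G) * indicator {0..<d} \<xi> \<partial>lborel)"
    proof (intro nn_integral_mono)
      fix \<xi> :: real
      have "(\<Sum>m\<in>?S. h (\<xi> + pi * of_int m / A)) = ennreal (\<Sum>m\<in>?S. (norm (fourier_L1 g (\<xi> + pi * m / A)))\<^sup>2)"
        by (simp add: h_def sum_ennreal)
      also have "\<dots> \<le> ennreal (2 * A * G)"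
        unfolding G_def by (intro ennreal_leI bessel_fourier_L1 assms) auto
      finally show "(\<Sum>m\<in>?S. h (\<xi> + pi * of_int m / A) * indicator {0..<d} \<xi>) \<le> ennreal (2 * A * G) * indicator {0..<d} \<xi>"
        by (auto simp: indicator_def)
    qed
    also have "\<dots> = ennreal (2 * A * G) * ennreal d"
      using d by (simp add: nn_integral_cmult_indicator)
    \<comment> \<open>Here \<open>2 * A * d = 2 * pi\<close>: the size of the support cancels, which
      lets the bound survive when the support grows.\<close>
    also have "\<dots> = ennreal (2 * pi * G)"
      using A G0 d by (simp add: d_def flip: ennreal_mult)
    finally show ?thesis .
  qed
  have "(\<integral>\<^sup>+k. h k \<partial>lborel) \<le> ennreal (2 * pi * G)"
  proof (rule nn_integral_tendsto_le[OF _ _ bound])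
    show "AE k in lborel. (\<lambda>N. h k * indicator {- real N * d..<real N * d} k) \<longlonglongrightarrow> h k"
    proof (intro AE_I2 tendsto_eventually)
      fix k
      obtain n :: nat where n: "\<bar>k\<bar> / d < real n" using reals_Archimedean2 by blast
      show "\<forall>\<^sub>F N in sequentially. h k * indicator {- real N * d..<real N * d} k = h k"
        using eventually_ge_at_top[of n]
      proof eventually_elim
        case (elim N)
        then have "\<bar>k\<bar> / d < real N" using n by linarith
        then have "\<bar>k\<bar> < real N * d" using d by (simp add: field_simps)
        then have "k \<in> {- real N * d..<real N * d}" by auto
        then show ?case by simp
      qed
    qed
  qed simp
  then show ?thesis by (simp add: h_def G_def)
qed

lemma fourier_L1_tendsto:
  assumes "\<And>n. integrable lborel (g n)" "integrable lborel f"
    and "(\<lambda>n. LINT x|lborel. norm (g n x - f x)) \<longlonglongrightarrow> 0"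
  shows "(\<lambda>n. fourier_L1 (g n) k) \<longlonglongrightarrow> fourier_L1 f k"
proof (rule Lim_null[THEN iffD2], rule Lim_null_comparison[OF _ assms(3)], intro always_eventually allI)
  fix n
  show "norm (fourier_L1 (g n) k - fourier_L1 f k) \<le> (LINT x|lborel. norm (g n x - f x))"
    using norm_fourier_L1_le[of "\<lambda>x. g n x - f x" k] assms by (simp add: fourier_L1_diff)
qed

lemma fourier_L1_truncated_tendsto:
  assumes g: "integrable lborel g"
  shows "((\<lambda>R. fourier_L1 (\<lambda>x. indicator {-R..R} x * g x) k) \<longlongrightarrow> fourier_L1 g k) at_top"
proof -
  have [measurable]: "g \<in> borel_measurable borel" using borel_measurable_integrable[OF g] by simp
  show ?thesis unfolding fourier_L1_def
  proof (rule integral_dominated_convergence_at_top[where w = "\<lambda>x. norm (g x)"])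
    show "integrable lborel (\<lambda>x. norm (g x))" using g by simp
    show "AE x in lborel. ((\<lambda>R. exp (- (\<i> * of_real k * of_real x)) * (indicator {-R..R} x * g x)) \<longlongrightarrow>
        exp (- (\<i> * of_real k * of_real x)) * g x) at_top"
    proof (intro AE_I2 tendsto_eventually)
      fix x :: real
      show "\<forall>\<^sub>F R in at_top. exp (- (\<i> * of_real k * of_real x)) * (indicator {-R..R} x * g x) = exp (- (\<i> * of_real k * of_real x)) * g x"
        using eventually_ge_at_top[of "\<bar>x\<bar>"] by eventually_elim (auto simp: indicator_def)
    qed
    show "\<forall>\<^sub>F R in at_top. AE x in lborel. norm (exp (- (\<i> * of_real k * of_real x)) * (indicator {-R..R} x * g x)) \<le> norm (g x)"
      by (intro always_eventually allI AE_I2) (auto simp: norm_mult indicator_def)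
  qed measurable
qed

text \<open>The constant of the compactly supported case does not depend on the support, and the
  transforms of the truncations converge pointwise; Fatou's lemma passes the bound to the
  limit.\<close>

lemma fourier_L1_energy:
  fixes g :: "real \<Rightarrow> complex"
  assumes g: "integrable lborel g" and g2: "integrable lborel (\<lambda>x. (norm (g x))\<^sup>2)"
  shows "(\<integral>\<^sup>+k. ennreal ((norm (fourier_L1 g k))\<^sup>2) \<partial>lborel) \<le> ennreal (2 * pi * (LINT x|lborel. (norm (g x))\<^sup>2))"
proof -
  have [measurable]: "g \<in> borel_measurable borel" using borel_measurable_integrable[OF g] by simp
  \<comment> \<open>The summand 1 keeps the half-length positive for n = 0, as the compact case
    demands.\<close>
  define h where "h n x = indicator {- (real n + 1)..real n + 1} x * g x" for n x
  have h2: "(norm (h n x))\<^sup>2 = indicator {- (real n + 1)..real n + 1} x *\<^sub>R (norm (g x))\<^sup>2" for n x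
    by (auto simp: h_def indicator_def)
  have hi: "integrable lborel (h n)" for n
    unfolding h_def by (rule Bochner_Integration.integrable_bound[OF g]) (auto simp: indicator_def)
  have h2i: "integrable lborel (\<lambda>x. (norm (h n x))\<^sup>2)" for n
    unfolding h2 by (rule integrable_mult_indicator[OF _ g2]) auto
  have le: "(LINT x|lborel. (norm (h n x))\<^sup>2) \<le> (LINT x|lborel. (norm (g x))\<^sup>2)" for n
    by (intro integral_mono h2i g2) (auto simp: h2 indicator_def)
  have lim: "filterlim (\<lambda>n. real n + 1) at_top sequentially"
    by real_asymp
  show ?thesis
  proof (rule nn_integral_tendsto_le[where f = "\<lambda>n k. ennreal ((norm (fourier_L1 (h n) k))\<^sup>2)"])
    show "AE k in lborel. (\<lambda>n. ennreal ((norm (fourier_L1 (h n) k))\<^sup>2)) \<longlonglongrightarrow> ennreal ((norm (fourier_L1 g k))\<^sup>2)"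
      unfolding h_def
      by (intro AE_I2 tendsto_ennreal_norm_sq filterlim_compose[OF fourier_L1_truncated_tendsto[OF g] lim])
    show "(\<integral>\<^sup>+k. ennreal ((norm (fourier_L1 (h n) k))\<^sup>2) \<partial>lborel) \<le> ennreal (2 * pi * (LINT x|lborel. (norm (g x))\<^sup>2))" for n
    proof -
      have "(\<integral>\<^sup>+k. ennreal ((norm (fourier_L1 (h n) k))\<^sup>2) \<partial>lborel) \<le> ennreal (2 * pi * (LINT x|lborel. (norm (h n x))\<^sup>2))"
        by (rule fourier_L1_energy_compact[OF _ hi h2i, of "real n + 1"]) (auto simp: h_def)
      also have "\<dots> \<le> ennreal (2 * pi * (LINT x|lborel. (norm (g x))\<^sup>2))"
        using le[of n] by (intro ennreal_leI mult_left_mono) auto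
      finally show ?thesis .
    qed
  qed (unfold h_def, measurable)
qed

text \<open>Riesz-Fischer with an explicit rate. A subsequence with summable increments converges
  almost everywhere to an integrable \<open>G\<close>; Fatou's lemma along that subsequence shows
  that the whole sequence approaches \<open>G\<close> at the Cauchy rate \<open>b\<close>.\<close>

lemma L1_complete:
  fixes g :: "nat \<Rightarrow> 'a \<Rightarrow> complex"
  assumes int: "\<And>n. integrable M (g n)"
    and cauchy: "\<And>m n. n \<le> m \<Longrightarrow> (LINT x|M. norm (g m x - g n x)) \<le> b n"
    and b: "b \<longlonglongrightarrow> (0::real)"
  obtains G where "integrable M G" "\<And>n. (LINT x|M. norm (g n x - G x)) \<le> b n"
proof -
  have "\<exists>n. \<forall>m\<ge>n. \<bar>b m\<bar> < (1/2) ^ k" for k :: nat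
    using LIMSEQ_D[OF b, of "(1/2) ^ k"] by auto
  then obtain s where s: "\<And>k m. m \<ge> s k \<Longrightarrow> \<bar>b m\<bar> < (1/2) ^ k" by metis
  \<comment> \<open>Cumulative sums make the indices increasing; the summand \<open>k\<close> makes
    them unbounded, which the Fatou argument below relies on.\<close>
  define r where "r k = (\<Sum>i\<le>k. s i) + k" for k
  have r_s: "r k \<ge> s k" and r_k: "r k \<ge> k" and r_Suc: "r k \<le> r (Suc k)" for k
    by (auto simp: r_def intro: trans_le_add1 member_le_sum)
  define h where "h k x = g (r (Suc k)) x - g (r k) x" for k x
  have hi: "integrable M (h k)" for k unfolding h_def by (intro Bochner_Integration.integrable_diff int)
  have hb: "(LINT x|M. norm (h k x)) \<le> (1/2) ^ k" for k
    using cauchy[OF r_Suc[of k]] s[OF r_s[of k]] by (simp add: h_def)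
  have summ: "summable (\<lambda>k. LINT x|M. norm (h k x))"
    by (rule summable_comparison_test'[OF summable_geometric[of "1/2::real"], of 0]) (use hb in auto)
  have AEs: "AE x in M. summable (\<lambda>k. norm (h k x))"
  proof -
    have "(\<integral>\<^sup>+x. (\<Sum>k. ennreal (norm (h k x))) \<partial>M) = (\<Sum>k. \<integral>\<^sup>+x. ennreal (norm (h k x)) \<partial>M)"
      using borel_measurable_integrable[OF hi] by (intro nn_integral_suminf) auto
    also have "\<dots> = (\<Sum>k. ennreal (LINT x|M. norm (h k x)))"
      using hi by (intro suminf_cong nn_integral_eq_integral) auto
    also have "\<dots> = ennreal (\<Sum>k. LINT x|M. norm (h k x))"
      by (rule suminf_ennreal2[OF _ summ]) simp
    finally have "(\<integral>\<^sup>+x. (\<Sum>k. ennreal (norm (h k x))) \<partial>M) \<noteq> \<infinity>" by simp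
    then have "AE x in M. (\<Sum>k. ennreal (norm (h k x))) \<noteq> \<infinity>"
      using borel_measurable_integrable[OF hi] by (intro nn_integral_PInf_AE) auto
    then show ?thesis by (rule eventually_mono) (auto intro: summable_suminf_not_top)
  qed
  define G where "G x = g (r 0) x + (\<Sum>k. h k x)" for x
  have Gi: "integrable M G"
    unfolding G_def using integrable_suminf[OF hi AEs summ] int by simp
  have conv: "AE x in M. (\<lambda>k. g (r k) x) \<longlonglongrightarrow> G x"
    using AEs
  proof eventually_elim
    case (elim x)
    have "(\<lambda>k. \<Sum>i<k. h i x) \<longlonglongrightarrow> (\<Sum>k. h k x)"
      using summable_norm_cancel[OF elim] by (rule summable_LIMSEQ)
    then have "(\<lambda>k. g (r 0) x + (\<Sum>i<k. h i x)) \<longlonglongrightarrow> G x" unfolding G_def by (intro tendsto_intros)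
    moreover have "g (r 0) x + (\<Sum>i<k. h i x) = g (r k) x" for k
      unfolding h_def using sum_lessThan_telescope[of "\<lambda>i. g (r i) x" k] by simp
    ultimately show ?case by simp
  qed
  have "(LINT x|M. norm (g n x - G x)) \<le> b n" for n
  proof -
    have b0: "0 \<le> b n" using cauchy[of n n] by simp
    have "(\<integral>\<^sup>+x. ennreal (norm (g n x - G x)) \<partial>M) \<le> ennreal (b n)"
    \<comment> \<open>Starting the subsequence at \<open>k + n\<close> ensures
      \<open>r (k + n) \<ge> n\<close>, so the Cauchy bound with rate \<open>b n\<close> applies to
      every term.\<close>
    proof (rule nn_integral_tendsto_le[where f = "\<lambda>k x. ennreal (norm (g n x - g (r (k + n)) x))"])
      show "AE x in M. (\<lambda>k. ennreal (norm (g n x - g (r (k + n)) x))) \<longlonglongrightarrow> ennreal (norm (g n x - G x))"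
        using conv by eventually_elim (intro tendsto_ennrealI tendsto_norm tendsto_diff tendsto_const LIMSEQ_ignore_initial_segment)
      show "(\<integral>\<^sup>+x. ennreal (norm (g n x - g (r (k + n)) x)) \<partial>M) \<le> ennreal (b n)" for k
      proof -
        have "n \<le> r (k + n)" using r_k[of "k + n"] by simp
        then have "(LINT x|M. norm (g n x - g (r (k + n)) x)) \<le> b n"
          using cauchy[of n "r (k + n)"] by (simp add: norm_minus_commute)
        then show ?thesis using int by (subst nn_integral_eq_integral) (auto intro: ennreal_leI)
      qed
    qed (use borel_measurable_integrable[OF int] in auto)
    then show ?thesis using int Gi b0 by (subst (asm) nn_integral_eq_integral) auto
  qed
  with Gi show ?thesis using that by blast
qed

section \<open>Fourier series on the circle\<close>

lemma exp_i_powi: "exp (\<i> * complex_of_real \<theta>) powi k = exp (\<i> * of_int k * of_real \<theta>)"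
  by (simp add: exp_power_int mult_ac)

lemma exp_i_sphere [simp]: "exp (\<i> * complex_of_real \<theta>) \<in> sphere 0 1"
  by simp

lemma sphere_exp_i_obtain:
  fixes z :: complex
  assumes "z \<in> sphere 0 1"
  obtains \<theta> where "0 \<le> \<theta>" "\<theta> < 2 * pi" "z = exp (\<i> * of_real \<theta>)"
  using assms that[of "Arg2pi z"] Arg2pi[of z] by (simp add: is_Arg_def)

lemma continuous_on_circle_compose:
  assumes "continuous_on (sphere 0 1) (H :: complex \<Rightarrow> 'a::topological_space)"
  shows "continuous_on X (\<lambda>\<theta>. H (exp (\<i> * complex_of_real \<theta>)))"
  by (rule continuous_on_compose2[OF assms]) (auto intro!: continuous_intros)

lemma integral_exp_int_circle:
  "integral {0..2 * pi} (\<lambda>\<theta>. exp (\<i> * of_int k * of_real \<theta>)) = (if k = 0 then 2 * of_real pi else 0)"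
proof (cases "k = 0")
  case False
  have "((\<lambda>\<theta>. exp (\<i> * of_int k * of_real \<theta>)) has_integral
      exp (\<i> * of_int k * of_real (2 * pi)) / (\<i> * of_int k) - exp (\<i> * of_int k * of_real 0) / (\<i> * of_int k)) {0..2 * pi}"
  proof (intro fundamental_theorem_of_calculus)
    fix \<theta>
    have "((\<lambda>z. exp (\<i> * of_int k * z) / (\<i> * of_int k)) has_field_derivative exp (\<i> * of_int k * of_real \<theta>)) (at (of_real \<theta>))"
      using False by (auto intro!: derivative_eq_intros)
    from has_vector_derivative_real_field[OF this]
    show "((\<lambda>\<theta>. exp (\<i> * of_int k * of_real \<theta>) / (\<i> * of_int k)) has_vector_derivative exp (\<i> * of_int k * of_real \<theta>)) (at \<theta> within {0..2 * pi})"
      by (rule has_vector_derivative_at_within)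
  qed simp
  moreover have "exp (\<i> * of_int k * of_real (2 * pi)) = 1"
    using exp_integer_2pi[of "of_int k"] by (simp add: mult_ac)
  ultimately show ?thesis using False by (simp add: integral_unique)
qed (simp add: scaleR_conv_of_real)

text \<open>On the circle a real linear function of z is a combination of z and 1/z, so multiplying
  by it shifts the frequency by one in either direction and preserves the vanishing of all
  coefficients. \<open>H\<close> is generalised in the induction because a product is absorbed one
  factor at a time.\<close>

lemma circle_coeffs_zero_mult:
  assumes "real_polynomial_function (g :: complex \<Rightarrow> real)"
    and "continuous_on (sphere 0 1) H"
    and "\<And>k::int. integral {0..2 * pi} (\<lambda>\<theta>. H (exp (\<i> * of_real \<theta>)) * exp (\<i> * of_int k * of_real \<theta>)) = 0"
  shows "integral {0..2 * pi} (\<lambda>\<theta>. (of_real (g (exp (\<i> * of_real \<theta>))) * H (exp (\<i> * of_real \<theta>))) * exp (\<i> * of_int k * of_real \<theta>)) = 0"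
  using assms
proof (induction g arbitrary: H k rule: real_polynomial_function.induct)
  case (linear g)
  \<comment> \<open>The coefficients of z and 1/z in
    \<open>cos \<theta> * g 1 + sin \<theta> * g \<i>\<close>.\<close>
  define \<alpha> where "\<alpha> = (of_real (g 1) - \<i> * of_real (g \<i>)) / 2"
  define \<gamma> where "\<gamma> = (of_real (g 1) + \<i> * of_real (g \<i>)) / 2"
  have g: "complex_of_real (g (exp (\<i> * of_real \<theta>))) = \<alpha> * exp (\<i> * of_real \<theta>) + \<gamma> * exp (- (\<i> * of_real \<theta>))" for \<theta>
  proof -
    have "g (exp (\<i> * of_real \<theta>)) = g (cos \<theta> *\<^sub>R 1 + sin \<theta> *\<^sub>R \<i>)"
      by (simp add: exp_Euler scaleR_conv_of_real cos_of_real sin_of_real mult.commute)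
    also have "\<dots> = cos \<theta> * g 1 + sin \<theta> * g \<i>"
      using linear(1) by (simp add: linear_add linear_scale bounded_linear.linear)
    finally have "complex_of_real (g (exp (\<i> * of_real \<theta>))) = cos (of_real \<theta>) * of_real (g 1) + sin (of_real \<theta>) * of_real (g \<i>)"
      by (simp add: cos_of_real sin_of_real)
    then show ?thesis by (simp add: \<alpha>_def \<gamma>_def exp_Euler exp_minus_Euler field_simps)
  qed
  have "(of_real (g (exp (\<i> * of_real \<theta>))) * H (exp (\<i> * of_real \<theta>))) * exp (\<i> * of_int k * of_real \<theta>)
     = \<alpha> * (H (exp (\<i> * of_real \<theta>)) * exp (\<i> * of_int (k + 1) * of_real \<theta>))
     + \<gamma> * (H (exp (\<i> * of_real \<theta>)) * exp (\<i> * of_int (k - 1) * of_real \<theta>))" for \<theta>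
  proof -
    have "exp (\<i> * of_int (k + 1) * of_real \<theta>) = exp (\<i> * of_real \<theta>) * exp (\<i> * of_int k * of_real \<theta>)"
      "exp (\<i> * of_int (k - 1) * of_real \<theta>) = exp (- (\<i> * of_real \<theta>)) * exp (\<i> * of_int k * of_real \<theta>)"
      by (simp_all flip: exp_add add: algebra_simps)
    then show ?thesis unfolding g by (simp only:) (simp add: algebra_simps)
  qed
  note eq = this
  have "(\<lambda>\<theta>. H (exp (\<i> * of_real \<theta>)) * exp (\<i> * of_int m * of_real \<theta>)) integrable_on {0..2*pi}" for m :: int
    by (intro integrable_continuous_real continuous_intros continuous_on_circle_compose linear)
  then show ?case
    unfolding eq by (subst integral_add) (simp_all only: integrable_on_mult_right integral_mult_right linear(3), simp)
next
  case (const c)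
  then show ?case by (simp add: mult.assoc)
next
  case (add f g)
  have int: "(\<lambda>\<theta>. (of_real (h (exp (\<i> * of_real \<theta>))) * H (exp (\<i> * of_real \<theta>))) * exp (\<i> * of_int k * of_real \<theta>)) integrable_on {0..2*pi}"
    if "real_polynomial_function h" for h
    using that
    by (intro integrable_continuous_real continuous_intros continuous_on_circle_compose add
        continuous_on_compose2[OF continuous_on_polymonial_function, of h _ "\<lambda>\<theta>. exp (\<i> * of_real \<theta>)"])
       (auto simp: real_polynomial_function_eq)
  show ?case
    using add(3,4)[OF add(5,6), of k] int[OF add(1)] int[OF add(2)] by (simp add: distrib_right integral_add)
next
  case (mult f g)
  have "continuous_on (sphere 0 1) (\<lambda>z. of_real (g z) * H z)"
    using continuous_on_polymonial_function[of g "sphere 0 1"] mult(2,5)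
    by (intro continuous_intros) (auto simp: real_polynomial_function_eq)
  then show ?case
    using mult(3)[of "\<lambda>z. of_real (g z) * H z" k] mult(4)[OF mult(5,6)] by (simp add: mult.assoc)
qed

text \<open>By Stone-Weierstrass, real polynomial functions are uniformly dense in the real
  continuous functions on the circle, so \<open>H\<close> integrates to 0 against each of these.
  Testing with the real and imaginary parts of \<open>H\<close> itself gives vanishing integral of
  |H|^2.\<close>

lemma circle_coeffs_zero_imp_zero:
  assumes H: "continuous_on (sphere 0 1) H"
    and zero: "\<And>k::int. integral {0..2 * pi} (\<lambda>\<theta>. H (exp (\<i> * of_real \<theta>)) * exp (\<i> * of_int k * of_real \<theta>)) = 0"
    and z: "z \<in> sphere 0 1"
  shows "H z = (0::complex)"
proof -
  note cont = continuous_on_circle_compose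
  obtain B where B: "B > 0" "\<And>z. z \<in> sphere 0 1 \<Longrightarrow> norm (H z) \<le> B"
    using compact_imp_bounded[OF compact_continuous_image[OF H compact_sphere]]
    by (auto simp: bounded_pos)
  have real0: "integral {0..2 * pi} (\<lambda>\<theta>. of_real (h (exp (\<i> * of_real \<theta>))) * H (exp (\<i> * of_real \<theta>))) = 0"
    if h: "continuous_on (sphere 0 1) h" for h :: "complex \<Rightarrow> real"
  proof (rule ccontr)
    let ?I = "\<lambda>h. integral {0..2 * pi} (\<lambda>\<theta>. of_real (h (exp (\<i> * of_real \<theta>))) * H (exp (\<i> * of_real \<theta>)))"
    assume ne: "?I h \<noteq> 0"
    \<comment> \<open>Chosen so that the approximation error \<open>e * B * 2 * pi\<close> is half
      of the integral assumed nonzero.\<close>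
    define e where "e = norm (?I h) / (4 * pi * B)"
    have e: "e > 0" using ne B by (simp add: e_def)
    obtain g where g: "real_polynomial_function g" "\<And>x. x \<in> sphere 0 1 \<Longrightarrow> \<bar>h x - g x\<bar> < e"
      using Stone_Weierstrass_real_polynomial_function[OF compact_sphere h e] by metis
    have gc: "continuous_on (sphere 0 1) g"
      using g(1) by (intro continuous_on_polymonial_function) (auto simp: real_polynomial_function_eq)
    have "?I h = ?I h - ?I g"
      using circle_coeffs_zero_mult[OF g(1) H zero, of 0] by simp
    also have "\<dots> = integral {0..2 * pi} (\<lambda>\<theta>. of_real (h (exp (\<i> * of_real \<theta>)) - g (exp (\<i> * of_real \<theta>))) * H (exp (\<i> * of_real \<theta>)))"
      by (subst integral_diff[symmetric])
         (auto intro!: integrable_continuous_real continuous_intros cont H h gc simp: left_diff_distrib)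
    also have "norm \<dots> \<le> e * B * (2 * pi - 0)"
    proof (rule integral_bound)
      show "continuous_on {0..2 * pi} (\<lambda>\<theta>. of_real (h (exp (\<i> * of_real \<theta>)) - g (exp (\<i> * of_real \<theta>))) * H (exp (\<i> * of_real \<theta>)))"
        by (intro continuous_intros cont H h gc)
      show "norm (of_real (h (exp (\<i> * of_real \<theta>)) - g (exp (\<i> * of_real \<theta>))) * H (exp (\<i> * of_real \<theta>))) \<le> e * B" for \<theta>
        unfolding norm_mult norm_of_real
        using g(2)[OF exp_i_sphere, of \<theta>] B(1) B(2)[OF exp_i_sphere, of \<theta>] by (intro mult_mono) auto
    qed simp
    also have "\<dots> = norm (?I h) / 2" using B(1) by (simp add: e_def field_simps)
    finally show False using ne by simp
  qed
  let ?E = "\<lambda>\<theta>. exp (\<i> * complex_of_real \<theta>)"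
  \<comment> \<open>|H|^2 is the conjugate of H times H, and the conjugate is Re H - i Im H; each
    part is a real continuous multiplier.\<close>
  have "integral {0..2 * pi} (\<lambda>\<theta>. of_real ((norm (H (?E \<theta>)))\<^sup>2)) =
      integral {0..2 * pi} (\<lambda>\<theta>. of_real (Re (H (?E \<theta>))) * H (?E \<theta>) - \<i> * (of_real (Im (H (?E \<theta>))) * H (?E \<theta>)))"
  proof (intro integral_cong)
    fix \<theta>
    show "complex_of_real ((norm (H (?E \<theta>)))\<^sup>2) = of_real (Re (H (?E \<theta>))) * H (?E \<theta>) - \<i> * (of_real (Im (H (?E \<theta>))) * H (?E \<theta>))"
      unfolding cmod_power2 by (simp add: complex_eq_iff power2_eq_square)
  qed
  also have "\<dots> = 0"
  proof (subst integral_diff)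
    show "(\<lambda>\<theta>. of_real (Re (H (?E \<theta>))) * H (?E \<theta>)) integrable_on {0..2 * pi}"
      "(\<lambda>\<theta>. \<i> * (of_real (Im (H (?E \<theta>))) * H (?E \<theta>))) integrable_on {0..2 * pi}"
      by (intro integrable_continuous_real continuous_intros cont H)+
    show "integral {0..2 * pi} (\<lambda>\<theta>. of_real (Re (H (?E \<theta>))) * H (?E \<theta>))
        - integral {0..2 * pi} (\<lambda>\<theta>. \<i> * (of_real (Im (H (?E \<theta>))) * H (?E \<theta>))) = 0"
      unfolding integral_mult_right real0[OF continuous_on_Re[OF H]] real0[OF continuous_on_Im[OF H]] by simp
  qed
  finally have "integral {0..2 * pi} (\<lambda>\<theta>. complex_of_real ((norm (H (?E \<theta>)))\<^sup>2)) = 0" .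
  moreover have "((\<lambda>\<theta>. complex_of_real ((norm (H (?E \<theta>)))\<^sup>2)) has_integral of_real (integral {0..2 * pi} (\<lambda>\<theta>. (norm (H (?E \<theta>)))\<^sup>2))) {0..2*pi}"
    by (intro has_integral_of_real integrable_integral integrable_continuous_real continuous_intros cont H)
  ultimately have "integral {0..2 * pi} (\<lambda>\<theta>. (norm (H (?E \<theta>)))\<^sup>2) = 0"
    by (simp add: integral_unique)
  then have "\<forall>\<theta>\<in>{0..2*pi}. (norm (H (?E \<theta>)))\<^sup>2 = 0"
    by (subst (asm) integral_eq_0_iff) (auto intro!: continuous_intros cont H)
  moreover obtain \<theta> where "0 \<le> \<theta>" "\<theta> < 2 * pi" "z = ?E \<theta>" using sphere_exp_i_obtain[OF z] .
  ultimately show ?thesis by simp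
qed

text \<open>Absolute summability makes the series converge uniformly to a continuous
  \<open>G\<close>. Integrating term by term shows that \<open>G\<close> has the coefficients
  \<open>a\<close>, and continuous functions with equal coefficients agree everywhere on the
  circle.\<close>

lemma circle_fourier_series:
  fixes \<Phi> :: "complex \<Rightarrow> complex"
  assumes \<Phi>: "continuous_on (sphere 0 1) \<Phi>"
    and a: "\<And>k::int. a k = 1 / (2 * of_real pi) * integral {0..2 * pi} (\<lambda>\<theta>. exp (- (\<i> * of_int k * of_real \<theta>)) * \<Phi> (exp (\<i> * of_real \<theta>)))"
    and summ: "(\<lambda>k. norm (a k)) summable_on UNIV"
    and z: "z \<in> sphere 0 1"
  shows "((\<lambda>k. a k * z powi k) has_sum \<Phi> z) UNIV"
proof -
  let ?E = "\<lambda>\<theta>. exp (\<i> * complex_of_real \<theta>)"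
  define G where "G z = (\<Sum>\<^sub>\<infinity>k\<in>UNIV. a k * z powi k)" for z
  have norm_le: "norm (a k * z powi k) \<le> norm (a k)" if "z \<in> sphere 0 1" for k z
    using that by (simp add: norm_mult norm_power_int)
  have u: "uniform_limit (sphere 0 1) (\<lambda>X z. \<Sum>k\<in>X. a k * z powi k) G (finite_subsets_at_top UNIV)"
    unfolding G_def by (rule Weierstrass_m_test_general[OF norm_le summ])
  have contP: "continuous_on (sphere 0 1) (\<lambda>z. \<Sum>k\<in>X. a k * z powi k)" for X
    by (intro continuous_intros) auto
  have Gc: "continuous_on (sphere 0 1) G"
    by (rule uniform_limit_theorem[OF _ u]) (auto intro!: always_eventually contP)
  have Gint: "integral {0..2 * pi} (\<lambda>\<theta>. G (?E \<theta>) * exp (\<i> * of_int m * of_real \<theta>)) = 2 * of_real pi * a (- m)" for m :: int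
  proof -
    have u2: "uniform_limit {0..2 * pi} (\<lambda>X \<theta>. (\<Sum>k\<in>X. a k * ?E \<theta> powi k) * exp (\<i> * of_int m * of_real \<theta>))
        (\<lambda>\<theta>. G (?E \<theta>) * exp (\<i> * of_int m * of_real \<theta>)) (finite_subsets_at_top UNIV)"
    proof (rule uniform_lim_mult)
      show "uniform_limit {0..2 * pi} (\<lambda>X \<theta>. \<Sum>k\<in>X. a k * ?E \<theta> powi k) (\<lambda>\<theta>. G (?E \<theta>)) (finite_subsets_at_top UNIV)"
        using u by (rule uniform_limit_compose') auto
      show "uniform_limit {0..2 * pi} (\<lambda>X \<theta>. exp (\<i> * of_int m * of_real \<theta>)) (\<lambda>\<theta>. exp (\<i> * of_int m * of_real \<theta>)) (finite_subsets_at_top UNIV)"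
        by (rule uniform_limit_const)
      show "bounded ((\<lambda>\<theta>. G (?E \<theta>)) ` {0..2 * pi})"
        by (intro compact_imp_bounded compact_continuous_image continuous_on_circle_compose Gc) auto
      show "bounded ((\<lambda>\<theta>. exp (\<i> * of_int m * of_real \<theta>)) ` {0..2 * pi})"
        by (intro compact_imp_bounded compact_continuous_image continuous_intros) auto
    qed
    obtain I J where IJ: "\<And>X. ((\<lambda>\<theta>. (\<Sum>k\<in>X. a k * ?E \<theta> powi k) * exp (\<i> * of_int m * of_real \<theta>)) has_integral I X) {0..2*pi}"
      "((\<lambda>\<theta>. G (?E \<theta>) * exp (\<i> * of_int m * of_real \<theta>)) has_integral J) {0..2*pi}"
      "(I \<longlongrightarrow> J) (finite_subsets_at_top UNIV)"
      by (rule uniform_limit_integral[OF u2]) (auto intro!: continuous_intros)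
    \<comment> \<open>The test factor carries frequency \<open>+m\<close>, so it selects the
      coefficient of index \<open>-m\<close>; once \<open>X\<close> contains that index the integral
      no longer changes.\<close>
    have "\<forall>\<^sub>F X in finite_subsets_at_top UNIV. I X = 2 * of_real pi * a (- m)"
    proof (rule eventually_mono)
      show "\<forall>\<^sub>F X in finite_subsets_at_top UNIV. finite X \<and> {- m} \<subseteq> X \<and> X \<subseteq> UNIV"
        unfolding eventually_finite_subsets_at_top by (intro exI[of _ "{- m}"]) auto
      fix X assume X: "finite X \<and> {- m} \<subseteq> X \<and> X \<subseteq> UNIV"
      have "I X = integral {0..2*pi} (\<lambda>\<theta>. \<Sum>k\<in>X. a k * exp (\<i> * of_int (k + m) * of_real \<theta>))"
        unfolding integral_unique[OF IJ(1), symmetric] exp_i_powi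
        unfolding sum_distrib_right
        by (intro integral_cong sum.cong refl) (simp add: ring_distribs exp_add mult_ac)
      also have "\<dots> = (\<Sum>k\<in>X. a k * integral {0..2*pi} (\<lambda>\<theta>. exp (\<i> * of_int (k + m) * of_real \<theta>)))"
        using X by (subst integral_sum) (auto intro!: integrable_continuous_real continuous_intros)
      also have "\<dots> = (\<Sum>k\<in>X. if k = - m then 2 * of_real pi * a (- m) else 0)"
        unfolding integral_exp_int_circle by (intro sum.cong) (auto simp: add_eq_0_iff2)
      also have "\<dots> = 2 * of_real pi * a (- m)" using X by simp
      finally show "I X = 2 * of_real pi * a (- m)" .
    qed
    then have "(I \<longlongrightarrow> 2 * of_real pi * a (- m)) (finite_subsets_at_top UNIV)"
      by (rule tendsto_eventually)
    then have "J = 2 * of_real pi * a (- m)"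
      using IJ(3) tendsto_unique finite_subsets_at_top_neq_bot by blast
    then show ?thesis using IJ(2) by (simp add: integral_unique)
  qed
  have "\<Phi> z - G z = 0"
  proof (rule circle_coeffs_zero_imp_zero[where H = "\<lambda>z. \<Phi> z - G z"])
    show "continuous_on (sphere 0 1) (\<lambda>z. \<Phi> z - G z)" by (intro continuous_intros \<Phi> Gc)
    fix k :: int
    have "integral {0..2 * pi} (\<lambda>\<theta>. (\<Phi> (?E \<theta>) - G (?E \<theta>)) * exp (\<i> * of_int k * of_real \<theta>))
        = integral {0..2 * pi} (\<lambda>\<theta>. \<Phi> (?E \<theta>) * exp (\<i> * of_int k * of_real \<theta>)) - 2 * of_real pi * a (- k)"
      unfolding left_diff_distrib Gint[symmetric]
      by (rule integral_diff) (intro integrable_continuous_real continuous_intros continuous_on_circle_compose \<Phi> Gc)+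
    also have "\<dots> = 0" unfolding a by (simp add: mult.commute)
    finally show "integral {0..2 * pi} (\<lambda>\<theta>. (\<Phi> (?E \<theta>) - G (?E \<theta>)) * exp (\<i> * of_int k * of_real \<theta>)) = 0" .
  qed (rule z)
  moreover have "((\<lambda>k. a k * z powi k) has_sum G z) UNIV"
  proof -
    have "(\<lambda>k. norm (a k * z powi k)) summable_on UNIV"
      by (rule Infinite_Sum.abs_summable_on_comparison_test[OF summ]) (simp add: norm_le[OF z])
    from has_sum_infsum[OF Infinite_Sum.abs_summable_summable[OF this]]
    show ?thesis by (simp only: G_def)
  qed
  ultimately show ?thesis by simp
qed


section \<open>The Moebius map between line and circle\<close>

lemma moebius_inv_real:
  assumes "z \<in> sphere 0 1" "z \<noteq> 1"
  shows "complex_of_real (Re (moebius_inv \<beta> z)) = moebius_inv \<beta> z"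
proof -
  obtain \<theta> where \<theta>: "0 \<le> \<theta>" "\<theta> < 2 * pi" "z = exp (\<i> * of_real \<theta>)"
    using sphere_exp_i_obtain[OF assms(1)] .
  with assms(2) have "0 < \<theta>" by (cases "\<theta> = 0") auto
  then show ?thesis using of_real_circle_to_line[of \<theta> \<beta>] \<theta> by (simp add: circle_to_line_def)
qed

lemma moebius_inv_moebius:
  assumes "\<beta> > 0"
  shows "moebius_inv \<beta> (moebius \<beta> (of_real x)) = of_real x"
proof -
  have ne: "complex_of_real x + \<i> * of_real \<beta> \<noteq> 0"
    using assms by (simp add: complex_eq_iff)
  have 1: "moebius \<beta> (of_real x) + 1 = 2 * of_real x / (of_real x + \<i> * of_real \<beta>)"
    "moebius \<beta> (of_real x) - 1 = - 2 * \<i> * of_real \<beta> / (of_real x + \<i> * of_real \<beta>)"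
    using ne by (simp_all add: moebius_def field_simps)
  show ?thesis unfolding moebius_inv_def 1 using ne assms by (simp add: field_simps)
qed

lemma norm_moebius [simp]:
  assumes "\<beta> > 0"
  shows "norm (moebius \<beta> (of_real x)) = 1"
proof -
  have ne: "complex_of_real x + \<i> * of_real \<beta> \<noteq> 0"
    using assms by (simp add: complex_eq_iff)
  have "norm (complex_of_real x - \<i> * of_real \<beta>) = norm (complex_of_real x + \<i> * of_real \<beta>)"
    by (simp add: cmod_def)
  then show ?thesis using ne by (simp add: moebius_def norm_divide)
qed

lemma moebius_neq_1:
  assumes "\<beta> > 0"
  shows "moebius \<beta> (of_real x) \<noteq> 1"
proof -
  have ne: "complex_of_real x + \<i> * of_real \<beta> \<noteq> 0"
    using assms by (simp add: complex_eq_iff)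
  show ?thesis using assms by (simp add: moebius_def divide_eq_1_iff ne)
qed

lemma moebius_eq_exp_i_obtain:
  assumes "\<beta> > 0"
  obtains \<theta> where "0 < \<theta>" "\<theta> < 2 * pi" "moebius \<beta> (of_real x) = exp (\<i> * of_real \<theta>)" "circle_to_line \<beta> \<theta> = x"
proof -
  obtain \<theta> where \<theta>: "0 \<le> \<theta>" "\<theta> < 2 * pi" "moebius \<beta> (of_real x) = exp (\<i> * of_real \<theta>)"
    using sphere_exp_i_obtain[of "moebius \<beta> (of_real x)"] assms by auto
  have "\<theta> \<noteq> 0" using moebius_neq_1[OF assms, of x] \<theta> by auto
  moreover have "circle_to_line \<beta> \<theta> = x"
    unfolding circle_to_line_def \<theta>(3)[symmetric] moebius_inv_moebius[OF assms] by simp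
  ultimately show ?thesis using \<theta> that[of \<theta>] by simp
qed

text \<open>The decay of \<open>f\<close> is what makes \<open>\<Phi>\<close> continuous at z = 1,
  where the inverse Moebius map has its pole. The value 0 given to \<open>pullback\<close> at the
  endpoints matches this extension.\<close>

lemma pullback_circle_extension:
  assumes \<beta>: "\<beta> > 0" and f: "continuous_on UNIV f" and lim: "(f \<longlongrightarrow> 0) at_infinity"
  defines "\<Phi> \<equiv> \<lambda>z. if z = 1 then 0 else f (Re (moebius_inv \<beta> z))"
  shows "continuous_on (sphere 0 1) \<Phi>"
    and "\<And>\<theta>. 0 \<le> \<theta> \<Longrightarrow> \<theta> \<le> 2 * pi \<Longrightarrow> pullback \<beta> f \<theta> = \<Phi> (exp (\<i> * of_real \<theta>))"
proof -
  show "continuous_on (sphere 0 1) \<Phi>"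
    unfolding continuous_on_def
  proof
    fix z :: complex assume z: "z \<in> sphere 0 1"
    show "(\<Phi> \<longlongrightarrow> \<Phi> z) (at z within sphere 0 1)"
    proof (cases "z = 1")
      case False
      have "((\<lambda>z. f (Re (moebius_inv \<beta> z))) \<longlongrightarrow> f (Re (moebius_inv \<beta> z))) (at z within sphere 0 1)"
        unfolding moebius_inv_def
        using False f by (intro isCont_tendsto_compose[of _ f] tendsto_intros) (auto simp: continuous_on_eq_continuous_at)
      moreover have "\<forall>\<^sub>F w in at z within sphere 0 1. f (Re (moebius_inv \<beta> w)) = \<Phi> w"
        using eventually_neq_at_within[of 1 z "sphere 0 1"] by eventually_elim (simp add: \<Phi>_def)
      ultimately show ?thesis
        using False by (simp add: \<Phi>_def cong: Lim_cong_within) (erule Lim_transform_eventually, simp add: \<Phi>_def)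
    next
      case True
      have "filterlim (\<lambda>w. Re (moebius_inv \<beta> w)) at_infinity (at z within sphere 0 1)"
      proof (subst filterlim_at_infinity_conv_norm_at_top)
        have "filterlim (\<lambda>w. norm (moebius_inv \<beta> w)) at_top (at z within sphere 0 1)"
        proof (subst filterlim_at_infinity_conv_norm_at_top[symmetric], unfold moebius_inv_def)
          have "filterlim (\<lambda>w. (w + 1) / (w - 1)) at_infinity (at z within sphere 0 1)"
            using True
            by (intro filterlim_divide_at_infinity[of _ 2] filterlim_atI)
               (auto intro!: tendsto_eq_intros simp: eventually_at_filter)
          then show "filterlim (\<lambda>w. of_real \<beta> / \<i> * ((w + 1) / (w - 1))) at_infinity (at z within sphere 0 1)"
            using \<beta> by (intro tendsto_mult_filterlim_at_infinity[OF tendsto_const]) auto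
        qed
        \<comment> \<open>A real part may stay bounded while the modulus diverges; on the circle it
          cannot, because the inverse map is real there.\<close>
        moreover have "\<forall>\<^sub>F w in at z within sphere 0 1. norm (moebius_inv \<beta> w) = norm (Re (moebius_inv \<beta> w))"
          unfolding eventually_at_filter
        proof (intro always_eventually allI impI)
          fix w assume "w \<noteq> z" "w \<in> sphere 0 1"
          then show "norm (moebius_inv \<beta> w) = norm (Re (moebius_inv \<beta> w))"
            using moebius_inv_real[of w \<beta>] True by (metis norm_of_real real_norm_def)
        qed
        ultimately show "filterlim (\<lambda>w. norm (Re (moebius_inv \<beta> w))) at_top (at z within sphere 0 1)"
          by (rule filterlim_mono_eventually[OF _ order_refl order_refl])
      qed
      then have "((\<lambda>w. f (Re (moebius_inv \<beta> w))) \<longlongrightarrow> 0) (at z within sphere 0 1)"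
        by (rule filterlim_compose[OF lim])
      moreover have "\<forall>\<^sub>F w in at z within sphere 0 1. f (Re (moebius_inv \<beta> w)) = \<Phi> w"
        using True by (auto simp: eventually_at_filter \<Phi>_def)
      ultimately have "(\<Phi> \<longlongrightarrow> 0) (at z within sphere 0 1)" by (rule Lim_transform_eventually)
      then show ?thesis using True by (simp add: \<Phi>_def)
    qed
  qed
  fix \<theta> assume \<theta>: "0 \<le> \<theta>" "\<theta> \<le> 2 * pi"
  show "pullback \<beta> f \<theta> = \<Phi> (exp (\<i> * of_real \<theta>))"
  proof (cases "0 < \<theta> \<and> \<theta> < 2 * pi")
    case True
    then show ?thesis
      using exp_i_neq_1[of \<theta>] by (simp add: pullback_def \<Phi>_def circle_to_line_def)
  next
    case False
    with \<theta> have "\<theta> = 0 \<or> \<theta> = 2 * pi" by linarith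
    moreover have "exp (\<i> * complex_of_real (2 * pi)) = 1"
      using exp_integer_2pi[of 1] by (simp add: mult_ac)
    ultimately have "exp (\<i> * complex_of_real \<theta>) = 1" by auto
    then show ?thesis using False by (auto simp: pullback_def \<Phi>_def)
  qed
qed

text \<open>Convergence is needed at every angle, endpoints included: aliasing evaluates the series
  at the nodes, and 0 is one of them.\<close>

lemma pullback_has_sum:
  assumes \<beta>: "\<beta> > 0" and f: "continuous_on UNIV f" and lim: "(f \<longlongrightarrow> 0) at_infinity"
    and summ: "(\<lambda>k. norm (fourier_coeff (pullback \<beta> f) k)) summable_on UNIV"
    and \<theta>: "0 \<le> \<theta>" "\<theta> \<le> 2 * pi"
  shows "((\<lambda>k. fourier_coeff (pullback \<beta> f) k * exp (\<i> * of_int k * of_real \<theta>)) has_sum pullback \<beta> f \<theta>) UNIV"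
proof -
  define \<Phi> where "\<Phi> = (\<lambda>z. if z = 1 then 0 else f (Re (moebius_inv \<beta> z)))"
  have \<Phi>: "continuous_on (sphere 0 1) \<Phi>"
    "\<And>\<theta>. 0 \<le> \<theta> \<Longrightarrow> \<theta> \<le> 2 * pi \<Longrightarrow> pullback \<beta> f \<theta> = \<Phi> (exp (\<i> * of_real \<theta>))"
    using pullback_circle_extension[OF \<beta> f lim] by (simp_all add: \<Phi>_def)
  have "fourier_coeff (pullback \<beta> f) k
      = 1 / (2 * of_real pi) * integral {0..2 * pi} (\<lambda>\<theta>. exp (- (\<i> * of_int k * of_real \<theta>)) * \<Phi> (exp (\<i> * of_real \<theta>)))" for k
  proof -
    let ?h = "\<lambda>\<theta>. exp (- (\<i> * of_int k * of_real \<theta>)) * \<Phi> (exp (\<i> * of_real \<theta>))"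
    have c: "continuous_on {0..2 * pi} ?h" by (intro continuous_intros continuous_on_circle_compose \<Phi>)
    have "(LINT \<theta>:{0..<2 * pi}|lborel. exp (- (\<i> * of_int k * of_real \<theta>)) * pullback \<beta> f \<theta>)
        = (LINT \<theta>:{0..<2 * pi}|lborel. ?h \<theta>)"
      unfolding set_lebesgue_integral_def using \<Phi>(2)
      by (intro Bochner_Integration.integral_cong) (auto simp: indicator_def)
    also have "\<dots> = (LINT \<theta>:{0..2 * pi}|lborel. ?h \<theta>)"
      by (rule set_integral_discrete_difference[of "{2 * pi}"]) auto
    also have "\<dots> = integral {0..2 * pi} ?h"
      by (intro set_borel_integral_eq_integral(2) borel_integrable_atLeastAtMost' c)
    finally show ?thesis by (simp add: fourier_coeff_def)
  qed
  from circle_fourier_series[OF \<Phi>(1) this summ exp_i_sphere[of \<theta>]]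
  show ?thesis unfolding exp_i_powi using \<Phi>(2)[OF \<theta>] by simp
qed

section \<open>Laurent polynomials in the Moebius map\<close>

lemma exp_imaginary_has_vector_derivative:
  "((\<lambda>x. exp (- (\<i> * of_real k * of_real x)) :: complex) has_vector_derivative
     - (\<i> * of_real k) * exp (- (\<i> * of_real k * of_real x))) (at x)"
proof -
  have "((\<lambda>z. exp (- (\<i> * of_real k * z))) has_field_derivative
      - (\<i> * of_real k) * exp (- (\<i> * of_real k * of_real x))) (at (of_real x))"
    by (auto intro!: derivative_eq_intros)
  from has_vector_derivative_real_field[OF this] show ?thesis by (simp add: o_def)
qed

lemma fourier_L1_deriv:
  assumes der: "\<And>x. (g has_vector_derivative g' x) (at x)" and cont: "continuous_on UNIV g'"
    and int: "integrable lborel g" "integrable lborel g'"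
    and lim: "(g \<longlongrightarrow> 0) at_bot" "(g \<longlongrightarrow> 0) at_top"
  shows "fourier_L1 g' k = \<i> * of_real k * fourier_L1 g k"
proof -
  let ?e = "\<lambda>x. exp (- (\<i> * of_real k * of_real x)) :: complex"
  note e = exp_imaginary_has_vector_derivative[of k]
  have gc: "continuous_on UNIV g"
    by (intro differentiable_imp_continuous_on differentiable_at_imp_differentiable_on) (use der in \<open>auto intro: differentiableI_vector\<close>)
  have null: "((\<lambda>x. ?e x * g x) \<longlongrightarrow> 0) F" if "(g \<longlongrightarrow> 0) F" for F
    using tendsto_norm[OF that] by (intro tendsto_norm_zero_cancel[of "\<lambda>x. ?e x * g x"]) (simp add: norm_mult)
  have "(LINT x|lborel. ?e x * g' x + (- (\<i> * of_real k) * ?e x) * g x) = 0 - 0"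
  proof (rule integral_FTC_line)
    show "((\<lambda>x. ?e x * g x) has_vector_derivative ?e x * g' x + (- (\<i> * of_real k) * ?e x) * g x) (at x)" for x
      by (rule has_vector_derivative_mult[OF e der])
    show "continuous_on UNIV (\<lambda>x. ?e x * g' x + (- (\<i> * of_real k) * ?e x) * g x)"
      by (intro continuous_intros cont gc)
    show "integrable lborel (\<lambda>x. ?e x * g' x + (- (\<i> * of_real k) * ?e x) * g x)"
      using integrable_exp_mult[OF int(1), of k] integrable_exp_mult[OF int(2), of k] by (simp add: mult.assoc)
  qed (use null lim in auto)
  moreover have "(LINT x|lborel. ?e x * g' x + (- (\<i> * of_real k) * ?e x) * g x)
      = fourier_L1 g' k - \<i> * of_real k * fourier_L1 g k"
    using integrable_exp_mult[OF int(1), of k] integrable_exp_mult[OF int(2), of k]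
    by (simp add: mult.assoc fourier_L1_def)
  ultimately show ?thesis by simp
qed

text \<open>This kernel is the common majorant: with width \<beta> for derivatives of Laurent
  polynomials, with width \<beta>|m| for the square of M^m - 1 and for its remainder after the 1/x
  term. The integral does not depend on the width, which is why the latter bounds grow only linearly
  in |m|.\<close>

lemma
  assumes b: "b > (0::real)"
  shows integrable_poisson: "integrable lborel (\<lambda>x. b / (x\<^sup>2 + b\<^sup>2))"
    and integral_poisson: "(LINT x|lborel. b / (x\<^sup>2 + b\<^sup>2)) = pi"
proof -
  have D: "((\<lambda>x. arctan (x / b)) has_real_derivative b / (x\<^sup>2 + b\<^sup>2)) (at x)" for x
    using b by (auto intro!: derivative_eq_intros simp: field_simps power2_eq_square)
  have lim: "((\<lambda>x. arctan (x / b)) \<longlongrightarrow> pi / 2) at_top" "((\<lambda>x. arctan (x / b)) \<longlongrightarrow> - pi / 2) at_bot"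
    using b by real_asymp+
  have pos: "x\<^sup>2 + b\<^sup>2 \<noteq> 0" for x using b by (simp add: sum_power2_eq_zero_iff)
  have "set_integrable lborel (einterval (-\<infinity>) \<infinity>) (\<lambda>x. b / (x\<^sup>2 + b\<^sup>2))"
    "(LBINT x=-\<infinity>..\<infinity>. b / (x\<^sup>2 + b\<^sup>2)) = pi / 2 - (- pi / 2)"
    using D b pos lim
    by (intro interval_integral_FTC_nonneg[where F = "\<lambda>x. arctan (x / b)"]; force simp: ereal_tendsto_simps intro!: continuous_intros)+
  then show "integrable lborel (\<lambda>x. b / (x\<^sup>2 + b\<^sup>2))" "(LINT x|lborel. b / (x\<^sup>2 + b\<^sup>2)) = pi"
    by (simp_all add: set_integrable_def interval_lebesgue_integral_def set_lebesgue_integral_def)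
qed

lemma sum_shift_support:
  fixes g :: "int \<Rightarrow> 'a::comm_monoid_add"
  assumes "finite T" "S \<subseteq> (\<lambda>k. k + a) ` T" "\<And>k. k \<notin> S \<Longrightarrow> g k = 0"
  shows "(\<Sum>k\<in>T. g (k + a)) = (\<Sum>k\<in>S. g k)"
proof -
  have "(\<Sum>k\<in>T. g (k + a)) = (\<Sum>k\<in>(\<lambda>k. k + a) ` T. g k)" by (subst sum.reindex) (auto simp: inj_on_def)
  also have "\<dots> = (\<Sum>k\<in>S. g k)" using assms by (intro sum.mono_neutral_right) auto
  finally show ?thesis .
qed

section \<open>The angle measure on the line\<close>

locale cayley =
  fixes \<beta> :: real
  assumes \<beta>_pos: "\<beta> > 0"
begin

abbreviation M :: "real \<Rightarrow> complex" where "M x \<equiv> moebius \<beta> (of_real x)"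

text \<open>The density \<open>d\<theta>/dx\<close> of the angle \<open>\<theta> = T\<^sup>-\<^sup>1(x)\<close>.\<close>

definition angle_density :: "real \<Rightarrow> real" where "angle_density x = 2 * \<beta> / (x\<^sup>2 + \<beta>\<^sup>2)"

lemma denom_ne0: "complex_of_real x + \<i> * of_real \<beta> \<noteq> 0"
  using \<beta>_pos by (simp add: complex_eq_iff)

lemma sq_plus_pos: "x\<^sup>2 + \<beta>\<^sup>2 > 0"
  using \<beta>_pos by (simp add: add_nonneg_pos)

lemma norm_M [simp]: "norm (M x) = 1" by (rule norm_moebius[OF \<beta>_pos])

lemma M_ne0 [simp]: "M x \<noteq> 0" using norm_M[of x] by force

lemma norm_M_powi [simp]: "norm (M x powi k) = 1" by (simp add: norm_power_int)

lemma one_minus_M: "1 - M x = 2 * \<i> * of_real \<beta> / (of_real x + \<i> * of_real \<beta>)"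
  using denom_ne0[of x] by (simp add: moebius_def field_simps)

lemma norm_one_minus_M_sq: "(norm (1 - M x))\<^sup>2 = 2 * \<beta> * angle_density x"
proof -
  have "(norm (complex_of_real x + \<i> * of_real \<beta>))\<^sup>2 = x\<^sup>2 + \<beta>\<^sup>2" by (simp add: cmod_power2)
  then show ?thesis
    using \<beta>_pos by (simp add: one_minus_M norm_divide norm_mult power_divide angle_density_def power2_eq_square)
qed

lemma angle_density_nonneg [simp]: "angle_density x \<ge> 0"
  using \<beta>_pos sq_plus_pos[of x] by (simp add: angle_density_def)

lemma angle_density_le: "angle_density x \<le> 2 / \<beta>"
  using \<beta>_pos sq_plus_pos[of x] by (simp add: angle_density_def field_simps power2_eq_square)

lemma continuous_angle_density: "continuous_on X angle_density"
  unfolding angle_density_def[abs_def] using sq_plus_pos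
  by (intro continuous_intros) (metis less_irrefl)

lemma angle_density_measurable [measurable]: "angle_density \<in> borel_measurable borel"
  by (intro borel_measurable_continuous_onI continuous_angle_density)

lemma integrable_angle_density [simp]: "integrable lborel angle_density"
  and integral_angle_density: "(LINT x|lborel. angle_density x) = 2 * pi"
proof -
  have eq: "angle_density = (\<lambda>x. 2 * (\<beta> / (x\<^sup>2 + \<beta>\<^sup>2)))" by (simp add: angle_density_def fun_eq_iff)
  show "integrable lborel angle_density" "(LINT x|lborel. angle_density x) = 2 * pi"
    unfolding eq integral_mult_right_zero integral_poisson[OF \<beta>_pos]
    by (intro integrable_mult_right integrable_poisson[OF \<beta>_pos]) simp
qed

text \<open>Two forms of M'. The left one shows the modulus, as |M| = 1; the right one is a
  polynomial in M, so it acts on coefficients.\<close>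

lemma M_deriv_eq: "\<i> * of_real (angle_density x) * M x = (1 - M x)\<^sup>2 / (2 * \<i> * of_real \<beta>)"
proof -
  have 1: "complex_of_real (x\<^sup>2 + \<beta>\<^sup>2) = (of_real x + \<i> * of_real \<beta>) * (of_real x - \<i> * of_real \<beta>)"
    by (simp add: complex_eq_iff power2_eq_square)
  have "complex_of_real (x\<^sup>2 + \<beta>\<^sup>2) \<noteq> 0" using sq_plus_pos[of x] by (metis less_irrefl of_real_eq_0_iff)
  then have ne: "complex_of_real x - \<i> * of_real \<beta> \<noteq> 0" unfolding 1 by simp
  have alg: "\<i> * (2 * b / (d * e)) * (e / d) = (2 * \<i> * b / d)\<^sup>2 / (2 * \<i> * b)" if "d \<noteq> 0" "e \<noteq> 0" "b \<noteq> 0" for b d e :: complex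
    using that by (simp add: field_simps power2_eq_square)
  show ?thesis
    using alg[OF denom_ne0[of x] ne, of "of_real \<beta>"] \<beta>_pos
    unfolding one_minus_M unfolding moebius_def angle_density_def of_real_divide 1 by simp
qed

lemma M_has_vector_derivative: "(M has_vector_derivative \<i> * of_real (angle_density x) * M x) (at x)"
proof -
  have "(moebius \<beta> has_field_derivative (1 - M x)\<^sup>2 / (2 * \<i> * of_real \<beta>)) (at (of_real x))"
  proof -
    have "(moebius \<beta> has_field_derivative (1 * (of_real x + \<i> * of_real \<beta>) - (of_real x - \<i> * of_real \<beta>) * 1)
        / ((of_real x + \<i> * of_real \<beta>) * (of_real x + \<i> * of_real \<beta>))) (at (of_real x))"
      unfolding moebius_def[abs_def] using denom_ne0[of x] by (intro DERIV_divide) (auto intro!: derivative_eq_intros)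
    moreover have "2 * (\<i> * b) / (d * d) = (2 * \<i> * b / d)\<^sup>2 / (2 * \<i> * b)" if "d \<noteq> 0" "b \<noteq> 0" for b d :: complex
      using that by (simp add: field_simps power2_eq_square)
    from this[OF denom_ne0[of x], of "of_real \<beta>"]
    have "(1 * (of_real x + \<i> * of_real \<beta>) - (of_real x - \<i> * of_real \<beta>) * 1)
        / ((of_real x + \<i> * of_real \<beta>) * (of_real x + \<i> * of_real \<beta>)) = (1 - M x)\<^sup>2 / (2 * \<i> * of_real \<beta>)"
      unfolding one_minus_M using \<beta>_pos by simp
    ultimately show ?thesis by simp
  qed
  from has_vector_derivative_real_field[OF this] show ?thesis by (simp add: o_def M_deriv_eq)
qed

lemma continuous_M: "continuous_on X M"
  by (rule differentiable_imp_continuous_on, rule differentiable_at_imp_differentiable_on)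
     (auto intro: differentiableI_vector[OF M_has_vector_derivative])

lemma M_powi_has_vector_derivative:
  "((\<lambda>x. M x powi k) has_vector_derivative \<i> * of_int k * of_real (angle_density x) * M x powi k) (at x)"
proof -
  have "((\<lambda>z. z powi k) has_field_derivative of_int k * M x powi (k - 1) * 1) (at (M x))"
    by (intro DERIV_power_int DERIV_ident) simp
  from field_vector_diff_chain_at[OF M_has_vector_derivative this]
  have "((\<lambda>x. M x powi k) has_vector_derivative \<i> * of_real (angle_density x) * M x * (of_int k * M x powi (k - 1))) (at x)"
    by (simp add: o_def)
  moreover have "M x powi k = M x * M x powi (k - 1)"
    using power_int_add_1[of "M x" "k - 1"] by (simp add: mult.commute)
  ultimately show ?thesis by (simp add: mult_ac)
qed

lemma M_tendsto_1: "(M \<longlongrightarrow> 1) at_top" "(M \<longlongrightarrow> 1) at_bot"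
proof -
  have "((\<lambda>x. norm (M x - 1)) \<longlongrightarrow> 0) F" if "((\<lambda>x. sqrt (2 * \<beta> * (2 * \<beta> / (x\<^sup>2 + \<beta>\<^sup>2)))) \<longlongrightarrow> 0) F" for F
  proof -
    have "norm (M x - 1) = sqrt (2 * \<beta> * (2 * \<beta> / (x\<^sup>2 + \<beta>\<^sup>2)))" for x
      using norm_one_minus_M_sq[of x] by (metis angle_density_def norm_ge_zero norm_minus_commute real_sqrt_abs abs_of_nonneg)
    then show ?thesis using that by simp
  qed
  moreover have "((\<lambda>x. sqrt (2 * \<beta> * (2 * \<beta> / (x\<^sup>2 + \<beta>\<^sup>2)))) \<longlongrightarrow> 0) at_top"
    "((\<lambda>x. sqrt (2 * \<beta> * (2 * \<beta> / (x\<^sup>2 + \<beta>\<^sup>2)))) \<longlongrightarrow> 0) at_bot"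
    using \<beta>_pos by real_asymp+
  ultimately show "(M \<longlongrightarrow> 1) at_top" "(M \<longlongrightarrow> 1) at_bot"
    by (auto simp: Lim_null[of M] tendsto_norm_zero_iff)
qed

lemma M_powi_tendsto_1: "((\<lambda>x. M x powi k) \<longlongrightarrow> 1) at_top" "((\<lambda>x. M x powi k) \<longlongrightarrow> 1) at_bot"
  using tendsto_power_int[OF M_tendsto_1(1), of k] tendsto_power_int[OF M_tendsto_1(2), of k] by simp_all

lemma continuous_M_powi: "continuous_on X (\<lambda>x. M x powi k)"
  by (intro continuous_on_power_int continuous_M) simp

text \<open>The orthogonality of the exponentials, carried to the line by d\<theta> =
  \<open>angle_density\<close> dx. For k ~= 0 the function M^k/(ik) is a primitive, and its limits
  at both ends of the line coincide because M tends to 1 at both.\<close>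

lemma
  shows integrable_density_M_powi: "integrable lborel (\<lambda>x. of_real (angle_density x) * M x powi k)"
    and integral_density_M_powi:
      "(LINT x|lborel. of_real (angle_density x) * M x powi k) = (if k = 0 then 2 * of_real pi else 0)"
proof -
  have c: "continuous_on UNIV (\<lambda>x. of_real (angle_density x) * M x powi k)"
    by (intro continuous_intros continuous_M_powi continuous_angle_density)
  show i: "integrable lborel (\<lambda>x. of_real (angle_density x) * M x powi k)"
    by (rule Bochner_Integration.integrable_bound[OF integrable_angle_density])
       (use borel_measurable_continuous_onI[OF c] in \<open>auto simp: norm_mult\<close>)
  show "(LINT x|lborel. of_real (angle_density x) * M x powi k) = (if k = 0 then 2 * of_real pi else 0)"
  proof (cases "k = 0")
    case True
    then show ?thesis by (simp add: integral_angle_density)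
  next
    case False
    have "(LINT x|lborel. of_real (angle_density x) * M x powi k) = 1 / (\<i> * of_int k) * 1 - 1 / (\<i> * of_int k) * 1"
    proof (rule integral_FTC_line[OF _ c i])
      show "((\<lambda>x. 1 / (\<i> * of_int k) * M x powi k) has_vector_derivative of_real (angle_density x) * M x powi k) (at x)" for x
        using has_vector_derivative_mult_right[OF M_powi_has_vector_derivative[of k x], of "1 / (\<i> * of_int k)"] False
        by (simp add: mult_ac)
    qed (intro tendsto_intros M_powi_tendsto_1)+
    then show ?thesis using False by simp
  qed
qed

text \<open>Parseval's identity in the angle variable; conjugation turns M^l into M^(-l).\<close>

lemma
  fixes q :: "int \<Rightarrow> complex"
  assumes S: "finite S"
  defines "Q \<equiv> \<lambda>x. \<Sum>k\<in>S. q k * M x powi k"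
  shows integrable_density_laurent_sq: "integrable lborel (\<lambda>x. angle_density x * (norm (Q x))\<^sup>2)"
    and integral_density_laurent_sq:
      "(LINT x|lborel. angle_density x * (norm (Q x))\<^sup>2) = 2 * pi * (\<Sum>k\<in>S. (norm (q k))\<^sup>2)"
proof -
  have cnjM: "cnj (M x powi l) = M x powi (- l)" for x l
  proof -
    have "M x * cnj (M x) = 1" by (simp flip: complex_norm_square)
    then have "cnj (M x) = inverse (M x)" by (metis inverse_unique)
    then show ?thesis by (simp add: power_int_minus power_int_inverse)
  qed
  have eq: "complex_of_real (angle_density x * (norm (Q x))\<^sup>2)
      = (\<Sum>k\<in>S. \<Sum>l\<in>S. (q k * cnj (q l)) * (of_real (angle_density x) * M x powi (k - l)))" for x
  proof -
    have "M x powi (k - l) = M x powi k * M x powi (- l)" for k l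
      by (simp flip: power_int_add)
    then have t: "of_real (angle_density x) * ((q k * M x powi k) * cnj (q l * M x powi l))
       = (q k * cnj (q l)) * (of_real (angle_density x) * M x powi (k - l))" for k l
      unfolding complex_cnj_mult cnjM by simp
    show ?thesis
      unfolding of_real_mult complex_norm_square Q_def cnj_sum sum_product
      unfolding sum_distrib_left t ..
  qed
  have i: "integrable lborel (\<lambda>x. complex_of_real (angle_density x * (norm (Q x))\<^sup>2))"
    unfolding eq by (intro Bochner_Integration.integrable_sum integrable_mult_right integrable_density_M_powi)
  then show "integrable lborel (\<lambda>x. angle_density x * (norm (Q x))\<^sup>2)"
    using integrable_Re by fastforce
  have "complex_of_real (LINT x|lborel. angle_density x * (norm (Q x))\<^sup>2)
      = (\<Sum>k\<in>S. \<Sum>l\<in>S. (q k * cnj (q l)) * (if k = l then 2 * of_real pi else 0))"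
    unfolding integral_complex_of_real[symmetric] eq
    by (simp add: Bochner_Integration.integral_sum integrable_density_M_powi integral_density_M_powi integrable_mult_right)
  also have "\<dots> = of_real (2 * pi * (\<Sum>k\<in>S. (norm (q k))\<^sup>2))"
    using S by (simp add: if_distrib[where f = "\<lambda>y. _ * y"] sum_distrib_left cong: if_cong)
      (simp add: complex_norm_square mult_ac flip: of_real_power)
  finally show "(LINT x|lborel. angle_density x * (norm (Q x))\<^sup>2) = 2 * pi * (\<Sum>k\<in>S. (norm (q k))\<^sup>2)"
    unfolding of_real_eq_iff .
qed

text \<open>A sum over an infinite set is 0, so only finitely supported families carry meaning;
  \<open>laurent_eq\<close> lets any finite superset of the support serve as the index set.\<close>

definition laurent :: "(int \<Rightarrow> complex) \<Rightarrow> real \<Rightarrow> complex" where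
  "laurent c x = (\<Sum>k | c k \<noteq> 0. c k * M x powi k)"

lemma laurent_eq:
  assumes "finite S" "\<And>k. k \<notin> S \<Longrightarrow> c k = 0"
  shows "laurent c x = (\<Sum>k\<in>S. c k * M x powi k)"
  unfolding laurent_def using assms by (intro sum.mono_neutral_left) auto

text \<open>Since \<open>M' = (1 - M)\<^sup>2 / (2\<i>\<beta>)\<close>, differentiation of a Laurent polynomial in \<open>M\<close> is
  a tridiagonal operator on its coefficients.\<close>

definition diff_coeffs :: "(int \<Rightarrow> complex) \<Rightarrow> int \<Rightarrow> complex" where
  "diff_coeffs c k = (of_int (k + 1) * c (k + 1) - 2 * of_int k * c k + of_int (k - 1) * c (k - 1)) / (2 * \<i> * of_real \<beta>)"

lemma finite_support_bound:
  assumes "finite {k::int. c k \<noteq> 0}"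
  obtains N :: nat where "\<And>k. k \<notin> {- int N..int N} \<Longrightarrow> c k = 0"
proof -
  define b where "b = Max (insert 0 (abs ` {k. c k \<noteq> 0}))"
  have b: "\<bar>k\<bar> \<le> b" if "c k \<noteq> 0" for k
    unfolding b_def using assms that by (intro Max_ge) auto
  show ?thesis by (rule that[of "nat \<bar>b\<bar>"]) (use b in force)
qed

lemma diff_coeffs_support:
  assumes "\<And>k. k \<notin> {- N..N} \<Longrightarrow> c k = 0"
  shows "k \<notin> {- N - 1..N + 1} \<Longrightarrow> diff_coeffs c k = 0"
proof -
  assume "k \<notin> {- N - 1..N + 1}"
  then have "c (k + 1) = 0" "c k = 0" "c (k - 1) = 0" by (auto intro!: assms)
  then show "diff_coeffs c k = 0" by (simp add: diff_coeffs_def)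
qed

lemma finite_support_diff_coeffs:
  assumes "finite {k. c k \<noteq> 0}"
  shows "finite {k. diff_coeffs c k \<noteq> 0}"
proof -
  obtain N :: nat where "\<And>k. k \<notin> {- int N..int N} \<Longrightarrow> c k = 0" using finite_support_bound[OF assms] by blast
  then have "{k. diff_coeffs c k \<noteq> 0} \<subseteq> {- int N - 1..int N + 1}"
    using diff_coeffs_support[of "int N" c] by blast
  then show ?thesis by (rule finite_subset) simp
qed

lemma finite_support_diff_coeffs_funpow:
  assumes "finite {k. c k \<noteq> 0}"
  shows "finite {k. (diff_coeffs ^^ j) c k \<noteq> 0}"
  using assms by (induction j) (simp_all add: finite_support_diff_coeffs)

text \<open>Reindexing turns the second difference into multiplication by 1/M - 2 + M = (1 - M)^2 /
  M, and \<open>M_deriv_eq\<close> replaces (1 - M)^2 / (2i\<beta>) by \<open>angle_density\<close>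
  times iM; the factor M cancels.\<close>

lemma laurent_diff_coeffs:
  assumes S: "S = {- int N..int N}" "\<And>k. k \<notin> S \<Longrightarrow> c k = 0"
  shows "laurent (diff_coeffs c) x = \<i> * of_real (angle_density x) * (\<Sum>k\<in>S. of_int k * c k * M x powi k)"
proof -
  \<comment> \<open>One index more at each end, so that all three shifted copies of the support
    fit.\<close>
  define T where "T = {- int N - 1..int N + 1}"
  let ?p = "\<lambda>k. of_int k * c k"
  have p: "?p k = 0" if "k \<notin> S" for k using S(2)[OF that] by simp
  have T: "finite T" "S \<subseteq> (\<lambda>k. k + 1) ` T" "S \<subseteq> T" "S \<subseteq> (\<lambda>k. k + - 1) ` T"
  proof -
    show "S \<subseteq> (\<lambda>k. k + 1) ` T" "S \<subseteq> (\<lambda>k. k + - 1) ` T"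
      using image_add_atLeastAtMost[of 1 "- int N - 1" "int N + 1"] image_add_atLeastAtMost[of "-1" "- int N - 1" "int N + 1"]
      by (auto simp: S T_def add.commute)
  qed (auto simp: S T_def)
  have s: "M x powi (k + 1) = M x * M x powi k" "M x powi (k - 1) = M x powi k / M x" for k
    by (simp_all add: power_int_add power_int_diff)
  have "laurent (diff_coeffs c) x = (\<Sum>k\<in>T. diff_coeffs c k * M x powi k)"
    using diff_coeffs_support[of "int N" c] S unfolding T_def by (intro laurent_eq) auto
  also have "\<dots> = ((\<Sum>k\<in>T. ?p (k + 1) * M x powi (k + 1 - 1)) - 2 * (\<Sum>k\<in>T. ?p k * M x powi k)
      + (\<Sum>k\<in>T. ?p (k + - 1) * M x powi (k + - 1 + 1))) / (2 * \<i> * of_real \<beta>)"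
    unfolding diff_coeffs_def sum_distrib_left sum.distrib[symmetric] sum_subtractf[symmetric] sum_divide_distrib
    by (intro sum.cong refl) (simp add: algebra_simps add_divide_distrib diff_divide_distrib)
  also have "(\<Sum>k\<in>T. ?p (k + 1) * M x powi (k + 1 - 1)) = (\<Sum>k\<in>S. ?p k * M x powi (k - 1))"
    by (rule sum_shift_support[of T S 1 "\<lambda>k. ?p k * M x powi (k - 1)"]) (use T p in auto)
  also have "(\<Sum>k\<in>T. ?p (k + - 1) * M x powi (k + - 1 + 1)) = (\<Sum>k\<in>S. ?p k * M x powi (k + 1))"
    by (rule sum_shift_support[of T S "- 1" "\<lambda>k. ?p k * M x powi (k + 1)"]) (use T p in auto)
  also have "(\<Sum>k\<in>T. ?p k * M x powi k) = (\<Sum>k\<in>S. ?p k * M x powi k)"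
    using T p by (intro sum.mono_neutral_right) auto
  also have "((\<Sum>k\<in>S. ?p k * M x powi (k - 1)) - 2 * (\<Sum>k\<in>S. ?p k * M x powi k)
      + (\<Sum>k\<in>S. ?p k * M x powi (k + 1))) = (1 - M x)\<^sup>2 * (\<Sum>k\<in>S. ?p k * M x powi k) / M x"
    unfolding sum_distrib_left sum.distrib[symmetric] sum_subtractf[symmetric] sum_divide_distrib s
    by (intro sum.cong refl) (simp add: field_simps power2_eq_square)
  also have "\<dots> / (2 * \<i> * of_real \<beta>) = (1 - M x)\<^sup>2 / (2 * \<i> * of_real \<beta>) * (\<Sum>k\<in>S. ?p k * M x powi k) / M x"
    by simp
  finally show ?thesis unfolding M_deriv_eq[symmetric] by simp
qed

lemma laurent_has_vector_derivative:
  assumes "finite {k. c k \<noteq> 0}"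
  shows "(laurent c has_vector_derivative laurent (diff_coeffs c) x) (at x)"
proof -
  obtain N :: nat where N: "\<And>k. k \<notin> {- int N..int N} \<Longrightarrow> c k = 0" using finite_support_bound[OF assms] by blast
  have "((\<lambda>x. \<Sum>k\<in>{- int N..int N}. c k * M x powi k) has_vector_derivative
      (\<Sum>k\<in>{- int N..int N}. c k * (\<i> * of_int k * of_real (angle_density x) * M x powi k))) (at x)"
    by (intro has_vector_derivative_sum has_vector_derivative_mult_right M_powi_has_vector_derivative)
  moreover have "(\<lambda>x. \<Sum>k\<in>{- int N..int N}. c k * M x powi k) = laurent c"
    using laurent_eq[of "{- int N..int N}" c] N by auto
  moreover have "(\<Sum>k\<in>{- int N..int N}. c k * (\<i> * of_int k * of_real (angle_density x) * M x powi k)) = laurent (diff_coeffs c) x"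
  proof -
    have "laurent (diff_coeffs c) x = \<i> * of_real (angle_density x) * (\<Sum>k\<in>{- int N..int N}. of_int k * c k * M x powi k)"
      by (rule laurent_diff_coeffs[OF refl]) (rule N)
    then show ?thesis unfolding sum_distrib_left by (simp add: mult_ac)
  qed
  ultimately show ?thesis by simp
qed

lemma continuous_laurent: "continuous_on X (laurent c)"
  unfolding laurent_def[abs_def] by (intro continuous_intros continuous_M_powi)

lemma laurent_measurable [measurable]: "laurent c \<in> borel_measurable borel"
  by (intro borel_measurable_continuous_onI continuous_laurent)

text \<open>The squared periodic Sobolev norm of order \<open>r\<close>, in the angle variable, of a
  finitely supported family.\<close>

definition weighted_energy :: "real \<Rightarrow> (int \<Rightarrow> complex) \<Rightarrow> real" where
  "weighted_energy r c = (\<Sum>k | c k \<noteq> 0. (1 + \<bar>real_of_int k\<bar>) powr (2 * r) * (norm (c k))\<^sup>2)"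

lemma weighted_energy_eq:
  assumes "finite S" "\<And>k. k \<notin> S \<Longrightarrow> c k = 0"
  shows "weighted_energy r c = (\<Sum>k\<in>S. (1 + \<bar>real_of_int k\<bar>) powr (2 * r) * (norm (c k))\<^sup>2)"
  unfolding weighted_energy_def using assms by (intro sum.mono_neutral_left) auto

lemma weighted_energy_nonneg [simp]: "weighted_energy r c \<ge> 0"
  unfolding weighted_energy_def by (intro sum_nonneg) auto

text \<open>The derivative has modulus \<open>angle_density\<close> times |Q|, where
  \<open>Q\<close> has coefficients k c_k. For the L2 norm one factor \<open>angle_density\<close>
  is bounded by 2/\<beta> and the other is the angle measure, to which Parseval applies. The L1 norm
  is Cauchy-Schwarz against the total angle 2 pi.\<close>

lemma
  assumes "finite {k. c k \<noteq> 0}"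
  shows integrable_laurent_diff: "integrable lborel (laurent (diff_coeffs c))"
    and integrable_laurent_diff_sq: "integrable lborel (\<lambda>x. (norm (laurent (diff_coeffs c) x))\<^sup>2)"
    and laurent_diff_L1: "(LINT x|lborel. norm (laurent (diff_coeffs c) x)) \<le> 2 * pi * sqrt (weighted_energy 1 c)"
    and laurent_diff_L2: "(LINT x|lborel. (norm (laurent (diff_coeffs c) x))\<^sup>2) \<le> 4 * pi / \<beta> * weighted_energy 1 c"
    and laurent_diff_tendsto_0: "(laurent (diff_coeffs c) \<longlongrightarrow> 0) at_top" "(laurent (diff_coeffs c) \<longlongrightarrow> 0) at_bot"
proof -
  obtain N :: nat where N: "\<And>k. k \<notin> {- int N..int N} \<Longrightarrow> c k = 0" using finite_support_bound[OF assms] by blast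
  define S where "S = {- int N..int N}"
  define Q where "Q x = (\<Sum>k\<in>S. (of_int k * c k) * M x powi k)" for x
  have Qc: "continuous_on UNIV Q" unfolding Q_def by (intro continuous_intros continuous_M_powi)
  then have [measurable]: "Q \<in> borel_measurable borel" by (rule borel_measurable_continuous_onI)
  have n: "norm (laurent (diff_coeffs c) x) = angle_density x * norm (Q x)" for x
    proof -
    have "laurent (diff_coeffs c) x = \<i> * of_real (angle_density x) * (\<Sum>k\<in>S. of_int k * c k * M x powi k)"
      by (rule laurent_diff_coeffs[OF S_def]) (use N in \<open>simp add: S_def\<close>)
    then show ?thesis by (simp add: norm_mult Q_def)
  qed
  define B where "B = (\<Sum>k\<in>S. norm (of_int k * c k))"
  have QB: "norm (Q x) \<le> B" for x
    unfolding Q_def B_def by (rule sum_norm_le) (simp add: norm_mult)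
  have B0: "B \<ge> 0" unfolding B_def by (intro sum_nonneg) simp
  have nB: "norm (laurent (diff_coeffs c) x) \<le> B * angle_density x" for x
    unfolding n mult.commute[of B] using QB[of x] by (intro mult_left_mono) auto
  define G where "G = (\<Sum>k\<in>S. (norm (of_int k * c k))\<^sup>2)"
  have G0: "G \<ge> 0" unfolding G_def by (intro sum_nonneg) simp
  have GW: "G \<le> weighted_energy 1 c"
  proof -
    have "weighted_energy 1 c = (\<Sum>k\<in>S. (1 + \<bar>real_of_int k\<bar>) powr (2 * 1) * (norm (c k))\<^sup>2)"
      using N by (intro weighted_energy_eq) (auto simp: S_def)
    also have "\<dots> \<ge> G"
      unfolding G_def
    proof (rule sum_mono)
      fix k
      have "\<bar>real_of_int k\<bar>\<^sup>2 \<le> (1 + \<bar>real_of_int k\<bar>)\<^sup>2" by (rule power_mono) auto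
      also have "\<dots> = (1 + \<bar>real_of_int k\<bar>) powr (2 * 1)" by simp
      finally show "(norm (of_int k * c k))\<^sup>2 \<le> (1 + \<bar>real_of_int k\<bar>) powr (2 * 1) * (norm (c k))\<^sup>2"
        unfolding norm_mult power_mult_distrib norm_of_int by (rule mult_right_mono) simp
    qed
    finally show ?thesis .
  qed
  have Q2: "integrable lborel (\<lambda>x. angle_density x * (norm (Q x))\<^sup>2)" "(LINT x|lborel. angle_density x * (norm (Q x))\<^sup>2) = 2 * pi * G"
    using integrable_density_laurent_sq[of S "\<lambda>k. of_int k * c k"] integral_density_laurent_sq[of S "\<lambda>k. of_int k * c k"]
    by (simp_all add: Q_def G_def S_def)
  show int: "integrable lborel (laurent (diff_coeffs c))"
    by (rule Bochner_Integration.integrable_bound[OF integrable_mult_right[OF integrable_angle_density, of B]])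
       (use nB B0 in \<open>auto simp: abs_mult\<close>)
  have le2: "(norm (laurent (diff_coeffs c) x))\<^sup>2 \<le> 2 / \<beta> * (angle_density x * (norm (Q x))\<^sup>2)" for x
  proof -
    have "(norm (laurent (diff_coeffs c) x))\<^sup>2 = angle_density x * (angle_density x * (norm (Q x))\<^sup>2)"
      unfolding n by (simp add: power2_eq_square)
    also have "\<dots> \<le> 2 / \<beta> * (angle_density x * (norm (Q x))\<^sup>2)"
      by (intro mult_right_mono angle_density_le) simp
    finally show ?thesis .
  qed
  show int2: "integrable lborel (\<lambda>x. (norm (laurent (diff_coeffs c) x))\<^sup>2)"
    by (rule Bochner_Integration.integrable_bound[OF integrable_mult_right[OF Q2(1), of "2 / \<beta>"]])
       (use le2 \<beta>_pos in \<open>auto simp: abs_mult\<close>)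
  have "(LINT x|lborel. (norm (laurent (diff_coeffs c) x))\<^sup>2) \<le> (LINT x|lborel. 2 / \<beta> * (angle_density x * (norm (Q x))\<^sup>2))"
    by (intro integral_mono int2 le2 integrable_mult_right Q2)
  also have "\<dots> = 4 * pi / \<beta> * G" using Q2(2) by simp
  also have "\<dots> \<le> 4 * pi / \<beta> * weighted_energy 1 c" using GW \<beta>_pos by (intro mult_left_mono) auto
  finally show "(LINT x|lborel. (norm (laurent (diff_coeffs c) x))\<^sup>2) \<le> 4 * pi / \<beta> * weighted_energy 1 c" .
  have iQ: "integrable lborel (\<lambda>x. angle_density x * norm (Q x))" using integrable_norm[OF int] by (simp add: n)
  have L1: "(LINT x|lborel. angle_density x * norm (Q x)) \<le> 2 * pi * sqrt G"
  proof (rule field_le_epsilon)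
    fix e :: real assume "e > 0"
    \<comment> \<open>Cauchy-Schwarz in the form |Q| <= a/2 + |Q|^2/(2a). The best choice is a =
      sqrt G; the surplus keeps \<open>a\<close> positive when G = 0 and costs exactly
      \<open>e\<close> in the end.\<close>
    define a where "a = sqrt G + e / (2 * pi)"
    have a: "a > 0" "a \<ge> sqrt G" using \<open>e > 0\<close> G0 by (auto simp: a_def add_nonneg_pos)
    have "(LINT x|lborel. angle_density x * norm (Q x)) \<le> (LINT x|lborel. (a / 2) * angle_density x + 1 / (2 * a) * (angle_density x * (norm (Q x))\<^sup>2))"
    proof (intro integral_mono iQ Bochner_Integration.integrable_add integrable_mult_right Q2 integrable_angle_density)
      fix x
      have "norm (Q x) \<le> a / 2 + 1 / (2 * a) * (norm (Q x))\<^sup>2"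
        using a sum_squares_bound[of a "norm (Q x)"] by (simp add: field_simps power2_eq_square)
      then have "angle_density x * norm (Q x) \<le> angle_density x * (a / 2 + 1 / (2 * a) * (norm (Q x))\<^sup>2)"
        by (rule mult_left_mono) simp
      then show "angle_density x * norm (Q x) \<le> (a / 2) * angle_density x + 1 / (2 * a) * (angle_density x * (norm (Q x))\<^sup>2)"
        by (simp add: algebra_simps)
    qed
    also have "\<dots> = a * pi + pi * G / a"
      using Q2 a by (simp add: integral_angle_density)
    also have "\<dots> \<le> a * pi + pi * a"
    proof -
      have "sqrt G * sqrt G \<le> a * a" using a G0 by (intro mult_mono) auto
      then have "G / a \<le> a" using a G0 by (simp add: pos_divide_le_eq)
      then have "pi * (G / a) \<le> pi * a" by (rule mult_left_mono) simp
      then show ?thesis by simp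
    qed
    also have "\<dots> = 2 * pi * sqrt G + e" by (simp add: a_def field_simps)
    finally show "(LINT x|lborel. angle_density x * norm (Q x)) \<le> 2 * pi * sqrt G + e" by simp
  qed
  also have "2 * pi * sqrt G \<le> 2 * pi * sqrt (weighted_energy 1 c)" using GW by simp
  finally show "(LINT x|lborel. norm (laurent (diff_coeffs c) x)) \<le> 2 * pi * sqrt (weighted_energy 1 c)" by (simp add: n)
  have "((\<lambda>x. B * (2 * \<beta> / (x\<^sup>2 + \<beta>\<^sup>2))) \<longlongrightarrow> 0) at_top" "((\<lambda>x. B * (2 * \<beta> / (x\<^sup>2 + \<beta>\<^sup>2))) \<longlongrightarrow> 0) at_bot"
    using \<beta>_pos by real_asymp+
  then have lim: "((\<lambda>x. B * angle_density x) \<longlongrightarrow> 0) at_top" "((\<lambda>x. B * angle_density x) \<longlongrightarrow> 0) at_bot"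
    by (simp_all only: angle_density_def)
  have nB': "\<forall>\<^sub>F x in F. norm (laurent (diff_coeffs c) x) \<le> B * angle_density x" for F
    using nB by simp
  show "(laurent (diff_coeffs c) \<longlongrightarrow> 0) at_top" by (rule Lim_null_comparison[OF nB' lim(1)])
  show "(laurent (diff_coeffs c) \<longlongrightarrow> 0) at_bot" by (rule Lim_null_comparison[OF nB' lim(2)])
qed

text \<open>The factor k costs one order. A shift by one changes 1 + |k| at most by a factor 2,
  hence \<open>4 powr r\<close>. Cauchy-Schwarz on three terms gives the factor 3, the division by
  2\<beta> gives 1/(4\<beta>^2), and the shifted sums contribute 1 + 4 + 1 copies of the energy: 6 *
  3/4 = 9/2.\<close>

lemma weighted_energy_diff_coeffs:
  assumes r: "r \<ge> 0" and fin: "finite {k. c k \<noteq> 0}"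
  shows "weighted_energy r (diff_coeffs c) \<le> 9 / (2 * \<beta>\<^sup>2) * 4 powr r * weighted_energy (r + 1) c"
proof -
  obtain N :: nat where N: "\<And>k. k \<notin> {- int N..int N} \<Longrightarrow> c k = 0" using finite_support_bound[OF fin] by blast
  define S where "S = {- int N..int N}"
  define T where "T = {- int N - 1..int N + 1}"
  let ?w = "\<lambda>r k. (1 + \<bar>real_of_int k\<bar>) powr (2 * r)"
  define p where "p k = ?w (r + 1) k * (norm (c k))\<^sup>2" for k
  have p: "p k = 0" if "k \<notin> S" for k using N that by (simp add: p_def S_def)
  have T: "finite T" "S \<subseteq> (\<lambda>k. k + 1) ` T" "S \<subseteq> T" "S \<subseteq> (\<lambda>k. k + - 1) ` T"
  proof -
    show "S \<subseteq> (\<lambda>k. k + 1) ` T" "S \<subseteq> (\<lambda>k. k + - 1) ` T"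
      using image_add_atLeastAtMost[of 1 "- int N - 1" "int N + 1"] image_add_atLeastAtMost[of "-1" "- int N - 1" "int N + 1"]
      by (auto simp: S_def T_def add.commute)
  qed (auto simp: S_def T_def)
  have W: "weighted_energy (r + 1) c = (\<Sum>k\<in>S. p k)"
    unfolding p_def using N by (intro weighted_energy_eq) (auto simp: S_def)
  have shift: "?w r k * (norm (of_int l * c l))\<^sup>2 \<le> 4 powr r * p l" if "\<bar>k - l\<bar> \<le> 1" for k l
  proof -
    have "1 + \<bar>real_of_int k\<bar> \<le> 2 * (1 + \<bar>real_of_int l\<bar>)" proof -
      have "\<bar>k\<bar> \<le> \<bar>l\<bar> + 1" using that by linarith
      then have "real_of_int \<bar>k\<bar> \<le> real_of_int (\<bar>l\<bar> + 1)" by (simp only: of_int_le_iff)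
      then show ?thesis by simp
    qed
    then have "?w r k \<le> (2 * (1 + \<bar>real_of_int l\<bar>)) powr (2 * r)" using r by (intro powr_mono2) auto
    also have "\<dots> = 4 powr r * ?w r l"
    proof -
      have "(4::real) powr r = 2 powr (2 * r)" by (simp add: powr_powr[symmetric])
      then show ?thesis by (subst powr_mult) auto
    qed
    finally have 1: "?w r k \<le> 4 powr r * ?w r l" .
    have "(norm (of_int l * c l))\<^sup>2 \<le> (1 + \<bar>real_of_int l\<bar>)\<^sup>2 * (norm (c l))\<^sup>2"
      unfolding norm_mult power_mult_distrib by (intro mult_right_mono power_mono) auto
    also have "(1 + \<bar>real_of_int l\<bar>)\<^sup>2 = ?w 1 l" by (simp add: abs_if)
    finally have "?w r k * (norm (of_int l * c l))\<^sup>2 \<le> (4 powr r * ?w r l) * (?w 1 l * (norm (c l))\<^sup>2)"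
      using 1 by (intro mult_mono) auto
    also have "\<dots> = 4 powr r * p l" by (simp add: p_def distrib_left powr_add mult_ac)
    finally show ?thesis .
  qed
  have point: "?w r k * (norm (diff_coeffs c k))\<^sup>2 \<le> 3 / (4 * \<beta>\<^sup>2) * 4 powr r * (p (k + 1) + 4 * p k + p (k + - 1))" for k
  proof -
    let ?a = "norm (of_int (k + 1) * c (k + 1))" and ?b = "norm (of_int k * c k)" and ?d = "norm (of_int (k - 1) * c (k - 1))"
    have "norm (diff_coeffs c k) = norm (of_int (k + 1) * c (k + 1) - 2 * of_int k * c k + of_int (k - 1) * c (k - 1)) / (2 * \<beta>)"
      using \<beta>_pos by (simp add: diff_coeffs_def norm_divide norm_mult)
    also have "\<dots> \<le> (?a + 2 * ?b + ?d) / (2 * \<beta>)"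
      using \<beta>_pos norm_triangle_ineq[of "of_int (k + 1) * c (k + 1) - 2 * of_int k * c k" "of_int (k - 1) * c (k - 1)"]
        norm_triangle_ineq4[of "of_int (k + 1) * c (k + 1)" "2 * of_int k * c k"]
      by (intro divide_right_mono) (auto simp: norm_mult)
    finally have "(norm (diff_coeffs c k))\<^sup>2 \<le> ((?a + 2 * ?b + ?d) / (2 * \<beta>))\<^sup>2"
      by (rule power_mono) simp
    also have "\<dots> = (?a + 2 * ?b + ?d)\<^sup>2 / (4 * \<beta>\<^sup>2)" by (simp add: power_divide)
    also have "(?a + 2 * ?b + ?d)\<^sup>2 \<le> 3 * (?a\<^sup>2 + 4 * ?b\<^sup>2 + ?d\<^sup>2)"
    proof -
      have "0 \<le> (x - 2 * y)\<^sup>2 + (x - z)\<^sup>2 + (2 * y - z)\<^sup>2" for x y z :: real by simp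
      from this[of ?a ?b ?d] show ?thesis by (simp add: power2_eq_square algebra_simps)
    qed
    finally have "(norm (diff_coeffs c k))\<^sup>2 \<le> 3 / (4 * \<beta>\<^sup>2) * (?a\<^sup>2 + 4 * ?b\<^sup>2 + ?d\<^sup>2)"
      using \<beta>_pos by (simp add: divide_right_mono)
    then have "?w r k * (norm (diff_coeffs c k))\<^sup>2 \<le> ?w r k * (3 / (4 * \<beta>\<^sup>2) * (?a\<^sup>2 + 4 * ?b\<^sup>2 + ?d\<^sup>2))"
      by (intro mult_left_mono) auto
    also have "\<dots> = 3 / (4 * \<beta>\<^sup>2) * (?w r k * ?a\<^sup>2 + 4 * (?w r k * ?b\<^sup>2) + ?w r k * ?d\<^sup>2)"
      by (simp add: algebra_simps)
    also have "\<dots> \<le> 3 / (4 * \<beta>\<^sup>2) * (4 powr r * p (k + 1) + 4 * (4 powr r * p k) + 4 powr r * p (k - 1))"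
      using shift[of k "k + 1"] shift[of k k] shift[of k "k - 1"] by (intro mult_left_mono add_mono) auto
    also have "\<dots> = 3 / (4 * \<beta>\<^sup>2) * 4 powr r * (p (k + 1) + 4 * p k + p (k + - 1))"
      by (simp only: distrib_left distrib_right mult_ac diff_conv_add_uminus)
    finally show ?thesis .
  qed
  have "weighted_energy r (diff_coeffs c) = (\<Sum>k\<in>T. ?w r k * (norm (diff_coeffs c k))\<^sup>2)"
    using diff_coeffs_support[of "int N" c] N unfolding T_def by (intro weighted_energy_eq) auto
  also have "\<dots> \<le> (\<Sum>k\<in>T. 3 / (4 * \<beta>\<^sup>2) * 4 powr r * (p (k + 1) + 4 * p k + p (k + - 1)))"
    by (intro sum_mono point)
  also have "\<dots> = 3 / (4 * \<beta>\<^sup>2) * 4 powr r * ((\<Sum>k\<in>T. p (k + 1)) + 4 * (\<Sum>k\<in>T. p k) + (\<Sum>k\<in>T. p (k + - 1)))"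
    by (simp only: sum_distrib_left[symmetric] sum.distrib)
  also have "(\<Sum>k\<in>T. p (k + 1)) = (\<Sum>k\<in>S. p k)" by (rule sum_shift_support) (use T p in auto)
  also have "(\<Sum>k\<in>T. p (k + - 1)) = (\<Sum>k\<in>S. p k)" by (rule sum_shift_support) (use T p in auto)
  also have "(\<Sum>k\<in>T. p k) = (\<Sum>k\<in>S. p k)" using T p by (intro sum.mono_neutral_right) auto
  finally show ?thesis unfolding W by (simp add: field_simps)
qed

lemma weighted_energy_diff_coeffs_funpow:
  "\<exists>C\<ge>0. \<forall>c. finite {k. c k \<noteq> 0} \<longrightarrow>
     weighted_energy 1 ((diff_coeffs ^^ j) c) \<le> C * weighted_energy (real j + 1) c"
proof -
  \<comment> \<open>The order is generalised because the induction removes the outermost operator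
    and measures the rest one order higher.\<close>
  have "\<exists>C\<ge>0. \<forall>c. finite {k. c k \<noteq> 0} \<longrightarrow> weighted_energy r ((diff_coeffs ^^ j) c) \<le> C * weighted_energy (real j + r) c"
    if "r \<ge> 0" for r
    using that
  proof (induction j arbitrary: r)
    case 0
    then show ?case by (intro exI[of _ 1]) simp
  next
    case (Suc j)
    have "r + 1 \<ge> 0" using Suc.prems by simp
    from Suc.IH[OF this] obtain C where C: "C \<ge> 0" "\<And>c. finite {k. c k \<noteq> 0} \<Longrightarrow>
        weighted_energy (r + 1) ((diff_coeffs ^^ j) c) \<le> C * weighted_energy (real j + (r + 1)) c"
      by blast
    define K where "K = 9 / (2 * \<beta>\<^sup>2) * 4 powr r"
    have K: "K \<ge> 0" by (simp add: K_def)
    show ?case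
    proof (intro exI[of _ "K * C"] conjI allI impI)
      show "K * C \<ge> 0" using K C by simp
      fix c :: "int \<Rightarrow> complex" assume c: "finite {k. c k \<noteq> 0}"
      have "weighted_energy r ((diff_coeffs ^^ Suc j) c) \<le> K * weighted_energy (r + 1) ((diff_coeffs ^^ j) c)"
        unfolding K_def using weighted_energy_diff_coeffs[OF Suc.prems finite_support_diff_coeffs_funpow[OF c, of j]] by simp
      also have "\<dots> \<le> K * (C * weighted_energy (real j + (r + 1)) c)"
        using C(2)[OF c] K by (rule mult_left_mono)
      finally show "weighted_energy r ((diff_coeffs ^^ Suc j) c) \<le> K * C * weighted_energy (real (Suc j) + r) c"
        by (simp add: add_ac)
    qed
  qed
  from this[of 1] show ?thesis by simp
qed

text \<open>Counting starts at the first derivative: the Laurent polynomial itself tends to the sum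
  of its coefficients at infinity and need not be integrable.\<close>

lemma fourier_L1_laurent_diff:
  assumes "finite {k. c k \<noteq> 0}"
  shows "fourier_L1 (laurent ((diff_coeffs ^^ Suc j) c)) k = (\<i> * of_real k) ^ j * fourier_L1 (laurent (diff_coeffs c)) k"
proof (induction j)
  case (Suc j)
  let ?c = "(diff_coeffs ^^ j) c"
  have fin: "finite {k. ?c k \<noteq> 0}" "finite {k. diff_coeffs ?c k \<noteq> 0}"
    using finite_support_diff_coeffs_funpow[OF assms, of j] finite_support_diff_coeffs_funpow[OF assms, of "Suc j"] by simp_all
  have "fourier_L1 (laurent (diff_coeffs (diff_coeffs ?c))) k = \<i> * of_real k * fourier_L1 (laurent (diff_coeffs ?c)) k"
    by (intro fourier_L1_deriv laurent_has_vector_derivative continuous_laurent integrable_laurent_diff laurent_diff_tendsto_0 fin)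
  then show ?case using Suc by simp
qed simp

end

section \<open>Interpolation between Sobolev orders\<close>

lemma four_powr_power: "((4::real) powr r) ^ i = (2 ^ i) powr (2 * r)"
  using powr_powr[of 2 2 "r * i"] by (simp add: powr_power powr_realpow[symmetric] powr_powr mult_ac)

text \<open>The capped sequence \<open>\<phi>\<close> telescopes: while 2^i < u its increment is (A
  - 1) A^i, and it never exceeds A u^(2r). The bound is uniform in \<open>N\<close> without locating
  the last index that counts.\<close>

lemma sum_geometric_below:
  fixes u r :: real
  assumes "u \<ge> 1" "r > 0"
  shows "(\<Sum>i<N. if 2 ^ i < u then (4 powr r) ^ i else 0) \<le> 4 powr r / (4 powr r - 1) * u powr (2 * r)"
proof -
  define A where "A = (4::real) powr r"
  have A: "A > 1" using assms by (simp add: A_def)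
  have Ai: "A ^ i = (2 ^ i) powr (2 * r)" for i
    unfolding A_def by (rule four_powr_power)
  define \<phi> where "\<phi> i = min (A ^ i) (A * u powr (2 * r))" for i :: nat
  have "(if 2 ^ i < u then A ^ i else 0) \<le> (\<phi> (Suc i) - \<phi> i) / (A - 1)" for i
  proof (cases "2 ^ i < u")
    case True
    then have "A ^ i \<le> u powr (2 * r)" unfolding Ai using assms by (intro powr_mono2) auto
    then have 1: "A ^ Suc i \<le> A * u powr (2 * r)" using A by simp
    also have "A ^ i \<le> A ^ Suc i" using A by simp
    finally have "\<phi> i = A ^ i" by (simp add: \<phi>_def)
    moreover have "\<phi> (Suc i) = A ^ Suc i" using 1 by (simp add: \<phi>_def)
    ultimately show ?thesis using True A by (simp add: field_simps)
  next
    case False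
    have "\<phi> i \<le> \<phi> (Suc i)" unfolding \<phi>_def using A by (intro min.mono) auto
    then show ?thesis using False A by simp
  qed
  then have "(\<Sum>i<N. if 2 ^ i < u then A ^ i else 0) \<le> (\<Sum>i<N. (\<phi> (Suc i) - \<phi> i) / (A - 1))" by (rule sum_mono)
  also have "\<dots> = (\<phi> N - \<phi> 0) / (A - 1)" by (simp add: sum_lessThan_telescope flip: sum_divide_distrib)
  also have "\<dots> \<le> A * u powr (2 * r) / (A - 1)"
  proof (rule divide_right_mono)
    have "\<phi> 0 \<ge> 0" "\<phi> N \<le> A * u powr (2 * r)" using A by (auto simp: \<phi>_def)
    then show "\<phi> N - \<phi> 0 \<le> A * u powr (2 * r)" by linarith
  qed (use A in simp)
  finally show ?thesis unfolding A_def[symmetric] by simp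
qed

text \<open>The mirror image with ratio A < 1. The cap carries no factor \<open>A\<close> because
  here the term itself, not its successor, is the larger one and must lie below the cap.\<close>

lemma sum_geometric_above:
  fixes u r :: real
  assumes "u \<ge> 1" "r < 0"
  shows "(\<Sum>i<N. if u \<le> 2 ^ i then (4 powr r) ^ i else 0) \<le> 1 / (1 - 4 powr r) * u powr (2 * r)"
proof -
  define A where "A = (4::real) powr r"
  have A: "0 < A" "A < 1" using assms by (auto simp: A_def powr_less_one)
  have Ai: "A ^ i = (2 ^ i) powr (2 * r)" for i
    unfolding A_def by (rule four_powr_power)
  define \<phi> where "\<phi> i = min (A ^ i) (u powr (2 * r))" for i :: nat
  have "(if u \<le> 2 ^ i then A ^ i else 0) \<le> (\<phi> i - \<phi> (Suc i)) / (1 - A)" for i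
  proof (cases "u \<le> 2 ^ i")
    case True
    then have 1: "A ^ i \<le> u powr (2 * r)" unfolding Ai using assms by (intro powr_mono2') auto
    moreover have "A ^ Suc i \<le> A ^ i" using A by (simp add: mult_left_le_one_le)
    ultimately have "\<phi> i = A ^ i" "\<phi> (Suc i) = A ^ Suc i" by (auto simp: \<phi>_def)
    then show ?thesis using True A by (simp add: field_simps)
  next
    case False
    have "A ^ Suc i \<le> A ^ i" using A by (simp add: mult_left_le_one_le)
    then have "\<phi> (Suc i) \<le> \<phi> i" unfolding \<phi>_def by (intro min.mono) auto
    then show ?thesis using False A by simp
  qed
  then have "(\<Sum>i<N. if u \<le> 2 ^ i then A ^ i else 0) \<le> (\<Sum>i<N. (\<phi> i - \<phi> (Suc i)) / (1 - A))" by (rule sum_mono)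
  also have "\<dots> = (\<phi> 0 - \<phi> N) / (1 - A)" by (simp add: sum_lessThan_telescope' flip: sum_divide_distrib)
  also have "\<dots> \<le> u powr (2 * r) / (1 - A)"
  proof (rule divide_right_mono)
    have "\<phi> N \<ge> 0" "\<phi> 0 \<le> u powr (2 * r)" using A by (auto simp: \<phi>_def)
    then show "\<phi> 0 - \<phi> N \<le> u powr (2 * r)" by linarith
  qed (use A in simp)
  finally show ?thesis unfolding A_def[symmetric] by simp
qed

lemma dyadic_interval:
  fixes u :: real
  assumes "u \<ge> 1"
  obtains i :: nat where "2 ^ i \<le> u" "u < 2 ^ Suc i"
proof -
  obtain n where n: "u < 2 ^ n" using real_arch_pow[of 2 u] by auto
  define j where "j = (LEAST n. u < 2 ^ n)"
  have j: "u < 2 ^ j" unfolding j_def by (rule LeastI[of _ n]) (rule n)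
  then obtain i where i: "j = Suc i" using assms by (cases j) auto
  have "\<not> u < 2 ^ i" using not_less_Least[of i "\<lambda>n. u < 2 ^ n"] i by (simp add: j_def[symmetric])
  then show ?thesis using that[of i] j i by simp
qed

context cayley
begin

lemma diff_coeffs_add: "diff_coeffs (\<lambda>k. a k + b k) = (\<lambda>k. diff_coeffs a k + diff_coeffs b k)"
  by (simp add: diff_coeffs_def fun_eq_iff algebra_simps add_divide_distrib diff_divide_distrib)

lemma laurent_add:
  assumes "finite {k. a k \<noteq> 0}" "finite {k. b k \<noteq> 0}"
  shows "laurent (\<lambda>k. a k + b k) x = laurent a x + laurent b x"
proof -
  let ?S = "{k. a k \<noteq> 0} \<union> {k. b k \<noteq> 0}"
  have S: "finite ?S" using assms by simp
  have "laurent (\<lambda>k. a k + b k) x = (\<Sum>k\<in>?S. (a k + b k) * M x powi k)" using S by (intro laurent_eq) auto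
  moreover have "laurent a x = (\<Sum>k\<in>?S. a k * M x powi k)" "laurent b x = (\<Sum>k\<in>?S. b k * M x powi k)"
    using S by (intro laurent_eq; auto)+
  ultimately show ?thesis by (simp add: distrib_right sum.distrib)
qed

lemma fourier_laurent_diff_add:
  assumes "finite {k. a k \<noteq> 0}" "finite {k. b k \<noteq> 0}"
  shows "fourier_L1 (laurent (diff_coeffs (\<lambda>k. a k + b k))) x
    = fourier_L1 (laurent (diff_coeffs a)) x + fourier_L1 (laurent (diff_coeffs b)) x"
proof -
  have "laurent (diff_coeffs (\<lambda>k. a k + b k)) = (\<lambda>x. laurent (diff_coeffs a) x + laurent (diff_coeffs b) x)"
    unfolding diff_coeffs_add using assms by (intro ext laurent_add finite_support_diff_coeffs)
  then show ?thesis using fourier_L1_add[OF integrable_laurent_diff integrable_laurent_diff] assms by simp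
qed

text \<open>(1+|k|)^(2m) is at most 4^m (1 + |k|^(2m)), and the factor |k|^(2m) turns the transform
  of the first derivative into that of derivative m + 1. Both pieces are then L2 norms of
  derivatives.\<close>

lemma fourier_laurent_diff_energy_nat:
  "\<exists>C\<ge>0. \<forall>c. finite {k. c k \<noteq> 0} \<longrightarrow>
     (\<integral>\<^sup>+k. ennreal ((1 + \<bar>k\<bar>) ^ (2 * m) * (norm (fourier_L1 (laurent (diff_coeffs c)) k))\<^sup>2) \<partial>lborel)
       \<le> ennreal (C * weighted_energy (real m + 1) c)"
proof -
  obtain C where C: "C \<ge> 0" "\<And>c. finite {k. c k \<noteq> 0} \<Longrightarrow> weighted_energy 1 ((diff_coeffs ^^ m) c) \<le> C * weighted_energy (real m + 1) c"
    using weighted_energy_diff_coeffs_funpow by blast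
  \<comment> \<open>The factor 2 pi belongs to the energy inequality, 4 pi/\<beta> to the L2 bound
    for a derivative.\<close>
  define K where "K = 2 * pi * (4 * pi / \<beta>)"
  have K: "K \<ge> 0" using \<beta>_pos by (simp add: K_def)
  have en: "(\<integral>\<^sup>+k. ennreal ((norm (fourier_L1 (laurent (diff_coeffs c)) k))\<^sup>2) \<partial>lborel) \<le> ennreal (K * weighted_energy 1 c)"
    if c: "finite {k. c k \<noteq> 0}" for c
  proof -
    have "(\<integral>\<^sup>+k. ennreal ((norm (fourier_L1 (laurent (diff_coeffs c)) k))\<^sup>2) \<partial>lborel)
        \<le> ennreal (2 * pi * (LINT x|lborel. (norm (laurent (diff_coeffs c) x))\<^sup>2))"
      by (rule fourier_L1_energy[OF integrable_laurent_diff[OF c] integrable_laurent_diff_sq[OF c]])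
    also have "\<dots> \<le> ennreal (K * weighted_energy 1 c)"
      unfolding K_def mult.assoc using laurent_diff_L2[OF c] by (intro ennreal_leI mult_left_mono) (auto simp: mult.assoc)
    finally show ?thesis .
  qed
  show ?thesis
  proof (intro exI[of _ "4 ^ m * (K + K * C)"] conjI allI impI)
    show "0 \<le> 4 ^ m * (K + K * C)" using K C by simp
    fix c :: "int \<Rightarrow> complex" assume c: "finite {k. c k \<noteq> 0}"
    define W where "W = weighted_energy (real m + 1) c"
    have W0: "W \<ge> 0" by (simp add: W_def)
    have W1: "weighted_energy 1 c \<le> W"
      unfolding W_def weighted_energy_def by (intro sum_mono mult_right_mono powr_mono) auto
    let ?h = "\<lambda>k. (norm (fourier_L1 (laurent (diff_coeffs c)) k))\<^sup>2"
    let ?h' = "\<lambda>k. (norm (fourier_L1 (laurent ((diff_coeffs ^^ Suc m) c)) k))\<^sup>2"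
    have [measurable]: "fourier_L1 (laurent (diff_coeffs c)) \<in> borel_measurable borel"
      "fourier_L1 (laurent ((diff_coeffs ^^ Suc m) c)) \<in> borel_measurable borel" by measurable
    have pt: "(1 + \<bar>k\<bar>) ^ (2 * m) * ?h k \<le> 4 ^ m * (?h k + ?h' k)" for k
    proof -
      have h': "?h' k = \<bar>k\<bar> ^ (2 * m) * ?h k"
        using fourier_L1_laurent_diff[OF c, of m k]
        by (simp add: norm_mult norm_power power_mult_distrib power_mult[symmetric] mult.commute del: funpow.simps)
      have "(1 + \<bar>k\<bar>) ^ (2 * m) \<le> 4 ^ m * (1 + \<bar>k\<bar> ^ (2 * m))"
      proof -
        have "(1 + \<bar>k\<bar>) ^ (2 * m) \<le> (2 * max 1 \<bar>k\<bar>) ^ (2 * m)" by (intro power_mono) auto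
        also have "\<dots> = 4 ^ m * (max 1 \<bar>k\<bar>) ^ (2 * m)" by (simp add: power_mult_distrib power_mult)
        also have "(max 1 \<bar>k\<bar>) ^ (2 * m) \<le> 1 + \<bar>k\<bar> ^ (2 * m)" by (auto simp: max_def)
        finally show ?thesis by simp
      qed
      then have "(1 + \<bar>k\<bar>) ^ (2 * m) * ?h k \<le> 4 ^ m * (1 + \<bar>k\<bar> ^ (2 * m)) * ?h k" by (rule mult_right_mono) simp
      then show ?thesis unfolding h' by (simp add: algebra_simps)
    qed
    have "(\<integral>\<^sup>+k. ennreal ((1 + \<bar>k\<bar>) ^ (2 * m) * ?h k) \<partial>lborel) \<le> (\<integral>\<^sup>+k. ennreal (4 ^ m * (?h k + ?h' k)) \<partial>lborel)"
      by (intro nn_integral_mono ennreal_leI pt)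
    also have "\<dots> = (\<integral>\<^sup>+k. ennreal (4 ^ m) * (ennreal (?h k) + ennreal (?h' k)) \<partial>lborel)"
      by (intro nn_integral_cong) (simp add: ennreal_mult)
    also have "\<dots> = ennreal (4 ^ m) * ((\<integral>\<^sup>+k. ennreal (?h k) \<partial>lborel) + (\<integral>\<^sup>+k. ennreal (?h' k) \<partial>lborel))"
      by (simp add: nn_integral_cmult nn_integral_add del: funpow.simps)
    also have "\<dots> \<le> ennreal (4 ^ m) * (ennreal (K * W) + ennreal (K * (C * W)))"
    proof (intro mult_left_mono add_mono)
      show "(\<integral>\<^sup>+k. ennreal (?h k) \<partial>lborel) \<le> ennreal (K * W)"
        using en[OF c] by (rule order_trans) (intro ennreal_leI mult_left_mono W1 K)
      have "(\<integral>\<^sup>+k. ennreal (?h' k) \<partial>lborel) \<le> ennreal (K * weighted_energy 1 ((diff_coeffs ^^ m) c))"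
        using en[OF finite_support_diff_coeffs_funpow[OF c, of m]] by simp
      also have "\<dots> \<le> ennreal (K * (C * W))" unfolding W_def by (intro ennreal_leI mult_left_mono C K c)
      finally show "(\<integral>\<^sup>+k. ennreal (?h' k) \<partial>lborel) \<le> ennreal (K * (C * W))" .
    qed simp
    also have "\<dots> = ennreal (4 ^ m * (K + K * C) * W)"
      using K C W0 by (simp add: ennreal_mult[symmetric] ennreal_plus[symmetric] algebra_simps del: ennreal_plus)
    finally show "(\<integral>\<^sup>+k. ennreal ((1 + \<bar>k\<bar>) ^ (2 * m) * ?h k) \<partial>lborel) \<le> ennreal (4 ^ m * (K + K * C) * weighted_energy (real m + 1) c)"
      by (simp add: W_def)
  qed
qed

text \<open>Real interpolation between the integer orders \<open>0\<close> and \<open>m > r\<close>: on the dyadic shell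
  \<open>1 + |k| \<approx> 2\<^sup>i\<close> the coefficients of index below \<open>2\<^sup>i\<close> are measured with order \<open>m\<close> and the
  others with order \<open>0\<close>; summing over \<open>i\<close> leaves geometric series.\<close>

lemma fourier_laurent_diff_energy:
  assumes r: "r > 0"
  shows "\<exists>C\<ge>0. \<forall>c. finite {k. c k \<noteq> 0} \<longrightarrow>
     (\<integral>\<^sup>+k. ennreal ((1 + \<bar>k\<bar>) powr (2 * r) * (norm (fourier_L1 (laurent (diff_coeffs c)) k))\<^sup>2) \<partial>lborel)
       \<le> ennreal (C * weighted_energy (r + 1) c)"
proof -
  define m where "m = nat \<lfloor>r\<rfloor> + 1"
  have m: "r < real m" unfolding m_def using r by linarith
  obtain C0 where C0: "C0 \<ge> 0" "\<And>c. finite {k. c k \<noteq> 0} \<Longrightarrow>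
     (\<integral>\<^sup>+k. ennreal ((norm (fourier_L1 (laurent (diff_coeffs c)) k))\<^sup>2) \<partial>lborel) \<le> ennreal (C0 * weighted_energy 1 c)"
    using fourier_laurent_diff_energy_nat[of 0] by auto
  obtain C1 where C1: "C1 \<ge> 0" "\<And>c. finite {k. c k \<noteq> 0} \<Longrightarrow>
     (\<integral>\<^sup>+k. ennreal ((1 + \<bar>k\<bar>) ^ (2 * m) * (norm (fourier_L1 (laurent (diff_coeffs c)) k))\<^sup>2) \<partial>lborel)
       \<le> ennreal (C1 * weighted_energy (real m + 1) c)"
    using fourier_laurent_diff_energy_nat[of m] by auto
  define A where "A = (4::real) powr r"
  define B where "B = (4::real) powr (r - m)"
  have A: "A > 1" using r by (simp add: A_def)
  have B: "0 < B" "B < 1" using m by (auto simp: B_def powr_less_one)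
  \<comment> \<open>The 2 comes from splitting a square of a sum, the \<open>A\<close> from the
    upper edge \<open>2 ^ Suc i\<close> of a shell, the two fractions from the geometric sums over
    the shells.\<close>
  define L where "L = 2 * A * (C0 * (A / (A - 1)) + C1 * (1 / (1 - B)))"
  have L: "L \<ge> 0" using A B C0 C1 by (simp add: L_def)
  show ?thesis
  proof (intro exI[of _ L] conjI allI impI L)
    fix c :: "int \<Rightarrow> complex" assume c: "finite {k. c k \<noteq> 0}"
    define a where "a i l = (if 1 + \<bar>real_of_int l\<bar> \<le> 2 ^ i then c l else 0)" for i :: nat and l
    define b where "b i l = (if 1 + \<bar>real_of_int l\<bar> \<le> 2 ^ i then 0 else c l)" for i :: nat and l
    have fa: "finite {k. a i k \<noteq> 0}" for i
      by (rule finite_subset[OF _ c]) (auto simp: a_def split: if_splits)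
    have fb: "finite {k. b i k \<noteq> 0}" for i
      by (rule finite_subset[OF _ c]) (auto simp: b_def split: if_splits)
    define h where "h c k = (norm (fourier_L1 (laurent (diff_coeffs c)) k))\<^sup>2" for c k
    have h0: "h c k \<ge> 0" for c k by (simp add: h_def)
    have [measurable]: "h c \<in> borel_measurable borel" for c unfolding h_def by measurable
    have split: "h c k \<le> 2 * h (a i) k + 2 * h (b i) k" for i k
    proof -
      have "c = (\<lambda>l. a i l + b i l)" by (auto simp: a_def b_def)
      then have "fourier_L1 (laurent (diff_coeffs c)) k = fourier_L1 (laurent (diff_coeffs (a i))) k + fourier_L1 (laurent (diff_coeffs (b i))) k"
        using fourier_laurent_diff_add[OF fa[of i] fb[of i], of k] by simp
      then have "h c k \<le> (norm (fourier_L1 (laurent (diff_coeffs (a i))) k) + norm (fourier_L1 (laurent (diff_coeffs (b i))) k))\<^sup>2"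
        unfolding h_def by (simp add: norm_triangle_ineq power_mono)
      also have "\<dots> \<le> 2 * h (a i) k + 2 * h (b i) k"
        unfolding h_def
        using sum_squares_bound[of "norm (fourier_L1 (laurent (diff_coeffs (a i))) k)" "norm (fourier_L1 (laurent (diff_coeffs (b i))) k)"]
        by (simp add: power2_sum)
      finally show ?thesis .
    qed
    \<comment> \<open>Majorant of the integrand on shell \<open>i\<close>. The high part
      \<open>b i\<close> is charged at order 0. The low part \<open>a i\<close> is charged at order
      \<open>m\<close>: as \<open>A = B * 4 ^ m\<close>, on the shell \<open>A ^ i\<close> is at
      most \<open>B ^ i\<close> times the weight of order \<open>m\<close>.\<close>
    define T where "T i k = 2 * A * A ^ i * h (b i) k + 2 * A * B ^ i * ((1 + \<bar>k\<bar>) ^ (2 * m) * h (a i) k)" for i k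
    have T0: "T i k \<ge> 0" for i k using A B h0 by (simp add: T_def)
    have pt: "ennreal ((1 + \<bar>k\<bar>) powr (2 * r) * h c k) \<le> (\<Sum>i. ennreal (T i k))" for k
    proof -
      obtain i where i: "2 ^ i \<le> 1 + \<bar>k\<bar>" "1 + \<bar>k\<bar> < 2 ^ Suc i" using dyadic_interval[of "1 + \<bar>k\<bar>"] by auto
      have "(1 + \<bar>k\<bar>) powr (2 * r) \<le> (2 ^ Suc i) powr (2 * r)" using i r by (intro powr_mono2) auto
      also have "\<dots> = A * A ^ i"
        using four_powr_power[of r "Suc i"] by (simp add: A_def)
      finally have 1: "(1 + \<bar>k\<bar>) powr (2 * r) \<le> A * A ^ i" .
      have 2: "A ^ i \<le> B ^ i * (1 + \<bar>k\<bar>) ^ (2 * m)"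
      proof -
        have "A = B * 4 ^ m" unfolding A_def B_def by (simp add: powr_diff powr_realpow)
        then have "A ^ i = B ^ i * (2 ^ i) ^ (2 * m)" 
        proof -
          have "((2::real) ^ i) ^ (2 * m) = (2\<^sup>2) ^ (m * i)" unfolding power_mult[symmetric] by (simp add: mult_ac)
          also have "\<dots> = (4 ^ m) ^ i" by (simp add: power_mult)
          finally show ?thesis using \<open>A = B * 4 ^ m\<close> by (simp add: power_mult_distrib)
        qed
        also have "\<dots> \<le> B ^ i * (1 + \<bar>k\<bar>) ^ (2 * m)" using i B by (intro mult_left_mono power_mono) auto
        finally show ?thesis .
      qed
      have "(1 + \<bar>k\<bar>) powr (2 * r) * h c k \<le> A * A ^ i * (2 * h (a i) k + 2 * h (b i) k)"
        using 1 split A h0 by (intro mult_mono) auto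
      also have "\<dots> = 2 * A * A ^ i * h (b i) k + 2 * A * (A ^ i * h (a i) k)" by (simp add: algebra_simps)
      also have "\<dots> \<le> T i k"
      proof -
        have "A ^ i * h (a i) k \<le> B ^ i * (1 + \<bar>k\<bar>) ^ (2 * m) * h (a i) k" using 2 h0 by (rule mult_right_mono)
        then have "2 * A * (A ^ i * h (a i) k) \<le> 2 * A * (B ^ i * (1 + \<bar>k\<bar>) ^ (2 * m) * h (a i) k)" using A by (intro mult_left_mono) auto
        then show ?thesis by (simp add: T_def mult_ac)
      qed
      finally have "ennreal ((1 + \<bar>k\<bar>) powr (2 * r) * h c k) \<le> ennreal (T i k)" by (rule ennreal_leI)
      \<comment> \<open>Only one shell contains \<open>k\<close>, but adding the majorants of all
        shells is affordable and avoids integrating over single shells.\<close>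
      also have "\<dots> = (\<Sum>j\<in>{i}. ennreal (T j k))" by simp
      also have "\<dots> \<le> (\<Sum>j. ennreal (T j k))" by (rule sum_le_suminf) auto
      finally show ?thesis .
    qed
    define S where "S = {k. c k \<noteq> 0}"
    define u where "u l = 1 + \<bar>real_of_int l\<bar>" for l
    have u1: "u l \<ge> 1" for l by (simp add: u_def)
    have Wb: "weighted_energy 1 (b i) = (\<Sum>l\<in>S. (if 2 ^ i < u l then 1 else 0) * (u l powr 2 * (norm (c l))\<^sup>2))" for i
      using c unfolding S_def u_def by (subst weighted_energy_eq[of "{k. c k \<noteq> 0}"]) (auto simp: b_def intro!: sum.cong)
    have Wa: "weighted_energy (real m + 1) (a i) = (\<Sum>l\<in>S. (if u l \<le> 2 ^ i then 1 else 0) * (u l powr (2 * (real m + 1)) * (norm (c l))\<^sup>2))" for i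
      using c unfolding S_def u_def by (subst weighted_energy_eq[of "{k. c k \<noteq> 0}"]) (auto simp: a_def intro!: sum.cong)
    define V where "V i = 2 * A * A ^ i * (C0 * weighted_energy 1 (b i)) + 2 * A * B ^ i * (C1 * weighted_energy (real m + 1) (a i))" for i
    have V0: "V i \<ge> 0" for i using A B C0 C1 by (simp add: V_def)
    have TV: "(\<integral>\<^sup>+k. ennreal (T i k) \<partial>lborel) \<le> ennreal (V i)" for i
    proof -
      have "(\<integral>\<^sup>+k. ennreal (T i k) \<partial>lborel) = (\<integral>\<^sup>+k. ennreal (2 * A * A ^ i) * ennreal (h (b i) k)
          + ennreal (2 * A * B ^ i) * ennreal ((1 + \<bar>k\<bar>) ^ (2 * m) * h (a i) k) \<partial>lborel)"
        unfolding T_def using A B h0 by (intro nn_integral_cong) (simp add: ennreal_mult)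
      also have "\<dots> = ennreal (2 * A * A ^ i) * (\<integral>\<^sup>+k. ennreal (h (b i) k) \<partial>lborel)
          + ennreal (2 * A * B ^ i) * (\<integral>\<^sup>+k. ennreal ((1 + \<bar>k\<bar>) ^ (2 * m) * h (a i) k) \<partial>lborel)"
        by (simp add: nn_integral_add nn_integral_cmult)
      also have "\<dots> \<le> ennreal (2 * A * A ^ i) * ennreal (C0 * weighted_energy 1 (b i))
          + ennreal (2 * A * B ^ i) * ennreal (C1 * weighted_energy (real m + 1) (a i))"
        unfolding h_def by (intro add_mono mult_left_mono C0 C1 fa fb) auto
      also have "\<dots> = ennreal (V i)"
        unfolding V_def using A B C0(1) C1(1)
        by (subst ennreal_plus) (auto simp: ennreal_mult[symmetric])
      finally show ?thesis .
    qed
    have sumV: "(\<Sum>i<N. V i) \<le> L * weighted_energy (r + 1) c" for N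
    proof -
      have W: "weighted_energy (r + 1) c = (\<Sum>l\<in>S. u l powr (2 * (r + 1)) * (norm (c l))\<^sup>2)"
        by (simp add: weighted_energy_def S_def u_def)
      have "(\<Sum>i<N. A ^ i * weighted_energy 1 (b i)) = (\<Sum>l\<in>S. (\<Sum>i<N. if 2 ^ i < u l then A ^ i else 0) * (u l powr 2 * (norm (c l))\<^sup>2))"
        unfolding Wb sum_distrib_left sum_distrib_right by (subst sum.swap) (auto intro!: sum.cong)
      also have "\<dots> \<le> (\<Sum>l\<in>S. A / (A - 1) * u l powr (2 * r) * (u l powr 2 * (norm (c l))\<^sup>2))"
        unfolding A_def by (intro sum_mono mult_right_mono sum_geometric_below u1 r) auto
      also have "\<dots> = A / (A - 1) * weighted_energy (r + 1) c"
        unfolding W sum_distrib_left by (intro sum.cong refl) (simp add: distrib_left powr_add)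
      finally have 1: "(\<Sum>i<N. A ^ i * weighted_energy 1 (b i)) \<le> A / (A - 1) * weighted_energy (r + 1) c" .
      have "(\<Sum>i<N. B ^ i * weighted_energy (real m + 1) (a i)) = (\<Sum>l\<in>S. (\<Sum>i<N. if u l \<le> 2 ^ i then B ^ i else 0) * (u l powr (2 * (real m + 1)) * (norm (c l))\<^sup>2))"
        unfolding Wa sum_distrib_left sum_distrib_right by (subst sum.swap) (auto intro!: sum.cong)
      also have "\<dots> \<le> (\<Sum>l\<in>S. 1 / (1 - B) * u l powr (2 * (r - m)) * (u l powr (2 * (real m + 1)) * (norm (c l))\<^sup>2))"
        unfolding B_def using m by (intro sum_mono mult_right_mono sum_geometric_above u1) auto
      also have "\<dots> = 1 / (1 - B) * weighted_energy (r + 1) c"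
      proof -
        have "u l powr (2 * (r - m)) * u l powr (2 * (real m + 1)) = u l powr (2 * (r + 1))" for l
          by (simp add: algebra_simps flip: powr_add)
        then have t: "u l powr (2 * (r - m)) * (u l powr (2 * (real m + 1)) * y) = u l powr (2 * (r + 1)) * y" for l y
          by (simp flip: mult.assoc)
        show ?thesis unfolding W sum_distrib_left by (intro sum.cong refl) (simp only: mult.assoc t)
      qed
      finally have 2: "(\<Sum>i<N. B ^ i * weighted_energy (real m + 1) (a i)) \<le> 1 / (1 - B) * weighted_energy (r + 1) c" .
      have "(\<Sum>i<N. V i) = 2 * A * (C0 * (\<Sum>i<N. A ^ i * weighted_energy 1 (b i)) + C1 * (\<Sum>i<N. B ^ i * weighted_energy (real m + 1) (a i)))"
        unfolding V_def by (simp add: sum.distrib sum_distrib_left distrib_left mult_ac)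
      also have "\<dots> \<le> 2 * A * (C0 * (A / (A - 1) * weighted_energy (r + 1) c) + C1 * (1 / (1 - B) * weighted_energy (r + 1) c))"
        using 1 2 A C0(1) C1(1) by (intro mult_left_mono add_mono) auto
      also have "\<dots> = L * weighted_energy (r + 1) c" unfolding L_def by (simp add: distrib_left distrib_right mult_ac)
      finally show ?thesis .
    qed
    have "(\<integral>\<^sup>+k. ennreal ((1 + \<bar>k\<bar>) powr (2 * r) * h c k) \<partial>lborel) \<le> (\<integral>\<^sup>+k. (\<Sum>i. ennreal (T i k)) \<partial>lborel)"
      by (intro nn_integral_mono pt)
    also have "\<dots> = (\<Sum>i. \<integral>\<^sup>+k. ennreal (T i k) \<partial>lborel)"
      unfolding T_def by (intro nn_integral_suminf) measurable
    also have "\<dots> \<le> ennreal (L * weighted_energy (r + 1) c)"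
    proof (rule suminf_le_const[OF summableI])
      fix N
      have "(\<Sum>i<N. \<integral>\<^sup>+k. ennreal (T i k) \<partial>lborel) \<le> (\<Sum>i<N. ennreal (V i))" by (intro sum_mono TV)
      also have "\<dots> = ennreal (\<Sum>i<N. V i)" using V0 by (simp add: sum_ennreal)
      also have "\<dots> \<le> ennreal (L * weighted_energy (r + 1) c)" by (intro ennreal_leI sumV)
      finally show "(\<Sum>i<N. \<integral>\<^sup>+k. ennreal (T i k) \<partial>lborel) \<le> ennreal (L * weighted_energy (r + 1) c)" .
    qed
    finally show "(\<integral>\<^sup>+k. ennreal ((1 + \<bar>k\<bar>) powr (2 * r) * (norm (fourier_L1 (laurent (diff_coeffs c)) k))\<^sup>2) \<partial>lborel)
       \<le> ennreal (L * weighted_energy (r + 1) c)" by (simp add: h_def)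
  qed
qed

end

section \<open>Aliasing\<close>

lemma has_sum_finite_sum:
  fixes f :: "'b \<Rightarrow> 'a \<Rightarrow> 'c::topological_comm_monoid_add"
  assumes "finite I" "\<And>i. i \<in> I \<Longrightarrow> (f i has_sum S i) A"
  shows "((\<lambda>x. \<Sum>i\<in>I. f i x) has_sum (\<Sum>i\<in>I. S i)) A"
  using assms by (induction I rule: finite_induct) (auto intro!: has_sum_add)

lemma has_sum_minus:
  fixes f g :: "'a \<Rightarrow> 'b::real_normed_vector"
  assumes "(f has_sum a) A" "(g has_sum b) A"
  shows "((\<lambda>x. f x - g x) has_sum (a - b)) A"
  using tendsto_diff[OF assms[unfolded has_sum_def]] by (simp add: has_sum_def sum_subtractf[abs_def])

lemma infsum_norm_bound:
  fixes a :: "'a \<Rightarrow> 'b::real_normed_vector"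
  assumes "a summable_on A" and le: "\<And>X. finite X \<Longrightarrow> X \<subseteq> A \<Longrightarrow> norm (sum a X) \<le> B"
  shows "norm (infsum a A) \<le> B"
proof (rule tendsto_upperbound)
  show "((\<lambda>X. norm (sum a X)) \<longlongrightarrow> norm (infsum a A)) (finite_subsets_at_top A)"
    using infsum_tendsto[OF assms(1)] by (rule tendsto_norm)
  show "\<forall>\<^sub>F X in finite_subsets_at_top A. norm (sum a X) \<le> B"
    by (intro eventually_finite_subsets_at_top_weakI le)
qed simp

text \<open>Cauchy-Schwarz for the factors b/sqrt w and a sqrt w. With \<open>w\<close> a Sobolev
  weight, \<open>Q\<close> bounds a Sobolev energy; the factor \<open>b\<close> will be 1 for
  aliasing, |m| for the truncated transforms and M^m - 1 for the L2 norm.\<close>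

lemma norm_sum_mult_sq_le:
  fixes a b :: "'a \<Rightarrow> 'b::real_normed_algebra"
  assumes w: "\<And>k. k \<in> X \<Longrightarrow> w k > 0"
    and P: "(\<Sum>k\<in>X. (norm (b k))\<^sup>2 / w k) \<le> P" and Q: "(\<Sum>k\<in>X. w k * (norm (a k))\<^sup>2) \<le> Q"
  shows "(norm (\<Sum>k\<in>X. a k * b k))\<^sup>2 \<le> P * Q"
proof -
  have "norm (\<Sum>k\<in>X. a k * b k) \<le> (\<Sum>k\<in>X. norm (a k) * norm (b k))"
    by (rule sum_norm_le) (rule norm_mult_ineq)
  also have "\<dots> = (\<Sum>k\<in>X. norm (b k) / sqrt (w k) * (sqrt (w k) * norm (a k)))"
    using w by (intro sum.cong refl) (simp add: order.strict_implies_not_eq[symmetric])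
  finally have "(norm (\<Sum>k\<in>X. a k * b k))\<^sup>2 \<le> (\<Sum>k\<in>X. norm (b k) / sqrt (w k) * (sqrt (w k) * norm (a k)))\<^sup>2"
    by (rule power_mono) simp
  also have "\<dots> \<le> (\<Sum>k\<in>X. (norm (b k) / sqrt (w k))\<^sup>2) * (\<Sum>k\<in>X. (sqrt (w k) * norm (a k))\<^sup>2)"
    by (rule Cauchy_Schwarz_ineq_sum)
  also have "\<dots> = (\<Sum>k\<in>X. (norm (b k))\<^sup>2 / w k) * (\<Sum>k\<in>X. w k * (norm (a k))\<^sup>2)"
    using w by (intro arg_cong2[where f = "(*)"] sum.cong refl) (simp_all add: power_mult_distrib power_divide less_imp_le)
  also have "\<dots> \<le> P * Q"
  proof (intro mult_mono P Q)
    have "0 \<le> (\<Sum>k\<in>X. (norm (b k))\<^sup>2 / w k)" using w by (intro sum_nonneg) (simp add: less_imp_le)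
    then show "0 \<le> P" using P by linarith
    show "0 \<le> (\<Sum>k\<in>X. w k * (norm (a k))\<^sup>2)" using w by (intro sum_nonneg) (simp add: less_imp_le)
  qed
  finally show ?thesis .
qed

text \<open>The two halves of the integers each give a zeta series; the index 0 contributes nothing,
  since \<open>0 powr x = 0\<close>.\<close>

lemma int_powr_summable:
  assumes p: "p > 1"
  shows "(\<lambda>j::int. \<bar>real_of_int j\<bar> powr (- p)) summable_on UNIV"
proof -
  have "summable (\<lambda>n. real n powr (- p))" using p by (simp add: summable_real_powr_iff)
  then have nat: "(\<lambda>n. real n powr (- p)) summable_on UNIV" by (simp add: summable_on_UNIV_nonneg_real_iff)
  have "(\<lambda>j::int. \<bar>real_of_int j\<bar> powr (- p)) summable_on range int"
    using nat by (subst summable_on_reindex) (auto simp: o_def)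
  moreover have "(\<lambda>j::int. \<bar>real_of_int j\<bar> powr (- p)) summable_on range (\<lambda>n. - int n)"
    using nat by (subst summable_on_reindex) (auto simp: o_def inj_on_def)
  ultimately have "(\<lambda>j::int. \<bar>real_of_int j\<bar> powr (- p)) summable_on (range int \<union> range (\<lambda>n. - int n))"
    by (rule summable_on_union)
  moreover have "range int \<union> range (\<lambda>n. - int n) = UNIV"
  proof (intro equalityI subsetI UnCI)
    fix j :: int assume "j \<notin> range (\<lambda>n. - int n)"
    then have "j \<noteq> - int (nat (- j))" by blast
    then have "j > 0" by (cases "j \<le> 0") auto
    then have "j = int (nat j)" by auto
    then show "j \<in> range int" by blast
  qed simp
  ultimately show ?thesis by simp
qed

lemma int_weight_summable:
  assumes p: "p > 1"
  shows "(\<lambda>j::int. (1 + \<bar>real_of_int j\<bar>) powr (- p)) summable_on UNIV"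
proof (rule summable_on_comparison_test)
  \<comment> \<open>The extra 1 at j = 0 covers the one index at which the majorant vanishes and the
    weight does not.\<close>
  show "(\<lambda>j::int. \<bar>real_of_int j\<bar> powr (- p) + (if j = 0 then 1 else 0)) summable_on UNIV"
    by (intro summable_on_add int_powr_summable p finite_nonzero_values_imp_summable_on) simp
  fix j :: int
  show "(1 + \<bar>real_of_int j\<bar>) powr (- p) \<le> \<bar>real_of_int j\<bar> powr (- p) + (if j = 0 then 1 else 0)"
    using p by (auto intro!: powr_mono2')
qed simp

text \<open>2|a| <= 1/w^2 + w^2 |a|^2, and for p > 1 the reciprocal weights are summable. This is
  the embedding of periodic Sobolev spaces of order above 1/2 into absolutely convergent
  series.\<close>

lemma summable_norm_of_weighted:
  fixes a :: "int \<Rightarrow> 'a::real_normed_vector"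
  assumes p: "p > 1" and "(\<lambda>k. (1 + \<bar>real_of_int k\<bar>) powr p * (norm (a k))\<^sup>2) summable_on UNIV"
  shows "(\<lambda>k. norm (a k)) summable_on UNIV"
proof (rule summable_on_comparison_test)
  show "(\<lambda>k. (1 + \<bar>real_of_int k\<bar>) powr (- p) + (1 + \<bar>real_of_int k\<bar>) powr p * (norm (a k))\<^sup>2) summable_on UNIV"
    by (intro summable_on_add int_weight_summable assms)
  fix k :: int
  define w where "w = (1 + \<bar>real_of_int k\<bar>) powr (p / 2)"
  have w: "w > 0" by (simp add: w_def)
  have w2: "w\<^sup>2 = (1 + \<bar>real_of_int k\<bar>) powr p"
    by (simp add: w_def powr_powr powr_power)
  have "2 * (1 / w) * (w * norm (a k)) \<le> (1 / w)\<^sup>2 + (w * norm (a k))\<^sup>2" by (rule sum_squares_bound)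
  then have "2 * norm (a k) \<le> 1 / w\<^sup>2 + w\<^sup>2 * (norm (a k))\<^sup>2"
    using w by (simp add: power_mult_distrib power_divide)
  then have "norm (a k) \<le> 1 / w\<^sup>2 + w\<^sup>2 * (norm (a k))\<^sup>2" by (smt (verit) norm_ge_zero)
  then show "norm (a k) \<le> (1 + \<bar>real_of_int k\<bar>) powr (- p) + (1 + \<bar>real_of_int k\<bar>) powr p * (norm (a k))\<^sup>2"
    unfolding w2 by (simp add: powr_minus field_simps)
qed simp

section \<open>Residue classes and the aliasing formula\<close>

definition interp_band :: "nat \<Rightarrow> int set" where
  "interp_band n = {- int ((n - 1) div 2)..int (n div 2)}"

definition residue_class :: "nat \<Rightarrow> int \<Rightarrow> int set" where
  "residue_class n k = {m. m mod int n = k mod int n}"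

lemma finite_interp_band [simp]: "finite (interp_band n)" by (simp add: interp_band_def)

lemma interp_band_abs_le: "k \<in> interp_band n \<Longrightarrow> 2 * \<bar>k\<bar> \<le> int n"
  by (auto simp: interp_band_def)

lemma not_interp_band_abs_ge: "k \<notin> interp_band n \<Longrightarrow> int n \<le> 2 * (1 + \<bar>k\<bar>)"
  by (auto simp: interp_band_def)

lemma interp_band_width: "n > 0 \<Longrightarrow> k \<in> interp_band n \<Longrightarrow> l \<in> interp_band n \<Longrightarrow> \<bar>k - l\<bar> < int n"
  by (auto simp: interp_band_def)

lemma residue_class_disjoint:
  assumes "n > 0" "k \<in> interp_band n" "l \<in> interp_band n" "k \<noteq> l"
  shows "residue_class n k \<inter> residue_class n l = {}"
proof (rule ccontr)
  assume "residue_class n k \<inter> residue_class n l \<noteq> {}"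
  then have "k mod int n = l mod int n" by (auto simp: residue_class_def)
  then have "int n dvd k - l" by (simp add: mod_eq_dvd_iff)
  then have "int n \<le> \<bar>k - l\<bar>" using assms(4) by (intro zdvd_imp_le) auto
  then show False using interp_band_width[OF assms(1-3)] by linarith
qed

lemma residue_class_cover:
  assumes "n > 0"
  shows "(\<Union>k\<in>interp_band n. residue_class n k) = UNIV"
proof (intro equalityI subsetI)
  fix m :: int
  define b where "b = int ((n - 1) div 2)"
  \<comment> \<open>The band has exactly \<open>n\<close> consecutive indices and begins at
    \<open>-b\<close>, so shifting the remainder by \<open>b\<close> lands in it.\<close>
  define k where "k = (m + b) mod int n - b"
  have "0 \<le> (m + b) mod int n" "(m + b) mod int n < int n" using assms by auto
  moreover have "int n = b + int (n div 2) + 1" using assms unfolding b_def by linarith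
  ultimately have "k \<in> interp_band n" by (auto simp: k_def interp_band_def b_def)
  moreover have "k mod int n = m mod int n" unfolding k_def by (simp add: mod_diff_left_eq)
  ultimately show "m \<in> (\<Union>k\<in>interp_band n. residue_class n k)" by (intro UN_I[of k]) (auto simp: residue_class_def)
qed simp

lemma roots_of_unity_sum:
  assumes n: "n > 0"
  shows "(\<Sum>l<n. exp (\<i> * of_int j * of_real (2 * pi * real l / real n))) = (if int n dvd j then of_nat n else 0)"
proof -
  define w where "w = exp (\<i> * of_int j * of_real (2 * pi / real n))"
  have wl: "exp (\<i> * of_int j * of_real (2 * pi * real l / real n)) = w ^ l" for l
    unfolding w_def by (simp flip: exp_of_nat_mult add: mult_ac)
  have wn: "w ^ n = 1"
    unfolding wl[symmetric] using n exp_integer_2pi[of "of_int j"] by (simp add: mult_ac)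
  have "w = 1 \<longleftrightarrow> int n dvd j"
  proof
    assume "w = 1"
    then obtain m :: int where "of_int j * (2 * pi / real n) = of_int (2 * m) * pi"
      unfolding w_def by (auto simp: exp_eq_1)
    then have "real_of_int j = real_of_int (m * int n)" using n by (simp add: field_simps)
    then have "j = m * int n" by (simp only: of_int_eq_iff)
    then show "int n dvd j" by simp
  next
    assume "int n dvd j"
    then obtain m where "j = int n * m" by blast
    then show "w = 1" unfolding w_def using n exp_integer_2pi[of "of_int m"] by (simp add: mult_ac)
  qed
  then show ?thesis unfolding wl using wn by (cases "w = 1") (auto simp: geometric_sum)
qed

text \<open>At the nodes, exponentials whose indices agree modulo \<open>n\<close> coincide. The
  node sum is finite, so it may be exchanged with the series; orthogonality of the roots of unity
  then removes every other residue class.\<close>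

lemma discrete_coeff_alias:
  assumes n: "n > 0"
    and F: "\<And>l. l < n \<Longrightarrow> ((\<lambda>k. a k * exp (\<i> * of_int k * of_real (2 * pi * real l / real n))) has_sum F (2 * pi * real l / real n)) UNIV"
  shows "(a has_sum discrete_coeff n F k) (residue_class n k)"
proof -
  let ?\<theta> = "\<lambda>l. 2 * pi * real l / real n"
  have "((\<lambda>m. 1 / of_nat n * (\<Sum>l<n. exp (- (\<i> * of_int k * of_real (?\<theta> l))) * (a m * exp (\<i> * of_int m * of_real (?\<theta> l)))))
      has_sum discrete_coeff n F k) UNIV"
    unfolding discrete_coeff_def
    by (intro has_sum_cmult_right has_sum_finite_sum F) auto
  also have "(\<lambda>m. 1 / of_nat n * (\<Sum>l<n. exp (- (\<i> * of_int k * of_real (?\<theta> l))) * (a m * exp (\<i> * of_int m * of_real (?\<theta> l)))))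
      = (\<lambda>m. if m \<in> residue_class n k then a m else 0)"
  proof
    fix m
    have "(\<Sum>l<n. exp (- (\<i> * of_int k * of_real (?\<theta> l))) * (a m * exp (\<i> * of_int m * of_real (?\<theta> l))))
       = a m * (\<Sum>l<n. exp (\<i> * of_int (m - k) * of_real (?\<theta> l)))"
      unfolding sum_distrib_left
    proof (intro sum.cong refl)
      fix l
      have "exp (\<i> * of_int (m - k) * of_real (?\<theta> l)) = exp (- (\<i> * of_int k * of_real (?\<theta> l))) * exp (\<i> * of_int m * of_real (?\<theta> l))"
        by (simp flip: exp_add add: algebra_simps diff_divide_distrib)
      then show "exp (- (\<i> * of_int k * of_real (?\<theta> l))) * (a m * exp (\<i> * of_int m * of_real (?\<theta> l)))
          = a m * exp (\<i> * of_int (m - k) * of_real (?\<theta> l))" by simp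
    qed
    then show "1 / of_nat n * (\<Sum>l<n. exp (- (\<i> * of_int k * of_real (?\<theta> l))) * (a m * exp (\<i> * of_int m * of_real (?\<theta> l))))
        = (if m \<in> residue_class n k then a m else 0)"
      using n by (simp only: roots_of_unity_sum) (auto simp: residue_class_def mod_eq_dvd_iff)
  qed
  finally have "((\<lambda>m. if m \<in> residue_class n k then a m else 0) has_sum discrete_coeff n F k) UNIV" .
  then show ?thesis
    by (subst has_sum_cong_neutral[where g = "\<lambda>m. if m \<in> residue_class n k then a m else 0" and T = UNIV]) auto
qed

text \<open>The 1 accounts for the coefficients outside the band, the infinite sum for those folded
  into it; \<open>4 powr s\<close> stems from the half in (n/2)^(-2s).\<close>

definition aliasing_const :: "real \<Rightarrow> real" where
  "aliasing_const s = 4 powr s * (1 + (\<Sum>\<^sub>\<infinity>j::int. \<bar>real_of_int j\<bar> powr (- (2 * s))))"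

lemma aliasing_const_nonneg: "aliasing_const s \<ge> 0"
  unfolding aliasing_const_def by (intro mult_nonneg_nonneg add_nonneg_nonneg infsum_nonneg) auto

text \<open>Write m = k + nj with j ~= 0. As |k| <= n/2 <= n|j|/2, it follows that |m| >= n|j|/2, so
  the weights are dominated by a zeta series in \<open>j\<close>.\<close>

lemma aliased_weights:
  assumes n: "n > 1" and s: "s \<ge> 1" and k: "k \<in> interp_band n"
    and X: "finite X" "X \<subseteq> residue_class n k - {k}"
  shows "(\<Sum>m\<in>X. 1 / (1 + \<bar>real_of_int m\<bar>) powr (2 * s))
    \<le> 4 powr s * real n powr (- (2 * s)) * (\<Sum>\<^sub>\<infinity>j::int. \<bar>real_of_int j\<bar> powr (- (2 * s)))"
proof -
  define j where "j m = (m - k) div int n" for m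
  have m: "m = k + int n * j m" "j m \<noteq> 0" if "m \<in> X" for m
  proof -
    have "m mod int n = k mod int n" "m \<noteq> k" using X that by (auto simp: residue_class_def)
    then have "int n dvd m - k" by (simp add: mod_eq_dvd_iff)
    then show "m = k + int n * j m" by (simp add: j_def)
    then show "j m \<noteq> 0" using \<open>m \<noteq> k\<close> by auto
  qed
  have "1 / (1 + \<bar>real_of_int m\<bar>) powr (2 * s) \<le> 4 powr s * real n powr (- (2 * s)) * \<bar>real_of_int (j m)\<bar> powr (- (2 * s))" if "m \<in> X" for m
  proof -
    have "\<bar>int n * j m\<bar> \<le> \<bar>m\<bar> + \<bar>k\<bar>" using m(1)[OF that] by linarith
    then have "2 * (int n * \<bar>j m\<bar>) \<le> 2 * \<bar>m\<bar> + int n" using interp_band_abs_le[OF k] by (simp add: abs_mult)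
    moreover have "int n \<le> int n * \<bar>j m\<bar>" using m(2)[OF that] n by simp
    ultimately have "int n * \<bar>j m\<bar> \<le> 2 * \<bar>m\<bar>" by linarith
    then have "real_of_int (int n * \<bar>j m\<bar>) \<le> real_of_int (2 * \<bar>m\<bar>)" by (simp only: of_int_le_iff)
    then have le: "real n / 2 * \<bar>real_of_int (j m)\<bar> \<le> 1 + \<bar>real_of_int m\<bar>" by simp
    have "1 / (1 + \<bar>real_of_int m\<bar>) powr (2 * s) = (1 + \<bar>real_of_int m\<bar>) powr (- (2 * s))" by (simp add: powr_minus_divide)
    also have "\<dots> \<le> (real n / 2 * \<bar>real_of_int (j m)\<bar>) powr (- (2 * s))"
      using le n m(2)[OF that] s by (intro powr_mono2') auto
    also have "\<dots> = (real n / 2) powr (- (2 * s)) * \<bar>real_of_int (j m)\<bar> powr (- (2 * s))"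
      by (rule powr_mult)
    also have "(real n / 2) powr (- (2 * s)) = 4 powr s * real n powr (- (2 * s))"
      using powr_powr[of 2 2 s] n by (simp add: powr_divide powr_minus field_simps)
    finally show ?thesis .
  qed
  then have "(\<Sum>m\<in>X. 1 / (1 + \<bar>real_of_int m\<bar>) powr (2 * s))
      \<le> (\<Sum>m\<in>X. 4 powr s * real n powr (- (2 * s)) * \<bar>real_of_int (j m)\<bar> powr (- (2 * s)))" by (rule sum_mono)
  also have "\<dots> = 4 powr s * real n powr (- (2 * s)) * (\<Sum>m\<in>X. \<bar>real_of_int (j m)\<bar> powr (- (2 * s)))"
    by (simp add: sum_distrib_left)
  also have "(\<Sum>m\<in>X. \<bar>real_of_int (j m)\<bar> powr (- (2 * s))) = (\<Sum>i\<in>j ` X. \<bar>real_of_int i\<bar> powr (- (2 * s)))"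
  proof (subst sum.reindex)
    show "inj_on j X" using m(1) by (metis inj_onI)
  qed simp
  also have "4 powr s * real n powr (- (2 * s)) * \<dots> \<le> 4 powr s * real n powr (- (2 * s)) * (\<Sum>\<^sub>\<infinity>j::int. \<bar>real_of_int j\<bar> powr (- (2 * s)))"
    using X s by (intro mult_left_mono finite_sum_le_infsum int_powr_summable) auto
  finally show ?thesis .
qed

text \<open>On the band the error coefficient is the sum over the residue class without its
  representative; Cauchy-Schwarz bounds it by the energy of the class, and since the classes are
  disjoint their energies add up to at most the full norm. Off the band it is the negated Fourier
  coefficient, and lowering the order from \<open>s\<close> to \<open>r\<close> gains
  (n/2)^(2(r-s)).\<close>

lemma aliasing_energy:
  fixes a d :: "int \<Rightarrow> complex"
  assumes n: "n > 1" and s: "s \<ge> 1" and r: "0 \<le> r" "r \<le> s"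
    and summ: "(\<lambda>k. (1 + \<bar>real_of_int k\<bar>) powr (2 * s) * (norm (a k))\<^sup>2) summable_on UNIV"
    and d: "\<And>k. k \<in> interp_band n \<Longrightarrow> (a has_sum d k) (residue_class n k)"
    and X: "finite X"
  shows "(\<Sum>k\<in>X. (1 + \<bar>real_of_int k\<bar>) powr (2 * r) * (norm ((if k \<in> interp_band n then d k else 0) - a k))\<^sup>2)
    \<le> aliasing_const s * real n powr (2 * (r - s)) * (\<Sum>\<^sub>\<infinity>k. (1 + \<bar>real_of_int k\<bar>) powr (2 * s) * (norm (a k))\<^sup>2)"
proof -
  define w where "w k = (1 + \<bar>real_of_int k\<bar>) powr (2 * s)" for k
  define q where "q k = w k * (norm (a k))\<^sup>2" for k
  define S where "S = (\<Sum>\<^sub>\<infinity>k. q k)"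
  define Z where "Z = (\<Sum>\<^sub>\<infinity>j::int. \<bar>real_of_int j\<bar> powr (- (2 * s)))"
  let ?E = "\<lambda>k. (if k \<in> interp_band n then d k else 0) - a k"
  let ?v = "\<lambda>k. (1 + \<bar>real_of_int k\<bar>) powr (2 * r)"
  have q: "q summable_on A" for A
    using summ summable_on_subset_banach[of _ UNIV A] unfolding q_def w_def by blast
  have q0: "q k \<ge> 0" for k by (simp add: q_def w_def)
  have a: "a summable_on A" for A
  proof -
    have "(\<lambda>k. norm (a k)) summable_on UNIV" using summable_norm_of_weighted[OF _ summ] s by simp
    then have "a summable_on UNIV" by (rule Infinite_Sum.abs_summable_summable)
    then show ?thesis by (rule summable_on_subset_banach) simp
  qed
  have n0: "n > 0" using n by simp
  have S0: "S \<ge> 0" unfolding S_def by (intro infsum_nonneg q0)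
  have Z0: "Z \<ge> 0" unfolding Z_def by (intro infsum_nonneg) auto
  have inband: "?v k * (norm (?E k))\<^sup>2 \<le> 4 powr s * Z * real n powr (2 * (r - s)) * infsum q (residue_class n k)"
    if k: "k \<in> interp_band n" for k
  proof -
    have sub: "{k} \<subseteq> residue_class n k" by (simp add: residue_class_def)
    have "(a has_sum (d k - a k)) (residue_class n k - {k})"
      using has_sum_Diff[OF d[OF k], of "{k}" "a k"] sub has_sum_finite[of "{k}" a] by simp
    then have E: "?E k = infsum a (residue_class n k - {k})" using k by (simp add: infsumI)
    have "norm (infsum a (residue_class n k - {k})) \<le> sqrt (4 powr s * real n powr (- (2 * s)) * Z * infsum q (residue_class n k))"
    proof (rule infsum_norm_bound[OF a])
      fix Y assume Y: "finite Y" "Y \<subseteq> residue_class n k - {k}"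
      have "(norm (\<Sum>k\<in>Y. a k * 1))\<^sup>2 \<le> (4 powr s * real n powr (- (2 * s)) * Z) * infsum q (residue_class n k)"
      proof (rule norm_sum_mult_sq_le[where w = w])
        show "(\<Sum>k\<in>Y. (norm (1::complex))\<^sup>2 / w k) \<le> 4 powr s * real n powr (- (2 * s)) * Z"
          unfolding w_def Z_def using aliased_weights[OF n s k Y] by simp
        have "(\<Sum>k\<in>Y. q k) \<le> infsum q (residue_class n k)"
          using Y q0 by (intro finite_sum_le_infsum q) auto
        then show "(\<Sum>k\<in>Y. w k * (norm (a k))\<^sup>2) \<le> infsum q (residue_class n k)" by (simp add: q_def)
      qed (simp add: w_def)
      then show "norm (sum a Y) \<le> sqrt (4 powr s * real n powr (- (2 * s)) * Z * infsum q (residue_class n k))"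
        by (simp add: real_le_rsqrt)
    qed
    then have "(norm (?E k))\<^sup>2 \<le> (sqrt (4 powr s * real n powr (- (2 * s)) * Z * infsum q (residue_class n k)))\<^sup>2"
      unfolding E by (intro power_mono) auto
    also have "\<dots> = 4 powr s * real n powr (- (2 * s)) * Z * infsum q (residue_class n k)"
      using Z0 infsum_nonneg[of "residue_class n k" q] q0 by simp
    finally have 1: "(norm (?E k))\<^sup>2 \<le> 4 powr s * real n powr (- (2 * s)) * Z * infsum q (residue_class n k)" .
    have "1 + \<bar>k\<bar> \<le> int n" using interp_band_abs_le[OF k] n by linarith
    then have "real_of_int (1 + \<bar>k\<bar>) \<le> real_of_int (int n)" by (simp only: of_int_le_iff)
    then have "?v k \<le> real n powr (2 * r)" using r by (intro powr_mono2) auto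
    then have "?v k * (norm (?E k))\<^sup>2 \<le> real n powr (2 * r) * (4 powr s * real n powr (- (2 * s)) * Z * infsum q (residue_class n k))"
      using 1 by (intro mult_mono) auto
    also have "\<dots> = 4 powr s * Z * (real n powr (2 * r) * real n powr (- (2 * s))) * infsum q (residue_class n k)"
      by (simp add: mult_ac)
    also have "real n powr (2 * r) * real n powr (- (2 * s)) = real n powr (2 * (r - s))"
      by (simp add: algebra_simps flip: powr_add)
    finally show ?thesis .
  qed
  have offband: "?v k * (norm (?E k))\<^sup>2 \<le> 4 powr s * real n powr (2 * (r - s)) * q k" if k: "k \<notin> interp_band n" for k
  proof -
    have "real_of_int (int n) \<le> real_of_int (2 * (1 + \<bar>k\<bar>))" using not_interp_band_abs_ge[OF k] by (simp only: of_int_le_iff)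
    then have le: "real n / 2 \<le> 1 + \<bar>real_of_int k\<bar>" by simp
    have "?v k = w k * (1 + \<bar>real_of_int k\<bar>) powr (2 * (r - s))"
      unfolding w_def by (simp add: algebra_simps flip: powr_add)
    also have "\<dots> \<le> w k * (real n / 2) powr (2 * (r - s))"
      using le n r by (intro mult_left_mono powr_mono2') (auto simp: w_def)
    also have "(real n / 2) powr (2 * (r - s)) = real n powr (2 * (r - s)) * 4 powr (s - r)"
    proof -
      have "(4::real) powr (s - r) = 2 powr (2 * (s - r))" using powr_powr[of 2 2 "s - r"] by simp
      also have "\<dots> = 1 / 2 powr (2 * (r - s))" using powr_minus_divide[of 2 "2 * (r - s)"] by (simp add: algebra_simps)
      finally show ?thesis by (simp add: powr_divide)
    qed
    also have "w k * (real n powr (2 * (r - s)) * 4 powr (s - r)) \<le> w k * (real n powr (2 * (r - s)) * 4 powr s)"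
      using r by (intro mult_left_mono powr_mono) (auto simp: w_def)
    finally have "?v k * (norm (?E k))\<^sup>2 \<le> w k * (real n powr (2 * (r - s)) * 4 powr s) * (norm (?E k))\<^sup>2"
      by (rule mult_right_mono) simp
    then show ?thesis using k by (simp add: q_def mult_ac)
  qed
  have "(\<Sum>k\<in>X \<inter> interp_band n. ?v k * (norm (?E k))\<^sup>2)
      \<le> (\<Sum>k\<in>X \<inter> interp_band n. 4 powr s * Z * real n powr (2 * (r - s)) * infsum q (residue_class n k))"
    by (intro sum_mono inband) auto
  also have "\<dots> = 4 powr s * Z * real n powr (2 * (r - s)) * (\<Sum>k\<in>X \<inter> interp_band n. infsum q (residue_class n k))"
    by (simp add: sum_distrib_left)
  also have "(\<Sum>k\<in>X \<inter> interp_band n. infsum q (residue_class n k)) = infsum q (\<Union>k\<in>X \<inter> interp_band n. residue_class n k)"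
    using X residue_class_disjoint[OF n0] by (intro sum_infsum q) auto
  also have "4 powr s * Z * real n powr (2 * (r - s)) * \<dots> \<le> 4 powr s * Z * real n powr (2 * (r - s)) * S"
    unfolding S_def using q0 Z0 by (intro mult_left_mono infsum_mono_neutral q) auto
  finally have A: "(\<Sum>k\<in>X \<inter> interp_band n. ?v k * (norm (?E k))\<^sup>2) \<le> 4 powr s * Z * real n powr (2 * (r - s)) * S" .
  have "(\<Sum>k\<in>X - interp_band n. ?v k * (norm (?E k))\<^sup>2) \<le> (\<Sum>k\<in>X - interp_band n. 4 powr s * real n powr (2 * (r - s)) * q k)"
    by (intro sum_mono offband) auto
  also have "\<dots> = 4 powr s * real n powr (2 * (r - s)) * (\<Sum>k\<in>X - interp_band n. q k)" by (simp add: sum_distrib_left)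
  also have "\<dots> \<le> 4 powr s * real n powr (2 * (r - s)) * S"
    unfolding S_def using X q0 by (intro mult_left_mono finite_sum_le_infsum q) auto
  finally have B: "(\<Sum>k\<in>X - interp_band n. ?v k * (norm (?E k))\<^sup>2) \<le> 4 powr s * real n powr (2 * (r - s)) * S" .
  have "(\<Sum>k\<in>X. ?v k * (norm (?E k))\<^sup>2)
      = (\<Sum>k\<in>X \<inter> interp_band n. ?v k * (norm (?E k))\<^sup>2) + (\<Sum>k\<in>X - interp_band n. ?v k * (norm (?E k))\<^sup>2)"
    using X by (rule sum.Int_Diff)
  also have "\<dots> \<le> aliasing_const s * real n powr (2 * (r - s)) * S"
    using add_mono[OF A B] unfolding aliasing_const_def Z_def[symmetric] by (simp add: algebra_simps)
  finally show ?thesis by (simp add: S_def q_def w_def)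
qed

section \<open>The coefficients of the interpolation error\<close>

context cayley
begin

definition error_coeff :: "nat \<Rightarrow> (real \<Rightarrow> complex) \<Rightarrow> int \<Rightarrow> complex" where
  "error_coeff n f k = (if k \<in> interp_band n then discrete_coeff n (pullback \<beta> f) k else 0) - fourier_coeff (pullback \<beta> f) k"

lemma
  assumes n: "n > 1" and f: "continuous_on UNIV f" "(f \<longlongrightarrow> 0) at_infinity"
    and s: "s \<ge> 1" and F: "pullback \<beta> f \<in> sobolev_circle s"
  shows error_coeff_summable: "(\<lambda>k. norm (error_coeff n f k)) summable_on UNIV"
    and error_coeff_has_sum_0: "(error_coeff n f has_sum 0) UNIV"
    and interp_error_has_sum: "((\<lambda>k. error_coeff n f k * M x powi k) has_sum interp_error \<beta> n f x) UNIV"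
    and error_coeff_energy: "\<And>r X. 0 \<le> r \<Longrightarrow> r \<le> s \<Longrightarrow> finite X \<Longrightarrow>
      (\<Sum>k\<in>X. (1 + \<bar>real_of_int k\<bar>) powr (2 * r) * (norm (error_coeff n f k))\<^sup>2)
        \<le> aliasing_const s * (real n powr (r - s) * sobolev_circle_norm s (pullback \<beta> f))\<^sup>2"
proof -
  define a where "a = fourier_coeff (pullback \<beta> f)"
  define d where "d = discrete_coeff n (pullback \<beta> f)"
  have E: "error_coeff n f k = (if k \<in> interp_band n then d k else 0) - a k" for k
    by (simp add: error_coeff_def a_def d_def)
  have summ: "(\<lambda>k. (1 + \<bar>real_of_int k\<bar>) powr (2 * s) * (norm (a k))\<^sup>2) summable_on UNIV"
    using F by (simp add: sobolev_circle_def a_def)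
  have na: "(\<lambda>k. norm (a k)) summable_on UNIV" using summable_norm_of_weighted[OF _ summ] s by simp
  then have as: "a summable_on UNIV" by (rule Infinite_Sum.abs_summable_summable)
  have pb: "((\<lambda>k. a k * exp (\<i> * of_int k * of_real \<theta>)) has_sum pullback \<beta> f \<theta>) UNIV" if "0 \<le> \<theta>" "\<theta> \<le> 2 * pi" for \<theta>
    using pullback_has_sum[OF \<beta>_pos f na[unfolded a_def] that] by (simp add: a_def)
  have d: "(a has_sum d k) (residue_class n k)" for k
    unfolding d_def
  proof (rule discrete_coeff_alias)
    fix l assume "l < n"
    then show "((\<lambda>k. a k * exp (\<i> * of_int k * of_real (2 * pi * real l / real n))) has_sum pullback \<beta> f (2 * pi * real l / real n)) UNIV"
      by (intro pb) (auto simp: field_simps)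
  qed (use n in simp)
  have "(\<lambda>k. norm (if k \<in> interp_band n then d k else 0) + norm (a k)) summable_on UNIV"
    by (intro summable_on_add na finite_nonzero_values_imp_summable_on finite_subset[OF _ finite_interp_band[of n]]) auto
  then show "(\<lambda>k. norm (error_coeff n f k)) summable_on UNIV"
    by (rule summable_on_comparison_test) (simp_all add: E norm_triangle_ineq4)
  have band: "((\<lambda>k. if k \<in> interp_band n then g k else 0) has_sum (\<Sum>k\<in>interp_band n. g k)) UNIV" for g :: "int \<Rightarrow> complex"
    using has_sum_finite[OF finite_interp_band[of n], of g]
    by (subst has_sum_cong_neutral[where g = g and T = "interp_band n"]) auto
  \<comment> \<open>The residue classes of the band partition the integers, so the discrete
    coefficients have the same total as the Fourier coefficients and the total of the differences is
    0.\<close>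
  have "(\<Sum>k\<in>interp_band n. d k) = (\<Sum>k\<in>interp_band n. infsum a (residue_class n k))"
    by (intro sum.cong refl infsumI[OF d, symmetric])
  also have "\<dots> = infsum a (\<Union>k\<in>interp_band n. residue_class n k)"
    using d n residue_class_disjoint[of n] by (intro sum_infsum) (auto intro: has_sum_imp_summable)
  also have "\<dots> = infsum a UNIV" using n by (simp add: residue_class_cover)
  finally have "((\<lambda>k. if k \<in> interp_band n then d k else 0) has_sum infsum a UNIV) UNIV" using band[of d] by simp
  from has_sum_minus[OF this has_sum_infsum[OF as]] show "(error_coeff n f has_sum 0) UNIV"
    by (simp add: E[abs_def])
  obtain \<theta> where \<theta>: "0 < \<theta>" "\<theta> < 2 * pi" "M x = exp (\<i> * of_real \<theta>)" "circle_to_line \<beta> \<theta> = x"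
    using moebius_eq_exp_i_obtain[OF \<beta>_pos] by blast
  have "((\<lambda>k. a k * M x powi k) has_sum f x) UNIV"
    using pb[of \<theta>] \<theta> unfolding \<theta>(3) exp_i_powi by (simp add: pullback_def)
  from has_sum_minus[OF band[of "\<lambda>k. d k * M x powi k"] this]
  have "((\<lambda>k. (if k \<in> interp_band n then d k * M x powi k else 0) - a k * M x powi k) has_sum interp_error \<beta> n f x) UNIV"
    by (simp add: interp_error_def rational_interp_def d_def interp_band_def)
  also have "(\<lambda>k. (if k \<in> interp_band n then d k * M x powi k else 0) - a k * M x powi k) = (\<lambda>k. error_coeff n f k * M x powi k)"
    by (auto simp: E left_diff_distrib)
  finally show "((\<lambda>k. error_coeff n f k * M x powi k) has_sum interp_error \<beta> n f x) UNIV" .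
  fix r X assume r: "0 \<le> r" "r \<le> s" and X: "finite (X :: int set)"
  have "(\<Sum>k\<in>X. (1 + \<bar>real_of_int k\<bar>) powr (2 * r) * (norm (error_coeff n f k))\<^sup>2)
    \<le> aliasing_const s * real n powr (2 * (r - s)) * (\<Sum>\<^sub>\<infinity>k. (1 + \<bar>real_of_int k\<bar>) powr (2 * s) * (norm (a k))\<^sup>2)"
    unfolding E by (rule aliasing_energy[OF n s r summ d X])
  also have "(\<Sum>\<^sub>\<infinity>k. (1 + \<bar>real_of_int k\<bar>) powr (2 * s) * (norm (a k))\<^sup>2) = (sobolev_circle_norm s (pullback \<beta> f))\<^sup>2"
    unfolding sobolev_circle_norm_def a_def by (subst real_sqrt_pow2) (auto intro!: infsum_nonneg)
  also have "real n powr (2 * (r - s)) = (real n powr (r - s))\<^sup>2" using n powr_powr[of "real n" "r - s" 2] by (simp add: mult.commute)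
  finally show "(\<Sum>k\<in>X. (1 + \<bar>real_of_int k\<bar>) powr (2 * r) * (norm (error_coeff n f k))\<^sup>2)
        \<le> aliasing_const s * (real n powr (r - s) * sobolev_circle_norm s (pullback \<beta> f))\<^sup>2"
    by (simp add: power_mult_distrib mult.assoc)
qed

end

section \<open>Derivatives of the error\<close>

lemma symmetric_intervals_filterlim:
  "filterlim (\<lambda>N. {- int N..int N}) (finite_subsets_at_top UNIV) sequentially"
  unfolding filterlim_finite_subsets_at_top
proof (intro allI impI)
  fix X :: "int set" assume "finite X \<and> X \<subseteq> UNIV"
  then have X: "finite X" by simp
  define n where "n = nat (Max (insert 0 (abs ` X)))"
  have "\<bar>k\<bar> \<le> int n" if "k \<in> X" for k
  proof -
    have "\<bar>k\<bar> \<le> Max (insert 0 (abs ` X))" using X that by (intro Max_ge) auto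
    then show ?thesis unfolding n_def by linarith
  qed
  then have "X \<subseteq> {- int N..int N}" if "N \<ge> n" for N using that by fastforce
  then show "\<forall>\<^sub>F N in sequentially. finite {- int N..int N} \<and> X \<subseteq> {- int N..int N} \<and> {- int N..int N} \<subseteq> UNIV"
    unfolding eventually_sequentially by auto
qed

lemma has_sum_symmetric_limit:
  assumes "(f has_sum S) (UNIV :: int set)"
  shows "(\<lambda>N. \<Sum>k\<in>{- int N..int N}. f k) \<longlonglongrightarrow> S"
  using filterlim_compose[OF assms[unfolded has_sum_def] symmetric_intervals_filterlim] .

lemma truncated_fourier_henstock:
  assumes "continuous_on {-R..R} f"
  shows "truncated_fourier R f k = integral {-R..R} (\<lambda>x. exp (- (\<i> * of_real k * of_real x)) * f x)"
  unfolding truncated_fourier_def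
  by (intro set_borel_integral_eq_integral(2) borel_integrable_atLeastAtMost' continuous_intros assms)

lemma truncated_fourier_uniform_limit:
  assumes u: "uniform_limit {-R..R} f g F" and c: "\<And>n. continuous_on {-R..R} (f n)" and F: "F \<noteq> bot"
  shows "((\<lambda>n. truncated_fourier R (f n) k) \<longlongrightarrow> truncated_fourier R g k) F"
proof -
  let ?e = "\<lambda>x. exp (- (\<i> * of_real k * of_real x)) :: complex"
  have g: "continuous_on {-R..R} g"
    by (rule uniform_limit_theorem[OF _ u F]) (simp add: c)
  have u': "uniform_limit {-R..R} (\<lambda>n x. ?e x * f n x) (\<lambda>x. ?e x * g x) F"
    by (intro uniform_lim_mult uniform_limit_const u compact_imp_bounded compact_continuous_image continuous_intros g) auto
  obtain I J where IJ: "\<And>n. ((\<lambda>x. ?e x * f n x) has_integral I n) {-R..R}" "((\<lambda>x. ?e x * g x) has_integral J) {-R..R}" "(I \<longlongrightarrow> J) F"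
    by (rule uniform_limit_integral[OF u' _ F]) (auto intro!: continuous_intros c)
  show ?thesis
    using IJ(3) unfolding truncated_fourier_henstock[OF c] truncated_fourier_henstock[OF g]
    by (simp only: integral_unique[OF IJ(1)] integral_unique[OF IJ(2)])
qed

lemma truncated_fourier_L1_tendsto:
  assumes g: "\<And>n. integrable lborel (g n)" and f: "integrable lborel f"
    and lim: "(\<lambda>n. LINT x|lborel. norm (g n x - f x)) \<longlonglongrightarrow> 0"
  shows "(\<lambda>n. truncated_fourier R (g n) k) \<longlonglongrightarrow> truncated_fourier R f k"
  unfolding truncated_fourier_eq
proof (rule fourier_L1_tendsto)
  have ind: "integrable lborel (\<lambda>x. indicator {-R..R} x * h x)" if "integrable lborel h" for h :: "real \<Rightarrow> complex"
    using integrable_mult_indicator[OF _ that, of "{-R..R}"] by (simp add: scaleR_conv_of_real of_real_indicator)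
  show i: "integrable lborel (\<lambda>x. indicator {-R..R} x * g n x)" "integrable lborel (\<lambda>x. indicator {-R..R} x * f x)" for n
    by (intro ind g f)+
  show "(\<lambda>n. LINT x|lborel. norm (indicator {-R..R} x * g n x - indicator {-R..R} x * f x)) \<longlonglongrightarrow> 0"
  proof (rule Lim_null_comparison[OF always_eventually lim], intro allI)
    fix n
    have "(LINT x|lborel. norm (indicator {-R..R} x * g n x - indicator {-R..R} x * f x)) \<le> (LINT x|lborel. norm (g n x - f x))"
      using i g f by (intro integral_mono integrable_norm Bochner_Integration.integrable_diff) (auto simp: indicator_def)
    then show "norm (LINT x|lborel. norm (indicator {-R..R} x * g n x - indicator {-R..R} x * f x)) \<le> (LINT x|lborel. norm (g n x - f x))"
      by simp
  qed
qed

lemma truncated_fourier_by_parts: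
  assumes R: "R \<ge> 0" and der: "\<And>x. (g has_vector_derivative g' x) (at x)" and c: "continuous_on UNIV g'"
  shows "\<i> * of_real k * truncated_fourier R g k = truncated_fourier R g' k
    - (exp (- (\<i> * of_real k * of_real R)) * g R - exp (- (\<i> * of_real k * of_real (- R))) * g (- R))"
proof -
  let ?e = "\<lambda>x. exp (- (\<i> * of_real k * of_real x)) :: complex"
  note e = exp_imaginary_has_vector_derivative[of k]
  have gc: "continuous_on X g" for X
    using has_vector_derivative_continuous[OF der] by (simp add: continuous_at_imp_continuous_on)
  have g'c: "continuous_on X g'" for X using c continuous_on_subset by blast
  have "((\<lambda>x. ?e x * g' x + (- (\<i> * of_real k) * ?e x) * g x) has_integral ?e R * g R - ?e (-R) * g (-R)) {-R..R}"
  proof (rule fundamental_theorem_of_calculus[where f = "\<lambda>x. ?e x * g x"])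
    show "((\<lambda>x. ?e x * g x) has_vector_derivative ?e x * g' x + (- (\<i> * of_real k) * ?e x) * g x) (at x within {-R..R})" for x
      by (rule has_vector_derivative_at_within[OF has_vector_derivative_mult[OF e der]])
  qed (use R in simp)
  moreover have "integral {-R..R} (\<lambda>x. ?e x * g' x + (- (\<i> * of_real k) * ?e x) * g x)
      = integral {-R..R} (\<lambda>x. ?e x * g' x) + integral {-R..R} (\<lambda>x. - (\<i> * of_real k) * (?e x * g x))"
    unfolding mult.assoc
    by (intro integral_add integrable_continuous_real continuous_intros gc g'c)
  ultimately have "?e R * g R - ?e (-R) * g (-R) = truncated_fourier R g' k - \<i> * of_real k * truncated_fourier R g k"
    by (simp add: truncated_fourier_henstock gc g'c integral_unique)
  then show ?thesis by simp
qed

section \<open>Test functions\<close>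

lemma test_function_has_derivative:
  assumes "test_function \<phi>"
  shows "((deriv ^^ m) \<phi> has_real_derivative (deriv ^^ Suc m) \<phi> x) (at x)"
  using assms by (simp add: test_function_def DERIV_deriv_iff_field_differentiable)

lemma test_function_continuous:
  assumes "test_function \<phi>"
  shows "continuous_on X ((deriv ^^ m) \<phi>)"
  by (meson DERIV_continuous_on has_field_derivative_at_within test_function_has_derivative[OF assms])

lemma test_function_support:
  assumes "test_function \<phi>"
  obtains R where "\<And>m x. R < \<bar>x\<bar> \<Longrightarrow> (deriv ^^ m) \<phi> x = 0"
proof -
  obtain R where R: "\<And>x. \<bar>x\<bar> > R \<Longrightarrow> \<phi> x = 0" using assms by (auto simp: test_function_def)
  have "(deriv ^^ m) \<phi> x = 0" if "R < \<bar>x\<bar>" for m x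
    using that
  proof (induction m arbitrary: x)
    case (Suc m)
    have "open {x::real. R < \<bar>x\<bar>}" by (intro open_Collect_less continuous_intros)
    then have "((deriv ^^ m) \<phi> has_real_derivative 0) (at x)"
      using Suc by (intro has_field_derivative_transform_within_open[OF DERIV_const[of 0]]) auto
    then show ?case by (simp add: DERIV_imp_deriv)
  qed (simp add: R)
  then show ?thesis using that by blast
qed

lemma integrable_compact_support:
  fixes h :: "real \<Rightarrow> 'a::{banach, second_countable_topology}"
  assumes "continuous_on UNIV h" and "\<And>x. R < \<bar>x\<bar> \<Longrightarrow> h x = 0"
  shows "integrable lborel h"
proof -
  have "set_integrable lborel {-R..R} h"
    using assms(1) by (intro borel_integrable_atLeastAtMost') (rule continuous_on_subset, auto)
  moreover have "(\<lambda>x. indicator {-R..R} x *\<^sub>R h x) = h" using assms(2) by (auto simp: indicator_def fun_eq_iff)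
  ultimately show ?thesis by (simp add: set_integrable_def)
qed

section \<open>Higher derivatives of Laurent polynomials\<close>

context cayley
begin

text \<open>One derivative at a time moves from the test function to the Laurent polynomial,
  replacing \<open>c\<close> by \<open>diff_coeffs c\<close>, hence the generalisation over
  \<open>c\<close>. Boundary terms vanish by compact support.\<close>

lemma laurent_weak_derivative:
  assumes \<phi>: "test_function \<phi>" and "finite {k. c k \<noteq> 0}"
  shows "(LINT x|lborel. laurent c x * of_real ((deriv ^^ j) \<phi> x))
    = (-1) ^ j * (LINT x|lborel. laurent ((diff_coeffs ^^ j) c) x * of_real (\<phi> x))"
  using assms(2)
proof (induction j arbitrary: c)
  case (Suc j)
  obtain R where R: "\<And>m x. R < \<bar>x\<bar> \<Longrightarrow> (deriv ^^ m) \<phi> x = 0" using test_function_support[OF \<phi>] by blast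
  define \<psi> where "\<psi> m = (deriv ^^ m) \<phi>" for m
  have \<psi>: "continuous_on X (\<psi> m)" "\<And>x. R < \<bar>x\<bar> \<Longrightarrow> \<psi> m x = 0" for X m
    using test_function_continuous[OF \<phi>] R by (auto simp: \<psi>_def)
  have int: "integrable lborel (\<lambda>x. laurent c x * of_real (\<psi> m x))" for c m
    by (rule integrable_compact_support[where R = R]) (auto intro!: continuous_intros continuous_laurent \<psi>)
  have "(LINT x|lborel. laurent c x * of_real (\<psi> (Suc j) x) + laurent (diff_coeffs c) x * of_real (\<psi> j x)) = 0 - 0"
  proof (rule integral_FTC_line)
    show "((\<lambda>x. laurent c x * of_real (\<psi> j x)) has_vector_derivative
        laurent c x * of_real (\<psi> (Suc j) x) + laurent (diff_coeffs c) x * of_real (\<psi> j x)) (at x)" for x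
    proof (rule has_vector_derivative_mult[OF laurent_has_vector_derivative[OF Suc.prems]])
      show "((\<lambda>x. complex_of_real (\<psi> j x)) has_vector_derivative of_real (\<psi> (Suc j) x)) (at x)"
        using test_function_has_derivative[OF \<phi>, of j x] unfolding \<psi>_def
        by (intro has_vector_derivative_of_real) (simp add: has_real_derivative_iff_has_vector_derivative)
    qed
    show "continuous_on UNIV (\<lambda>x. laurent c x * of_real (\<psi> (Suc j) x) + laurent (diff_coeffs c) x * of_real (\<psi> j x))"
      by (intro continuous_intros continuous_laurent \<psi>)
    show "integrable lborel (\<lambda>x. laurent c x * of_real (\<psi> (Suc j) x) + laurent (diff_coeffs c) x * of_real (\<psi> j x))"
      by (intro Bochner_Integration.integrable_add int)
    have "\<forall>\<^sub>F x in at_bot. laurent c x * of_real (\<psi> j x) = 0"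
      using eventually_gt_at_bot[of "- \<bar>R\<bar>"] by (rule eventually_mono) (simp add: \<psi>)
    then show "((\<lambda>x. laurent c x * of_real (\<psi> j x)) \<longlongrightarrow> 0) at_bot" by (rule tendsto_eventually)
    have "\<forall>\<^sub>F x in at_top. laurent c x * of_real (\<psi> j x) = 0"
      using eventually_gt_at_top[of "\<bar>R\<bar>"] by (rule eventually_mono) (simp add: \<psi>)
    then show "((\<lambda>x. laurent c x * of_real (\<psi> j x)) \<longlongrightarrow> 0) at_top" by (rule tendsto_eventually)
  qed
  then have "(LINT x|lborel. laurent c x * of_real (\<psi> (Suc j) x)) = - (LINT x|lborel. laurent (diff_coeffs c) x * of_real (\<psi> j x))"
    using int by (simp add: add_eq_0_iff2)
  then show ?case
    using Suc.IH[OF finite_support_diff_coeffs[OF Suc.prems]] unfolding \<psi>_def by (simp add: funpow_swap1)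
qed simp

text \<open>Gives a name to a constant that depends only on the order and on \<beta>, so that the
  final constants are terms fixed before \<open>f\<close> and \<open>n\<close>.\<close>

definition energy_const :: "nat \<Rightarrow> real" where
  "energy_const j = (SOME C. C \<ge> 0 \<and> (\<forall>c. finite {k. c k \<noteq> 0} \<longrightarrow>
     weighted_energy 1 ((diff_coeffs ^^ j) c) \<le> C * weighted_energy (real j + 1) c))"

lemma energy_const:
  shows "energy_const j \<ge> 0"
    and "finite {k. c k \<noteq> 0} \<Longrightarrow> weighted_energy 1 ((diff_coeffs ^^ j) c) \<le> energy_const j * weighted_energy (real j + 1) c"
  using someI_ex[OF weighted_energy_diff_coeffs_funpow[of j, unfolded Bex_def]] unfolding energy_const_def by blast+

lemma diff_coeffs_funpow_add:
  "(diff_coeffs ^^ j) (\<lambda>k. a k + b k) = (\<lambda>k. (diff_coeffs ^^ j) a k + (diff_coeffs ^^ j) b k)"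
  by (induction j) (simp_all add: diff_coeffs_add)

lemma laurent_funpow_L1:
  assumes "finite {k. c k \<noteq> 0}"
  shows "(LINT x|lborel. norm (laurent ((diff_coeffs ^^ Suc j) c) x)) \<le> 2 * pi * sqrt (energy_const j * weighted_energy (real j + 1) c)"
proof -
  have "(LINT x|lborel. norm (laurent (diff_coeffs ((diff_coeffs ^^ j) c)) x)) \<le> 2 * pi * sqrt (weighted_energy 1 ((diff_coeffs ^^ j) c))"
    by (intro laurent_diff_L1 finite_support_diff_coeffs_funpow assms)
  also have "\<dots> \<le> 2 * pi * sqrt (energy_const j * weighted_energy (real j + 1) c)"
    by (intro mult_left_mono real_sqrt_le_mono energy_const assms) simp
  finally show ?thesis by simp
qed

lemma integrable_laurent_funpow:
  assumes "finite {k. c k \<noteq> 0}"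
  shows "integrable lborel (laurent ((diff_coeffs ^^ Suc j) c))"
  using integrable_laurent_diff[OF finite_support_diff_coeffs_funpow[OF assms, of j]] by simp

end

text \<open>What the estimates use of the interpolation error, detached from \<open>f\<close> and
  \<open>n\<close>. Energy bounds are passed to each lemma separately, because each item consumes
  different orders.\<close>

locale laurent_series = cayley +
  fixes E :: "int \<Rightarrow> complex" and e :: "real \<Rightarrow> complex"
  assumes E_summable: "(\<lambda>k. norm (E k)) summable_on UNIV"
    and E_sum_0: "(E has_sum 0) UNIV"
    and e_has_sum: "\<And>x. ((\<lambda>k. E k * M x powi k) has_sum e x) UNIV"
begin

definition cut :: "nat \<Rightarrow> int \<Rightarrow> complex" where
  "cut N k = (if k \<in> {- int N..int N} then E k else 0)"

lemma finite_cut: "finite {k. cut N k \<noteq> 0}"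
  by (rule finite_subset[of _ "{- int N..int N}"]) (auto simp: cut_def)

lemma laurent_cut: "laurent (cut N) x = (\<Sum>k\<in>{- int N..int N}. E k * M x powi k)"
  by (subst laurent_eq[of "{- int N..int N}"]) (auto simp: cut_def)

lemma weighted_energy_cut:
  "weighted_energy r (cut N) = (\<Sum>k\<in>{- int N..int N}. (1 + \<bar>real_of_int k\<bar>) powr (2 * r) * (norm (E k))\<^sup>2)"
  by (subst weighted_energy_eq[of "{- int N..int N}"]) (auto simp: cut_def)

lemma series_uniform_limit:
  "uniform_limit UNIV (\<lambda>X x. \<Sum>k\<in>X. E k * M x powi k) e (finite_subsets_at_top UNIV)"
  by (rule Weierstrass_m_test_general'[OF _ e_has_sum E_summable]) (simp add: norm_mult)

lemma cut_uniform_limit: "uniform_limit UNIV (\<lambda>N. laurent (cut N)) e sequentially"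
  using filterlim_compose[OF series_uniform_limit symmetric_intervals_filterlim] by (simp add: laurent_cut[abs_def])

lemma cut_tendsto: "(\<lambda>N. laurent (cut N) x) \<longlonglongrightarrow> e x"
  using tendsto_uniform_limitI[OF cut_uniform_limit] by simp

lemma continuous_e: "continuous_on X e"
proof -
  have "continuous_on UNIV e"
    by (rule uniform_limit_theorem[OF _ cut_uniform_limit]) (auto simp: continuous_laurent)
  then show ?thesis by (rule continuous_on_subset) simp
qed

lemma e_measurable [measurable]: "e \<in> borel_measurable borel"
  by (intro borel_measurable_continuous_onI continuous_e)

text \<open>As M tends to 1, a cut tends to the sum of its coefficients. Uniform convergence lets
  the two limits be exchanged, and the total is 0.\<close>

lemma e_tendsto_0: "(e \<longlongrightarrow> 0) at_top" "(e \<longlongrightarrow> 0) at_bot"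
proof -
  have lim: "(\<lambda>N. \<Sum>k\<in>{- int N..int N}. E k) \<longlonglongrightarrow> 0" by (rule has_sum_symmetric_limit[OF E_sum_0])
  have *: "(laurent (cut N) \<longlongrightarrow> (\<Sum>k\<in>{- int N..int N}. E k)) F" if "\<And>k. ((\<lambda>x. M x powi k) \<longlongrightarrow> 1) F" for N F
    unfolding laurent_cut[abs_def] using tendsto_sum[OF tendsto_mult[OF tendsto_const that]] by simp
  show "(e \<longlongrightarrow> 0) at_top"
    by (rule swap_uniform_limit'[OF _ lim cut_uniform_limit]) (auto intro!: always_eventually * M_powi_tendsto_1)
  show "(e \<longlongrightarrow> 0) at_bot"
    by (rule swap_uniform_limit'[OF _ lim cut_uniform_limit]) (auto intro!: always_eventually * M_powi_tendsto_1)
qed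

text \<open>The difference of two cuts has its coefficients between the two ranges, so the L1 norm
  of its derivative is controlled by a tail of a convergent series. The bound \<open>B\<close> on
  all finite sums supplies both that convergence and the norm of the limit.\<close>

lemma derivative_L1_limit:
  assumes B: "\<And>X. finite X \<Longrightarrow> (\<Sum>k\<in>X. (1 + \<bar>real_of_int k\<bar>) powr (2 * (real j + 1)) * (norm (E k))\<^sup>2) \<le> B"
  obtains G where "integrable lborel G"
    and "(\<lambda>N. LINT x|lborel. norm (laurent ((diff_coeffs ^^ Suc j) (cut N)) x - G x)) \<longlonglongrightarrow> 0"
    and "L1_norm G \<le> 2 * pi * sqrt (energy_const j * B)"
proof -
  let ?q = "\<lambda>k. (1 + \<bar>real_of_int k\<bar>) powr (2 * (real j + 1)) * (norm (E k))\<^sup>2"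
  let ?D = "\<lambda>N. laurent ((diff_coeffs ^^ Suc j) (cut N))"
  have q: "?q summable_on UNIV"
  proof (rule nonneg_bdd_above_summable_on)
    show "bdd_above (sum ?q ` {F. F \<subseteq> UNIV \<and> finite F})" by (rule bdd_aboveI2[where M = B]) (use B in auto)
  qed simp
  define S where "S = infsum ?q UNIV"
  define b where "b N = 2 * pi * sqrt (energy_const j * (S - (\<Sum>k\<in>{- int N..int N}. ?q k)))" for N
  have "(\<lambda>N. \<Sum>k\<in>{- int N..int N}. ?q k) \<longlonglongrightarrow> S"
    unfolding S_def by (rule has_sum_symmetric_limit[OF has_sum_infsum[OF q]])
  then have "b \<longlonglongrightarrow> 2 * pi * sqrt (energy_const j * (S - S))" unfolding b_def by (intro tendsto_intros)
  then have b: "b \<longlonglongrightarrow> 0" by simp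
  have int: "integrable lborel (?D N)" for N by (rule integrable_laurent_funpow[OF finite_cut])
  have cauchy: "(LINT x|lborel. norm (?D n x - ?D m x)) \<le> b m" if "m \<le> n" for m n
  proof -
    let ?r = "\<lambda>k. if k \<in> {- int n..int n} - {- int m..int m} then E k else 0"
    have fr: "finite {k. ?r k \<noteq> 0}" by (rule finite_subset[of _ "{- int n..int n}"]) auto
    have "cut n = (\<lambda>k. cut m k + ?r k)" using that by (auto simp: cut_def fun_eq_iff)
    then have "?D n x = ?D m x + laurent ((diff_coeffs ^^ Suc j) ?r) x" for x
      by (simp only: diff_coeffs_funpow_add laurent_add[OF finite_support_diff_coeffs_funpow[OF finite_cut] finite_support_diff_coeffs_funpow[OF fr]])
    then have "(LINT x|lborel. norm (?D n x - ?D m x)) = (LINT x|lborel. norm (laurent ((diff_coeffs ^^ Suc j) ?r) x))"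
      by (simp only: add_diff_cancel_left')
    also have "\<dots> \<le> 2 * pi * sqrt (energy_const j * weighted_energy (real j + 1) ?r)" by (rule laurent_funpow_L1[OF fr])
    also have "weighted_energy (real j + 1) ?r = (\<Sum>k\<in>{- int n..int n} - {- int m..int m}. ?q k)"
      by (subst weighted_energy_eq[of "{- int n..int n} - {- int m..int m}"]) auto
    also have "\<dots> = (\<Sum>k\<in>{- int n..int n}. ?q k) - (\<Sum>k\<in>{- int m..int m}. ?q k)"
      using that by (intro sum_diff) auto
    also have "2 * pi * sqrt (energy_const j * \<dots>) \<le> b m"
      unfolding b_def S_def using q by (intro mult_left_mono real_sqrt_le_mono diff_right_mono finite_sum_le_infsum energy_const) auto
    finally show ?thesis .
  qed
  obtain G where G: "integrable lborel G" "\<And>n. (LINT x|lborel. norm (?D n x - G x)) \<le> b n"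
    using L1_complete[OF int cauchy b] by blast
  have lim: "(\<lambda>N. LINT x|lborel. norm (?D N x - G x)) \<longlonglongrightarrow> 0"
    by (rule Lim_null_comparison[OF always_eventually b]) (use G(2) in simp)
  have "L1_norm G \<le> 2 * pi * sqrt (energy_const j * B) + b N" for N
  proof -
    have "L1_norm G \<le> (LINT x|lborel. norm (?D N x) + norm (?D N x - G x))"
      unfolding L1_norm_def
    proof (intro integral_mono Bochner_Integration.integrable_add integrable_norm Bochner_Integration.integrable_diff int G(1))
      show "norm (G x) \<le> norm (?D N x) + norm (?D N x - G x)" for x
        using norm_triangle_sub[of "G x" "?D N x"] by (simp only: norm_minus_commute)
    qed
    also have "\<dots> = (LINT x|lborel. norm (?D N x)) + (LINT x|lborel. norm (?D N x - G x))"
      using int[of N] G(1) by (intro Bochner_Integration.integral_add integrable_norm Bochner_Integration.integrable_diff) auto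
    also have "\<dots> \<le> 2 * pi * sqrt (energy_const j * weighted_energy (real j + 1) (cut N)) + b N"
      by (intro add_mono laurent_funpow_L1 finite_cut G)
    also have "\<dots> \<le> 2 * pi * sqrt (energy_const j * B) + b N"
      unfolding weighted_energy_cut
      by (intro add_right_mono mult_left_mono real_sqrt_le_mono energy_const B) auto
    finally show ?thesis .
  qed
  then have "L1_norm G \<le> 2 * pi * sqrt (energy_const j * B) + 0"
    by (intro tendsto_lowerbound[OF tendsto_add[OF tendsto_const b]]) auto
  then show ?thesis using that[OF G(1) lim] by simp
qed

text \<open>The identity holds for cuts. On the left, dominated convergence applies because all cuts
  are bounded by the sum of the |E_k|; on the right, L1 convergence is tested against a bounded
  function.\<close>

lemma derivative_limit_weak_deriv:
  assumes G: "integrable lborel G"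
    and lim: "(\<lambda>N. LINT x|lborel. norm (laurent ((diff_coeffs ^^ Suc j) (cut N)) x - G x)) \<longlonglongrightarrow> 0"
  shows "weak_deriv (Suc j) e G"
  unfolding weak_deriv_def
proof (intro conjI allI impI)
  let ?D = "\<lambda>N. laurent ((diff_coeffs ^^ Suc j) (cut N))"
  have [measurable]: "G \<in> borel_measurable borel" using borel_measurable_integrable[OF G] by simp
  have int: "integrable lborel (?D N)" for N by (rule integrable_laurent_funpow[OF finite_cut])
  show "locally_integrable e"
    unfolding locally_integrable_def by (intro allI borel_integrable_atLeastAtMost' continuous_e)
  show "locally_integrable G"
    unfolding locally_integrable_def set_integrable_def by (intro allI integrable_mult_indicator G) simp
  fix \<phi> assume \<phi>: "test_function \<phi>"
  obtain R where R: "\<And>m x. R < \<bar>x\<bar> \<Longrightarrow> (deriv ^^ m) \<phi> x = 0" using test_function_support[OF \<phi>] by blast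
  define \<psi> where "\<psi> m = (deriv ^^ m) \<phi>" for m
  have \<psi>: "continuous_on X (\<psi> m)" "\<And>x. R < \<bar>x\<bar> \<Longrightarrow> \<psi> m x = 0" for X m
    using test_function_continuous[OF \<phi>] R by (auto simp: \<psi>_def)
  have [measurable]: "\<psi> m \<in> borel_measurable borel" for m by (intro borel_measurable_continuous_onI \<psi>)
  have 1: "(\<lambda>N. LINT x|lborel. laurent (cut N) x * of_real (\<psi> (Suc j) x)) \<longlonglongrightarrow> (LINT x|lborel. e x * of_real (\<psi> (Suc j) x))"
  proof (rule integral_dominated_convergence[where w = "\<lambda>x. infsum (\<lambda>k. norm (E k)) UNIV * \<bar>\<psi> (Suc j) x\<bar>"])
    show "integrable lborel (\<lambda>x. infsum (\<lambda>k. norm (E k)) UNIV * \<bar>\<psi> (Suc j) x\<bar>)"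
      by (rule integrable_compact_support[where R = R]) (auto intro!: continuous_intros \<psi>)
    fix N
    show "AE x in lborel. norm (laurent (cut N) x * of_real (\<psi> (Suc j) x)) \<le> infsum (\<lambda>k. norm (E k)) UNIV * \<bar>\<psi> (Suc j) x\<bar>"
    proof (intro AE_I2)
      fix x
      have "norm (laurent (cut N) x) \<le> (\<Sum>k\<in>{- int N..int N}. norm (E k))"
        unfolding laurent_cut by (rule sum_norm_le) (simp add: norm_mult)
      also have "\<dots> \<le> infsum (\<lambda>k. norm (E k)) UNIV" by (intro finite_sum_le_infsum E_summable) auto
      finally show "norm (laurent (cut N) x * of_real (\<psi> (Suc j) x)) \<le> infsum (\<lambda>k. norm (E k)) UNIV * \<bar>\<psi> (Suc j) x\<bar>"
        by (simp add: norm_mult mult_right_mono)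
    qed
  qed (auto intro!: tendsto_mult cut_tendsto)
  obtain K where K: "\<And>x. \<bar>\<psi> 0 x\<bar> \<le> K"
  proof -
    have "bounded (\<psi> 0 ` {-R..R})" by (intro compact_imp_bounded compact_continuous_image \<psi>) simp
    then obtain K where "K > 0" "\<And>x. x \<in> {-R..R} \<Longrightarrow> \<bar>\<psi> 0 x\<bar> \<le> K" by (auto simp: bounded_pos)
    moreover have "\<bar>\<psi> 0 x\<bar> \<le> K" if "x \<notin> {-R..R}" for x
    proof -
      have "R < \<bar>x\<bar>" using that by auto
      then show ?thesis using \<open>K > 0\<close> \<psi>(2) by simp
    qed
    ultimately show ?thesis using that by blast
  qed
  have int\<phi>: "integrable lborel (\<lambda>x. h x * complex_of_real (\<psi> 0 x))" if h: "integrable lborel h" for h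
  proof (rule Bochner_Integration.integrable_bound[OF integrable_mult_right[OF integrable_norm[OF h], of K]])
    show "AE x in lborel. norm (h x * complex_of_real (\<psi> 0 x)) \<le> norm (K * norm (h x))"
      using K by (intro AE_I2) (auto simp: norm_mult abs_mult mult.commute[of "norm (h _)"] intro!: mult_right_mono order_trans[OF K abs_ge_self])
  qed (use borel_measurable_integrable[OF h] in simp)
  have 2: "(\<lambda>N. LINT x|lborel. ?D N x * of_real (\<psi> 0 x)) \<longlonglongrightarrow> (LINT x|lborel. G x * of_real (\<psi> 0 x))"
  proof (rule Lim_null[THEN iffD2], rule Lim_null_comparison[OF always_eventually], intro allI)
    fix N
    have "norm ((LINT x|lborel. ?D N x * of_real (\<psi> 0 x)) - (LINT x|lborel. G x * of_real (\<psi> 0 x)))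
        = norm (LINT x|lborel. (?D N x - G x) * of_real (\<psi> 0 x))"
      using int\<phi>[OF int] int\<phi>[OF G] by (simp add: left_diff_distrib)
    also have "\<dots> \<le> (LINT x|lborel. norm ((?D N x - G x) * of_real (\<psi> 0 x)))" by (rule integral_norm_bound)
    also have "\<dots> \<le> (LINT x|lborel. K * norm (?D N x - G x))"
    proof (rule integral_mono)
      have d: "integrable lborel (\<lambda>x. ?D N x - G x)" by (intro Bochner_Integration.integrable_diff int G)
      show "integrable lborel (\<lambda>x. norm ((?D N x - G x) * of_real (\<psi> 0 x)))" by (intro integrable_norm int\<phi> d)
      show "integrable lborel (\<lambda>x. K * norm (?D N x - G x))" by (intro integrable_mult_right integrable_norm d)
      show "norm ((?D N x - G x) * of_real (\<psi> 0 x)) \<le> K * norm (?D N x - G x)" for x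
        unfolding norm_mult norm_of_real mult.commute[of "norm (?D N x - G x)"] using K by (rule mult_right_mono) simp
    qed
    finally show "norm ((LINT x|lborel. ?D N x * of_real (\<psi> 0 x)) - (LINT x|lborel. G x * of_real (\<psi> 0 x)))
        \<le> K * (LINT x|lborel. norm (?D N x - G x))" by simp
  next
    show "(\<lambda>N. K * (LINT x|lborel. norm (?D N x - G x))) \<longlonglongrightarrow> 0" using tendsto_mult_right_zero[OF lim] .
  qed
  have "(\<lambda>N. LINT x|lborel. laurent (cut N) x * of_real (\<psi> (Suc j) x)) \<longlonglongrightarrow> (-1) ^ Suc j * (LINT x|lborel. G x * of_real (\<psi> 0 x))"
  proof -
    have eq: "(LINT x|lborel. laurent (cut N) x * of_real (\<psi> (Suc j) x)) = (-1) ^ Suc j * (LINT x|lborel. ?D N x * of_real (\<psi> 0 x))" for N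
      unfolding \<psi>_def laurent_weak_derivative[OF \<phi> finite_cut] by (simp only: funpow_0)
    show ?thesis unfolding eq by (rule tendsto_mult_left[OF 2])
  qed
  from LIMSEQ_unique[OF 1 this]
  show "(LINT x|lborel. e x * of_real ((deriv ^^ Suc j) \<phi> x)) = (-1) ^ Suc j * (LINT x|lborel. G x * of_real (\<phi> x))"
    by (simp add: \<psi>_def)
qed

lemma derivative_limit_fourier:
  assumes G: "integrable lborel G"
    and G_lim: "(\<lambda>N. LINT x|lborel. norm (laurent (diff_coeffs (cut N)) x - G x)) \<longlonglongrightarrow> 0"
    and H: "integrable lborel H"
    and H_lim: "(\<lambda>N. LINT x|lborel. norm (laurent ((diff_coeffs ^^ Suc j) (cut N)) x - H x)) \<longlonglongrightarrow> 0"
  shows "fourier_L1 H k = (\<i> * of_real k) ^ j * fourier_L1 G k"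
proof -
  have "(\<lambda>N. fourier_L1 (laurent ((diff_coeffs ^^ Suc j) (cut N))) k) \<longlonglongrightarrow> fourier_L1 H k"
    by (rule fourier_L1_tendsto[OF integrable_laurent_funpow[OF finite_cut] H H_lim])
  moreover have "(\<lambda>N. (\<i> * of_real k) ^ j * fourier_L1 (laurent (diff_coeffs (cut N))) k) \<longlonglongrightarrow> (\<i> * of_real k) ^ j * fourier_L1 G k"
    by (intro tendsto_intros fourier_L1_tendsto integrable_laurent_diff finite_cut G G_lim)
  ultimately show ?thesis
    unfolding fourier_L1_laurent_diff[OF finite_cut] using LIMSEQ_unique by blast
qed

text \<open>Integration by parts on \<open>{-R..R}\<close> trades the error for the integrable
  \<open>G\<close>, and the boundary terms vanish because the error tends to 0. It is carried out
  for the cuts and passed to the limit, since only they are known to be differentiable.\<close>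

lemma pv_fourier_nonzero:
  assumes k: "k \<noteq> 0" and G: "integrable lborel G"
    and lim: "(\<lambda>N. LINT x|lborel. norm (laurent (diff_coeffs (cut N)) x - G x)) \<longlonglongrightarrow> 0"
  shows "has_pv_fourier e k (fourier_L1 G k / (\<i> * of_real k))"
proof -
  let ?b = "\<lambda>h R. exp (- (\<i> * of_real k * of_real R)) * h R - exp (- (\<i> * of_real k * of_real (- R))) * h (- R) :: complex"
  have eq: "\<i> * of_real k * truncated_fourier R e k = truncated_fourier R G k - ?b e R" if R: "R \<ge> 0" for R
  proof -
    have 1: "(\<lambda>N. \<i> * of_real k * truncated_fourier R (laurent (cut N)) k) \<longlonglongrightarrow> \<i> * of_real k * truncated_fourier R e k"
      by (intro tendsto_intros truncated_fourier_uniform_limit uniform_limit_on_subset[OF cut_uniform_limit] continuous_laurent) auto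
    have 2: "(\<lambda>N. truncated_fourier R (laurent (diff_coeffs (cut N))) k - ?b (laurent (cut N)) R) \<longlonglongrightarrow> truncated_fourier R G k - ?b e R"
      by (intro tendsto_intros truncated_fourier_L1_tendsto integrable_laurent_diff finite_cut G lim cut_tendsto)
    show ?thesis
      using LIMSEQ_unique[OF 1 2[folded truncated_fourier_by_parts[OF R laurent_has_vector_derivative[OF finite_cut] continuous_laurent]]] .
  qed
  have "((\<lambda>R. ?b e R) \<longlongrightarrow> 0 - 0) at_top"
  proof (rule tendsto_diff)
    have "((\<lambda>R. norm (e R)) \<longlongrightarrow> 0) at_top" "((\<lambda>R. norm (e (- R))) \<longlongrightarrow> 0) at_top"
      using tendsto_norm_zero[OF e_tendsto_0(1)] tendsto_norm_zero[OF filterlim_compose[OF e_tendsto_0(2) filterlim_uminus_at_bot_at_top]] by simp_all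
    then show "((\<lambda>R. exp (- (\<i> * of_real k * of_real R)) * e R) \<longlongrightarrow> 0) at_top"
      "((\<lambda>R. exp (- (\<i> * of_real k * of_real (- R))) * e (- R)) \<longlongrightarrow> 0) at_top"
      by (intro tendsto_norm_zero_cancel[of "\<lambda>R. exp (- (\<i> * of_real k * of_real R)) * e R"]
          tendsto_norm_zero_cancel[of "\<lambda>R. exp (- (\<i> * of_real k * of_real (- R))) * e (- R)"]; simp only: norm_mult norm_exp_imaginary mult_1)+
  qed
  moreover have "((\<lambda>R. truncated_fourier R G k) \<longlongrightarrow> fourier_L1 G k) at_top"
    unfolding truncated_fourier_eq by (rule fourier_L1_truncated_tendsto[OF G])
  ultimately have "((\<lambda>R. truncated_fourier R G k - ?b e R) \<longlongrightarrow> fourier_L1 G k - (0 - 0)) at_top"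
    by (rule tendsto_diff[rotated])
  then have "((\<lambda>R. (truncated_fourier R G k - ?b e R) / (\<i> * of_real k)) \<longlongrightarrow> (fourier_L1 G k - (0 - 0)) / (\<i> * of_real k)) at_top"
    using k by (intro tendsto_divide tendsto_const) auto
  then have lim: "((\<lambda>R. (truncated_fourier R G k - ?b e R) / (\<i> * of_real k)) \<longlongrightarrow> fourier_L1 G k / (\<i> * of_real k)) at_top" by simp
  show ?thesis unfolding has_pv_fourier_def
  proof (rule Lim_transform_eventually[OF lim])
    show "\<forall>\<^sub>F R in at_top. (truncated_fourier R G k - ?b e R) / (\<i> * of_real k) = truncated_fourier R e k"
      using eventually_ge_at_top[of 0]
    proof eventually_elim
      case (elim R)
      show ?case unfolding eq[OF elim, symmetric] using k by simp
    qed
  qed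
qed

text \<open>With \<open>G\<close> the first and \<open>H\<close> the j-th derivative, the transform
  of \<open>H\<close> is (ik)^(j-1) times that of \<open>G\<close>, and that of the error is the
  latter divided by ik. The order 1 appears beside \<open>j\<close> because the principal value is
  reached through \<open>G\<close>.\<close>

lemma derivative_estimate:
  assumes j: "j > 0"
    and B: "\<And>r X. r \<in> {1, real j} \<Longrightarrow> finite X \<Longrightarrow> (\<Sum>k\<in>X. (1 + \<bar>real_of_int k\<bar>) powr (2 * r) * (norm (E k))\<^sup>2) \<le> B r"
  shows "\<exists>Dj. weak_deriv j e Dj \<and> integrable lborel Dj \<and> L1_norm Dj \<le> 2 * pi * sqrt (energy_const (j - 1) * B j) \<and>
    (\<forall>k. \<bar>k\<bar> > 0 \<longrightarrow> (\<exists>L. has_pv_fourier e k L \<and> norm L \<le> \<bar>k\<bar> powi (- int j) * L1_norm Dj))"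
proof -
  obtain i where i: "j = Suc i" using j by (cases j) auto
  have B1: "\<And>X. finite X \<Longrightarrow> (\<Sum>k\<in>X. (1 + \<bar>real_of_int k\<bar>) powr (2 * (real 0 + 1)) * (norm (E k))\<^sup>2) \<le> B 1"
    using B[of 1] by simp
  have Bj: "\<And>X. finite X \<Longrightarrow> (\<Sum>k\<in>X. (1 + \<bar>real_of_int k\<bar>) powr (2 * (real i + 1)) * (norm (E k))\<^sup>2) \<le> B j"
    using B[of "real j"] by (simp add: i add.commute)
  obtain G where G: "integrable lborel G" "(\<lambda>N. LINT x|lborel. norm (laurent ((diff_coeffs ^^ Suc 0) (cut N)) x - G x)) \<longlonglongrightarrow> 0"
    using derivative_L1_limit[OF B1] by blast
  then have G': "(\<lambda>N. LINT x|lborel. norm (laurent (diff_coeffs (cut N)) x - G x)) \<longlonglongrightarrow> 0" by simp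
  obtain H where H: "integrable lborel H" "(\<lambda>N. LINT x|lborel. norm (laurent ((diff_coeffs ^^ Suc i) (cut N)) x - H x)) \<longlonglongrightarrow> 0"
    "L1_norm H \<le> 2 * pi * sqrt (energy_const i * B j)"
    using derivative_L1_limit[OF Bj] by blast
  show ?thesis
  proof (intro exI[of _ H] conjI allI impI)
    show "weak_deriv j e H" unfolding i by (rule derivative_limit_weak_deriv[OF H(1,2)])
    show "L1_norm H \<le> 2 * pi * sqrt (energy_const (j - 1) * B j)" using H(3) by (simp add: i)
    fix k :: real assume k: "\<bar>k\<bar> > 0"
    have "norm (fourier_L1 G k / (\<i> * of_real k)) = \<bar>k\<bar> powi (- int j) * norm (fourier_L1 H k)"
      unfolding derivative_limit_fourier[OF G(1) G' H(1,2)] i using k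
      by (simp add: norm_divide norm_mult norm_power power_int_minus field_simps power_int_def nat_add_distrib)
    also have "\<dots> \<le> \<bar>k\<bar> powi (- int j) * L1_norm H"
      unfolding L1_norm_def by (intro mult_left_mono norm_fourier_L1_le) simp
    finally show "\<exists>L. has_pv_fourier e k L \<and> norm L \<le> \<bar>k\<bar> powi (- int j) * L1_norm H"
      using pv_fourier_nonzero[OF _ G(1) G', of k] k by auto
  qed (rule H(1))
qed

end

section \<open>Principal value transforms\<close>

lemma norm_inverse_unit_minus_1:
  fixes z :: complex
  assumes "norm z = 1"
  shows "norm (inverse z - 1) = norm (z - 1)"
proof -
  have "z \<noteq> 0" using assms by auto
  then have "inverse z - 1 = - (z - 1) * inverse z" by (simp add: field_simps)
  then show ?thesis using assms by (simp only: norm_mult norm_minus_cancel norm_inverse) simp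
qed

lemma norm_powi_minus_1_le:
  fixes z :: complex
  assumes z: "norm z = 1"
  shows "norm (z powi m - 1) \<le> \<bar>real_of_int m\<bar> * norm (z - 1)"
proof (cases "m \<ge> 0")
  case True
  then show ?thesis using norm_power_diff[of z 1 "nat m"] z by (simp add: power_int_def)
next
  case False
  then show ?thesis
    using norm_power_diff[of "inverse z" 1 "nat (- m)"] z norm_inverse_unit_minus_1[OF z]
    by (simp add: power_int_def norm_inverse)
qed

lemma norm_power_minus_linear_le:
  fixes z :: complex
  assumes z: "norm z = 1"
  shows "norm (z ^ p - 1 - of_nat p * (z - 1)) \<le> (real p)\<^sup>2 * (norm (z - 1))\<^sup>2"
proof (induction p)
  case (Suc p)
  have "z ^ Suc p - 1 - of_nat (Suc p) * (z - 1) = (z ^ p - 1 - of_nat p * (z - 1)) + (z ^ p - 1) * (z - 1)"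
    by (simp add: algebra_simps)
  also have "norm \<dots> \<le> (real p)\<^sup>2 * (norm (z - 1))\<^sup>2 + (real p * norm (z - 1)) * norm (z - 1)"
    using Suc norm_power_diff[of z 1 p] z
    by (intro order_trans[OF norm_triangle_ineq] add_mono) (auto simp: norm_mult intro!: mult_right_mono)
  also have "\<dots> = ((real p)\<^sup>2 + real p) * (norm (z - 1))\<^sup>2" by (simp add: algebra_simps power2_eq_square)
  also have "\<dots> \<le> (real (Suc p))\<^sup>2 * (norm (z - 1))\<^sup>2"
    by (intro mult_right_mono) (auto simp: power2_eq_square algebra_simps)
  finally show ?case .
qed simp

text \<open>For m = -p the expansion is taken at 1/z. Exchanging its linear term for the one at z
  costs p (z-1)^2 / z, and p^2 + p <= 2p^2 explains the factor 2.\<close>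

lemma norm_powi_minus_linear_le:
  fixes z :: complex
  assumes z: "norm z = 1"
  shows "norm (z powi m - 1 - of_int m * (z - 1)) \<le> 2 * (real_of_int m)\<^sup>2 * (norm (z - 1))\<^sup>2"
proof (cases "m \<ge> 0")
  case True
  then obtain p where m: "m = int p" using nonneg_int_cases by blast
  have "norm (z powi m - 1 - of_int m * (z - 1)) \<le> (real p)\<^sup>2 * (norm (z - 1))\<^sup>2"
    using norm_power_minus_linear_le[OF z, of p] by (simp add: m)
  also have "\<dots> \<le> 2 * (real_of_int m)\<^sup>2 * (norm (z - 1))\<^sup>2"
    unfolding m by (intro mult_right_mono) auto
  finally show ?thesis .
next
  case False
  define p where "p = nat (- m)"
  have m: "m = - int p" and p1: "p \<ge> 1" using False by (auto simp: p_def)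
  have z0: "z \<noteq> 0" using z by auto
  have w: "norm (inverse z) = 1" using z by (simp add: norm_inverse)
  have "z powi m - 1 - of_int m * (z - 1) = (inverse z ^ p - 1 - of_nat p * (inverse z - 1)) + of_nat p * (inverse z * (z - 1)\<^sup>2)"
    using z0 by (simp add: m power_int_minus power_inverse field_simps power2_eq_square)
  also have "norm \<dots> \<le> (real p)\<^sup>2 * (norm (z - 1))\<^sup>2 + real p * (norm (z - 1))\<^sup>2"
    using norm_power_minus_linear_le[OF w, of p] norm_inverse_unit_minus_1[OF z] w
    by (intro order_trans[OF norm_triangle_ineq] add_mono) (auto simp: norm_mult norm_power)
  also have "\<dots> = (real p * (real p + 1)) * (norm (z - 1))\<^sup>2" by (simp add: algebra_simps power2_eq_square)
  also have "\<dots> \<le> (real p * (real p + real p)) * (norm (z - 1))\<^sup>2"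
    using p1 by (intro mult_right_mono mult_left_mono) auto
  also have "\<dots> = 2 * (real_of_int m)\<^sup>2 * (norm (z - 1))\<^sup>2" by (simp add: m power2_eq_square)
  finally show ?thesis .
qed

text \<open>As 1/x is odd, the two half-lines combine to -2i times the integral of sin(kx)/x, with
  primitive \<open>sgn k * Si (x * |k|)\<close>. The sign factor includes k = 0, where both sides
  vanish.\<close>

lemma truncated_fourier_cutoff_inverse:
  assumes a: "a > 0" and R: "R \<ge> a"
  shows "truncated_fourier R (\<lambda>x. if a \<le> \<bar>x\<bar> then 1 / of_real x else 0) k
    = - 2 * \<i> * of_real (sgn k * (Si (R * \<bar>k\<bar>) - Si (a * \<bar>k\<bar>)))"
proof -
  let ?h = "\<lambda>x. exp (- (\<i> * of_real k * of_real x)) / of_real x :: complex"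
  have c: "continuous_on {-R..-a} ?h" "continuous_on {a..R} ?h"
    using a by (auto intro!: continuous_intros)
  have "truncated_fourier R (\<lambda>x. if a \<le> \<bar>x\<bar> then 1 / of_real x else 0) k = (LINT x:{-R..-a} \<union> {a..R}|lborel. ?h x)"
    unfolding truncated_fourier_def set_lebesgue_integral_def
    using a R by (intro Bochner_Integration.integral_cong refl) (auto simp: indicator_def)
  also have "\<dots> = (LINT x:{-R..-a}|lborel. ?h x) + (LINT x:{a..R}|lborel. ?h x)"
    using a by (intro set_integral_Un borel_integrable_atLeastAtMost' c) auto
  also have "\<dots> = integral {-R..-a} ?h + integral {a..R} ?h"
    using c by (simp add: set_borel_integral_eq_integral(2) borel_integrable_atLeastAtMost')
  also have "integral {-R..-a} ?h = integral {a..R} (\<lambda>x. - exp (\<i> * of_real k * of_real x) / of_real x)"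
    using Henstock_Kurzweil_Integration.integral_reflect_real[of R a "\<lambda>x. - exp (\<i> * of_real k * of_real x) / of_real x"] by simp
  also have "\<dots> + integral {a..R} ?h = integral {a..R} (\<lambda>x. - exp (\<i> * of_real k * of_real x) / of_real x + ?h x)"
    using a c by (intro integral_add[symmetric] integrable_continuous_real continuous_intros) auto
  also have "\<dots> = integral {a..R} (\<lambda>x. - 2 * \<i> * of_real (sin (k * x) / x))"
  proof (intro integral_cong)
    fix x
    have "exp (- (\<i> * of_real k * of_real x)) - exp (\<i> * of_real k * of_real x) = - 2 * \<i> * of_real (sin (k * x))"
      using exp_Euler[of "of_real (k * x)"] exp_minus_Euler[of "of_real (k * x)"]
      by (simp add: sin_of_real mult.assoc flip: of_real_mult)
    then have "(exp (- (\<i> * of_real k * of_real x)) - exp (\<i> * of_real k * of_real x)) / of_real x = - 2 * \<i> * of_real (sin (k * x)) / of_real x" by simp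
    then show "- exp (\<i> * of_real k * of_real x) / of_real x + ?h x = - 2 * \<i> * of_real (sin (k * x) / x)"
      by (simp add: diff_divide_distrib)
  qed
  also have "\<dots> = - 2 * \<i> * of_real (sgn k * Si (R * \<bar>k\<bar>)) - - 2 * \<i> * of_real (sgn k * Si (a * \<bar>k\<bar>))"
  proof (intro integral_unique fundamental_theorem_of_calculus)
    fix x assume x: "x \<in> {a..R}"
    have "((\<lambda>x. sgn k * Si (x * \<bar>k\<bar>)) has_real_derivative sgn k * (sinc (x * \<bar>k\<bar>) * \<bar>k\<bar>)) (at x)"
      by (intro DERIV_cmult DERIV_chain2[OF DERIV_Si] DERIV_cmult_right[OF DERIV_ident, simplified])
    also have "sgn k * (sinc (x * \<bar>k\<bar>) * \<bar>k\<bar>) = sin (k * x) / x"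
      using x a by (auto simp: sgn_if abs_if field_simps)
    finally have "((\<lambda>x. complex_of_real (sgn k * Si (x * \<bar>k\<bar>))) has_vector_derivative of_real (sin (k * x) / x)) (at x)"
      by (rule has_vector_derivative_of_real)
    from has_vector_derivative_at_within[OF has_vector_derivative_mult_right[OF this, of "- 2 * \<i>"]]
    show "((\<lambda>x. - 2 * \<i> * of_real (sgn k * Si (x * \<bar>k\<bar>))) has_vector_derivative - 2 * \<i> * of_real (sin (k * x) / x)) (at x within {a..R})"
      .
  qed (use R in simp)
  finally show ?thesis by (simp add: algebra_simps)
qed

lemma truncated_fourier_cutoff_inverse_small:
  assumes "R < a"
  shows "truncated_fourier R (\<lambda>x. if a \<le> \<bar>x\<bar> then 1 / of_real x else 0) k = 0"
proof -
  have "(\<lambda>x. indicator {-R..R} x *\<^sub>R (exp (- (\<i> * of_real k * of_real x)) * (if a \<le> \<bar>x\<bar> then 1 / of_real x else 0))) = (\<lambda>x. 0 :: complex)"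
    using assms by (auto simp: indicator_def fun_eq_iff)
  then show ?thesis by (simp add: truncated_fourier_def set_lebesgue_integral_def)
qed

lemma truncated_fourier_add:
  assumes "set_integrable lborel {-R..R} f" "set_integrable lborel {-R..R} g"
  shows "truncated_fourier R (\<lambda>x. f x + g x) k = truncated_fourier R f k + truncated_fourier R g k"
proof -
  have "integrable lborel (\<lambda>x. indicator {-R..R} x * h x)" if "set_integrable lborel {-R..R} h" for h :: "real \<Rightarrow> complex"
    using that by (simp add: set_integrable_def scaleR_conv_of_real of_real_indicator)
  from fourier_L1_add[OF this[OF assms(1)] this[OF assms(2)]]
  show ?thesis by (simp add: truncated_fourier_eq distrib_left)
qed

lemma truncated_fourier_cmult: "truncated_fourier R (\<lambda>x. c * f x) k = c * truncated_fourier R f k"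
proof -
  have "(\<lambda>x. indicator {-R..R} x *\<^sub>R (exp (- (\<i> * of_real k * of_real x)) * (c * f x)))
      = (\<lambda>x. c * (indicator {-R..R} x *\<^sub>R (exp (- (\<i> * of_real k * of_real x)) * f x)))"
    by (simp add: fun_eq_iff)
  then show ?thesis
    unfolding truncated_fourier_def set_lebesgue_integral_def by (simp only: integral_mult_right_zero)
qed

section \<open>Truncated transforms and L2 norms of M^m - 1\<close>

context cayley
begin

text \<open>Away from \<open>|x| \<le> \<beta>|m|\<close> the function \<open>M\<^sup>m - 1\<close> is \<open>-2\<i>\<beta>m/x\<close> up to an error of size
  \<open>(\<beta>m/x)\<^sup>2\<close>. The main term is odd, so its truncated transform is a sine integral, which is
  bounded uniformly in the frequency and in the truncation.\<close>

lemma M_powi_minus_1_expansion: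
  fixes m :: int
  assumes m: "m \<noteq> 0"
  defines "a \<equiv> \<beta> * \<bar>real_of_int m\<bar>"
  shows "norm (M x powi m - 1 + 2 * \<i> * of_real \<beta> * of_int m * (if a \<le> \<bar>x\<bar> then 1 / of_real x else 0)) \<le> 20 * a * (a / (x\<^sup>2 + a\<^sup>2))"
proof (cases "a \<le> \<bar>x\<bar>")
  case False
  then have "\<bar>x\<bar> \<le> \<bar>a\<bar>" by linarith
  then have "x\<^sup>2 \<le> a\<^sup>2" by (simp only: abs_le_square_iff)
  moreover have "a > 0" using \<beta>_pos m by (simp add: a_def)
  ultimately have "2 \<le> 20 * a\<^sup>2 / (x\<^sup>2 + a\<^sup>2)"
    using pos_le_divide_eq[of "x\<^sup>2 + a\<^sup>2" 2 "20 * a\<^sup>2"] zero_le_power2[of a] by (simp add: add_nonneg_pos)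
  then have "2 \<le> 20 * a * (a / (x\<^sup>2 + a\<^sup>2))" by (simp add: power2_eq_square)
  moreover have "norm (M x powi m - 1) \<le> 2" using norm_triangle_ineq4[of "M x powi m" 1] by simp
  ultimately show ?thesis using False by simp
next
  case True
  have a: "a > 0" using \<beta>_pos m by (simp add: a_def)
  then have x: "x \<noteq> 0" "x\<^sup>2 > 0" using True by auto
  have m1: "1 \<le> \<bar>real_of_int m\<bar>" using m by linarith
  have d: "(norm (M x - 1))\<^sup>2 \<le> 4 * \<beta>\<^sup>2 / x\<^sup>2"
  proof -
    have "(norm (M x - 1))\<^sup>2 = 4 * \<beta>\<^sup>2 / (x\<^sup>2 + \<beta>\<^sup>2)"
      using norm_one_minus_M_sq[of x] by (simp add: norm_minus_commute angle_density_def power2_eq_square)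
    also have "\<dots> \<le> 4 * \<beta>\<^sup>2 / x\<^sup>2" using mult_pos_pos[OF sq_plus_pos x(2)] by (intro divide_left_mono) auto
    finally show ?thesis .
  qed
  have 1: "norm (M x powi m - 1 - of_int m * (M x - 1)) \<le> 8 * a\<^sup>2 / x\<^sup>2"
  proof -
    have "norm (M x powi m - 1 - of_int m * (M x - 1)) \<le> 2 * (real_of_int m)\<^sup>2 * (norm (M x - 1))\<^sup>2"
      by (rule norm_powi_minus_linear_le) simp
    also have "\<dots> \<le> 2 * (real_of_int m)\<^sup>2 * (4 * \<beta>\<^sup>2 / x\<^sup>2)" using d by (intro mult_left_mono) auto
    also have "\<dots> = 8 * a\<^sup>2 / x\<^sup>2" by (simp add: a_def power_mult_distrib)
    finally show ?thesis .
  qed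
  have 2: "norm (of_int m * (M x - 1) + 2 * \<i> * of_real \<beta> * of_int m * (1 / of_real x)) \<le> 2 * a\<^sup>2 / x\<^sup>2"
  proof -
    define d where "d = of_real x + \<i> * of_real \<beta>"
    have d: "d \<noteq> 0" "complex_of_real x \<noteq> 0" using x denom_ne0[of x] by (simp_all add: d_def)
    have Mx: "M x - 1 = - (2 * \<i> * of_real \<beta> / d)"
      using one_minus_M[of x] unfolding d_def by (metis minus_diff_eq)
    have "of_int m * (M x - 1) + 2 * \<i> * of_real \<beta> * of_int m * (1 / of_real x)
        = of_int m * (2 * \<i> * of_real \<beta> * (d - of_real x) / (of_real x * d))"
      unfolding Mx using d by (simp add: field_simps)
    also have "2 * \<i> * of_real \<beta> * (d - of_real x) = - 2 * (of_real \<beta>)\<^sup>2"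
      by (simp add: d_def power2_eq_square)
    finally have "of_int m * (M x - 1) + 2 * \<i> * of_real \<beta> * of_int m * (1 / of_real x)
        = of_int m * (- 2 * (of_real \<beta>)\<^sup>2 / (of_real x * (of_real x + \<i> * of_real \<beta>)))"
      by (simp add: d_def)
    also have "norm \<dots> = \<bar>real_of_int m\<bar> * (2 * \<beta>\<^sup>2 / (\<bar>x\<bar> * norm (complex_of_real x + \<i> * of_real \<beta>)))"
      by (simp add: norm_mult norm_divide norm_power)
    also have "\<dots> \<le> \<bar>real_of_int m\<bar> * (2 * \<beta>\<^sup>2 / (\<bar>x\<bar> * \<bar>x\<bar>))"
    proof (intro mult_left_mono divide_left_mono)
      show "\<bar>x\<bar> \<le> norm (complex_of_real x + \<i> * of_real \<beta>)"
        using abs_Re_le_cmod[of "complex_of_real x + \<i> * of_real \<beta>"] by simp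
      show "0 < \<bar>x\<bar> * norm (complex_of_real x + \<i> * of_real \<beta>) * (\<bar>x\<bar> * \<bar>x\<bar>)"
        using x denom_ne0[of x] by (intro mult_pos_pos) (simp_all del: abs_mult_self_eq)
    qed auto
    also have "\<dots> = 2 * (\<bar>real_of_int m\<bar> * \<beta>\<^sup>2) / x\<^sup>2" by (simp add: power2_eq_square)
    also have "\<dots> \<le> 2 * a\<^sup>2 / x\<^sup>2"
    proof -
      have "\<bar>real_of_int m\<bar> * \<beta>\<^sup>2 \<le> (\<bar>real_of_int m\<bar> * \<bar>real_of_int m\<bar>) * \<beta>\<^sup>2"
        using mult_left_mono[OF m1 abs_ge_zero[of "real_of_int m"]] by (intro mult_right_mono) (simp_all del: abs_mult_self_eq)
      then show ?thesis by (intro divide_right_mono mult_left_mono) (auto simp: a_def power2_eq_square mult_ac)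
    qed
    finally show ?thesis .
  qed
  have "a\<^sup>2 \<le> x\<^sup>2" using True a by (simp add: abs_le_square_iff[symmetric])
  have "norm (M x powi m - 1 + 2 * \<i> * of_real \<beta> * of_int m * (1 / of_real x))
      = norm ((M x powi m - 1 - of_int m * (M x - 1)) + (of_int m * (M x - 1) + 2 * \<i> * of_real \<beta> * of_int m * (1 / of_real x)))"
    by (simp add: algebra_simps)
  also have "\<dots> \<le> 8 * a\<^sup>2 / x\<^sup>2 + 2 * a\<^sup>2 / x\<^sup>2"
    by (rule order_trans[OF norm_triangle_ineq add_mono[OF 1 2]])
  \<comment> \<open>The second-order term gives 8 and the replacement of M - 1 by its leading 1/x
    part gives 2; doubling the denominator to reach the Poisson kernel makes this 20.\<close>
  also have "\<dots> = 20 * a\<^sup>2 / (x\<^sup>2 + x\<^sup>2)" using x by (simp add: field_simps)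
  also have "\<dots> \<le> 20 * a\<^sup>2 / (x\<^sup>2 + a\<^sup>2)"
    using \<open>a\<^sup>2 \<le> x\<^sup>2\<close> x by (intro divide_left_mono) (auto intro!: mult_pos_pos add_pos_nonneg)
  also have "\<dots> = 20 * a * (a / (x\<^sup>2 + a\<^sup>2))" by (simp add: power2_eq_square)
  finally show ?thesis using True by simp
qed

text \<open>The remainder is integrable, with L1 norm linear in |m|, and the 1/x part is a
  difference of sine integrals. The existence of the limit is recorded with the bound because the
  series over m will be passed to the limit term by term.\<close>

lemma truncated_fourier_M_powi:
  "\<exists>K\<ge>0. \<forall>m k. (\<forall>R\<ge>0. norm (truncated_fourier R (\<lambda>x. M x powi m - 1) k) \<le> K * \<bar>real_of_int m\<bar>)
     \<and> (\<exists>l. ((\<lambda>R. truncated_fourier R (\<lambda>x. M x powi m - 1) k) \<longlongrightarrow> l) at_top)"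
proof -
  obtain B where B: "\<And>T. \<bar>Si T\<bar> \<le> B" using bounded_Si by blast
  have B0: "B \<ge> 0" using B[of 0] by linarith
  \<comment> \<open>\<open>20 * pi\<close> bounds the remainder; \<open>8 * B\<close> is the
    coefficient 2 of the 1/x part times 4B, where \<open>B\<close> bounds the sine integral.\<close>
  define K where "K = \<beta> * (20 * pi + 8 * B)"
  have K: "K \<ge> 0" using \<beta>_pos B0 by (simp add: K_def)
  show ?thesis
  proof (intro exI[of _ K] conjI allI K)
    fix m k
    have "(\<forall>R\<ge>0. norm (truncated_fourier R (\<lambda>x. M x powi m - 1) k) \<le> K * \<bar>real_of_int m\<bar>)
     \<and> (\<exists>l. ((\<lambda>R. truncated_fourier R (\<lambda>x. M x powi m - 1) k) \<longlongrightarrow> l) at_top)"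
    proof (cases "m = 0")
      case True
      then show ?thesis by (auto simp: truncated_fourier_def set_lebesgue_integral_def intro: exI[of _ 0])
    next
      case False
      define a where "a = \<beta> * \<bar>real_of_int m\<bar>"
      have a: "a > 0" using \<beta>_pos False by (simp add: a_def)
      define q where "q x = (if a \<le> \<bar>x\<bar> then 1 / complex_of_real x else 0)" for x
      have [measurable]: "q \<in> borel_measurable borel" unfolding q_def by measurable
      define r where "r x = M x powi m - 1 + 2 * \<i> * of_real \<beta> * of_int m * q x" for x
      have [measurable]: "(\<lambda>x. M x powi m) \<in> borel_measurable borel"
        by (intro borel_measurable_continuous_onI continuous_M_powi)
      have rm [measurable]: "r \<in> borel_measurable borel" unfolding r_def by measurable
      have rb: "norm (r x) \<le> 20 * a * (a / (x\<^sup>2 + a\<^sup>2))" for x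
        using M_powi_minus_1_expansion[OF False, of x] by (simp add: r_def q_def a_def)
      have ip: "integrable lborel (\<lambda>x. 20 * a * (a / (x\<^sup>2 + a\<^sup>2)))" by (intro integrable_mult_right integrable_poisson a)
      have ri: "integrable lborel r"
        by (rule Bochner_Integration.integrable_bound[OF ip]) (use rb in \<open>auto intro: order_trans[OF _ abs_ge_self]\<close>)
      have "(LINT x|lborel. norm (r x)) \<le> (LINT x|lborel. 20 * a * (a / (x\<^sup>2 + a\<^sup>2)))"
        by (intro integral_mono integrable_norm ri ip rb)
      also have "\<dots> = 20 * a * (LINT x|lborel. a / (x\<^sup>2 + a\<^sup>2))" by (rule integral_mult_right_zero)
      also have "\<dots> = 20 * pi * a" unfolding integral_poisson[OF a] by simp
      finally have rI: "(LINT x|lborel. norm (r x)) \<le> 20 * pi * a" .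
      define s where "s R = truncated_fourier R q k" for R
      have si: "set_integrable lborel {-R..R} r" for R
        unfolding set_integrable_def by (intro integrable_mult_indicator ri) simp
      have qi: "set_integrable lborel {-R..R} (\<lambda>x. - (2 * \<i> * of_real \<beta> * of_int m) * q x)" for R
        unfolding set_integrable_def
      proof (rule integrableI_bounded_set_indicator[where B = "2 * \<beta> * \<bar>real_of_int m\<bar> / a"])
        show "AE x in lborel. x \<in> {-R..R} \<longrightarrow> norm (- (2 * \<i> * of_real \<beta> * of_int m) * q x) \<le> 2 * \<beta> * \<bar>real_of_int m\<bar> / a"
        proof (intro AE_I2 impI)
          fix x
          have "norm (q x) \<le> 1 / a" using a by (auto simp: q_def norm_divide intro!: divide_left_mono)
          then have "2 * \<beta> * \<bar>real_of_int m\<bar> * norm (q x) \<le> 2 * \<beta> * \<bar>real_of_int m\<bar> * (1 / a)"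
            using \<beta>_pos by (intro mult_left_mono) auto
          then show "norm (- (2 * \<i> * of_real \<beta> * of_int m) * q x) \<le> 2 * \<beta> * \<bar>real_of_int m\<bar> / a"
            using \<beta>_pos by (simp add: norm_mult)
        qed
      qed (auto simp: emeasure_lborel_Icc_eq)
      have split: "truncated_fourier R (\<lambda>x. M x powi m - 1) k = truncated_fourier R r k - 2 * \<i> * of_real \<beta> * of_int m * s R" for R
      proof -
        have "(\<lambda>x. M x powi m - 1) = (\<lambda>x. r x + - (2 * \<i> * of_real \<beta> * of_int m) * q x)" by (simp add: r_def)
        then show ?thesis unfolding s_def using truncated_fourier_add[OF si qi, of R k]
          by (simp only: truncated_fourier_cmult) simp
      qed
      have sR: "s R = - 2 * \<i> * of_real (sgn k * (Si (R * \<bar>k\<bar>) - Si (a * \<bar>k\<bar>)))" if "R \<ge> a" for R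
        unfolding s_def q_def by (rule truncated_fourier_cutoff_inverse[OF a that])
      have sb: "norm (s R) \<le> 4 * B" for R
      proof (cases "R \<ge> a")
        case True
        have "\<bar>Si (R * \<bar>k\<bar>) - Si (a * \<bar>k\<bar>)\<bar> \<le> 2 * B" using B[of "R * \<bar>k\<bar>"] B[of "a * \<bar>k\<bar>"] by linarith
        then have "\<bar>sgn k\<bar> * \<bar>Si (R * \<bar>k\<bar>) - Si (a * \<bar>k\<bar>)\<bar> \<le> 1 * (2 * B)" by (intro mult_mono) (auto simp: abs_sgn_eq)
        moreover have "norm (s R) = 2 * (\<bar>sgn k\<bar> * \<bar>Si (R * \<bar>k\<bar>) - Si (a * \<bar>k\<bar>)\<bar>)"
          unfolding sR[OF True] by (simp only: norm_mult norm_of_real abs_mult) simp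
        ultimately show ?thesis by linarith
      next
        case False
        then have "s R = 0" unfolding s_def q_def by (intro truncated_fourier_cutoff_inverse_small) simp
        then show ?thesis using B0 by simp
      qed
      have rR: "norm (truncated_fourier R r k) \<le> 20 * pi * a" for R
      proof -
        have "norm (truncated_fourier R r k) \<le> (LINT x|lborel. norm (indicator {-R..R} x * r x))"
          unfolding truncated_fourier_eq by (rule norm_fourier_L1_le)
        also have "\<dots> \<le> (LINT x|lborel. norm (r x))"
        proof (intro integral_mono integrable_norm ri)
          show "integrable lborel (\<lambda>x. indicator {-R..R} x * r x)"
            using integrable_mult_indicator[OF _ ri, of "{-R..R}"] by (simp add: scaleR_conv_of_real of_real_indicator)
        qed (auto simp: indicator_def)
        finally show ?thesis using rI by linarith
      qed
      have "norm (truncated_fourier R (\<lambda>x. M x powi m - 1) k) \<le> K * \<bar>real_of_int m\<bar>" for R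
      proof -
        have "norm (truncated_fourier R (\<lambda>x. M x powi m - 1) k) \<le> 20 * pi * a + 2 * \<beta> * \<bar>real_of_int m\<bar> * (4 * B)"
          unfolding split
        proof (rule order_trans[OF norm_triangle_ineq4 add_mono[OF rR]])
          show "norm (2 * \<i> * of_real \<beta> * of_int m * s R) \<le> 2 * \<beta> * \<bar>real_of_int m\<bar> * (4 * B)"
            using mult_left_mono[OF sb[of R], of "2 * \<beta> * \<bar>real_of_int m\<bar>"] \<beta>_pos by (simp add: norm_mult)
        qed
        also have "\<dots> = K * \<bar>real_of_int m\<bar>" by (simp add: K_def a_def algebra_simps)
        finally show ?thesis .
      qed
      moreover have "\<exists>l. ((\<lambda>R. truncated_fourier R (\<lambda>x. M x powi m - 1) k) \<longlongrightarrow> l) at_top"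
      proof -
        have "\<exists>l. (s \<longlongrightarrow> l) at_top"
        proof (cases "k = 0")
          case True
          have "\<forall>\<^sub>F R in at_top. s R = 0" using eventually_ge_at_top[of a] by eventually_elim (simp add: sR True)
          then show ?thesis using tendsto_eventually by blast
        next
          case False
          have "filterlim (\<lambda>R. R * \<bar>k\<bar>) at_top at_top"
            using False by (intro filterlim_at_top_mult_tendsto_pos[OF tendsto_const _ filterlim_ident]) auto
          from filterlim_compose[OF Si_at_top this] have "((\<lambda>R. Si (R * \<bar>k\<bar>)) \<longlongrightarrow> pi / 2) at_top" .
          then have "((\<lambda>R. - 2 * \<i> * of_real (sgn k * (Si (R * \<bar>k\<bar>) - Si (a * \<bar>k\<bar>)))) \<longlongrightarrow> - 2 * \<i> * of_real (sgn k * (pi / 2 - Si (a * \<bar>k\<bar>)))) at_top"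
            by (intro tendsto_intros)
          moreover have "\<forall>\<^sub>F R in at_top. - 2 * \<i> * of_real (sgn k * (Si (R * \<bar>k\<bar>) - Si (a * \<bar>k\<bar>))) = s R"
            using eventually_ge_at_top[of a] by eventually_elim (simp add: sR)
          ultimately show ?thesis using Lim_transform_eventually by blast
        qed
        then obtain l where "(s \<longlongrightarrow> l) at_top" by blast
        moreover have "((\<lambda>R. truncated_fourier R r k) \<longlongrightarrow> fourier_L1 r k) at_top"
          unfolding truncated_fourier_eq by (rule fourier_L1_truncated_tendsto[OF ri])
        ultimately have "((\<lambda>R. truncated_fourier R r k - 2 * \<i> * of_real \<beta> * of_int m * s R)
            \<longlongrightarrow> fourier_L1 r k - 2 * \<i> * of_real \<beta> * of_int m * l) at_top"
          by (intro tendsto_intros)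
        then show ?thesis unfolding split by blast
      qed
      ultimately show ?thesis by blast
    qed
    then show "\<And>R. 0 \<le> R \<longrightarrow> norm (truncated_fourier R (\<lambda>x. M x powi m - 1) k) \<le> K * \<bar>real_of_int m\<bar>"
      "\<exists>l. ((\<lambda>R. truncated_fourier R (\<lambda>x. M x powi m - 1) k) \<longlongrightarrow> l) at_top" by blast+
  qed
qed

definition pv_const :: real where
  "pv_const = (SOME K. K \<ge> 0 \<and> (\<forall>m k. (\<forall>R\<ge>0. norm (truncated_fourier R (\<lambda>x. M x powi m - 1) k) \<le> K * \<bar>real_of_int m\<bar>)
     \<and> (\<exists>l. ((\<lambda>R. truncated_fourier R (\<lambda>x. M x powi m - 1) k) \<longlongrightarrow> l) at_top)))"

lemma pv_const:
  shows "pv_const \<ge> 0"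
    and "R \<ge> 0 \<Longrightarrow> norm (truncated_fourier R (\<lambda>x. M x powi m - 1) k) \<le> pv_const * \<bar>real_of_int m\<bar>"
    and "\<exists>l. ((\<lambda>R. truncated_fourier R (\<lambda>x. M x powi m - 1) k) \<longlongrightarrow> l) at_top"
  using someI_ex[OF truncated_fourier_M_powi[unfolded Bex_def]] unfolding pv_const_def by blast+

text \<open>The modulus is at most 2 and at most |m| |M - 1| <= 2\<beta>|m|/|x|. The two bounds meet
  at |x| = \<beta>|m|, and twice a Poisson-type profile of that width covers both; using only the
  second would make the integral quadratic in m.\<close>

lemma M_powi_minus_1_sq:
  shows "(norm (M x powi m - 1))\<^sup>2 \<le> 8 * (\<beta> * \<bar>real_of_int m\<bar>) * (\<beta> * \<bar>real_of_int m\<bar> / (x\<^sup>2 + (\<beta> * \<bar>real_of_int m\<bar>)\<^sup>2))"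
proof (cases "m = 0")
  case False
  define a where "a = \<beta> * \<bar>real_of_int m\<bar>"
  have a: "a > 0" using \<beta>_pos False by (simp add: a_def)
  have "(norm (M x powi m - 1))\<^sup>2 \<le> 8 * a\<^sup>2 / (x\<^sup>2 + a\<^sup>2)"
  proof (cases "x\<^sup>2 \<le> a\<^sup>2")
    case True
    have "norm (M x powi m - 1) \<le> 2" using norm_triangle_ineq4[of "M x powi m" 1] by simp
    then have "(norm (M x powi m - 1))\<^sup>2 \<le> 2\<^sup>2" by (intro power_mono) auto
    also have "2\<^sup>2 \<le> 8 * a\<^sup>2 / (x\<^sup>2 + a\<^sup>2)"
      using True a pos_le_divide_eq[of "x\<^sup>2 + a\<^sup>2" 4 "8 * a\<^sup>2"] by (simp add: add_nonneg_pos)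
    finally show ?thesis .
  next
    case False
    then have x: "x\<^sup>2 > 0" using a by (smt (verit) zero_le_power2)
    have "(norm (M x powi m - 1))\<^sup>2 \<le> (\<bar>real_of_int m\<bar> * norm (M x - 1))\<^sup>2"
      by (intro power_mono norm_powi_minus_1_le) auto
    also have "\<dots> = 4 * a\<^sup>2 / (x\<^sup>2 + \<beta>\<^sup>2)"
      using norm_one_minus_M_sq[of x]
      by (simp add: norm_minus_commute angle_density_def power_mult_distrib a_def) (simp add: power2_eq_square)
    also have "\<dots> \<le> 4 * a\<^sup>2 / x\<^sup>2" using mult_pos_pos[OF sq_plus_pos x] by (intro divide_left_mono) auto
    also have "\<dots> = 8 * a\<^sup>2 / (x\<^sup>2 + x\<^sup>2)" using x by (simp add: field_simps)
    also have "\<dots> \<le> 8 * a\<^sup>2 / (x\<^sup>2 + a\<^sup>2)"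
      using False x by (intro divide_left_mono) (auto intro!: mult_pos_pos add_pos_nonneg)
    finally show ?thesis .
  qed
  also have "8 * a\<^sup>2 / (x\<^sup>2 + a\<^sup>2) = 8 * a * (a / (x\<^sup>2 + a\<^sup>2))" by (simp add: power2_eq_square)
  finally show ?thesis by (simp only: a_def)
qed simp

lemma
  shows integrable_M_powi_minus_1_sq: "integrable lborel (\<lambda>x. (norm (M x powi m - 1))\<^sup>2)"
    and integral_M_powi_minus_1_sq: "(LINT x|lborel. (norm (M x powi m - 1))\<^sup>2) \<le> 8 * pi * \<beta> * \<bar>real_of_int m\<bar>"
proof -
  have "integrable lborel (\<lambda>x. (norm (M x powi m - 1))\<^sup>2) \<and> (LINT x|lborel. (norm (M x powi m - 1))\<^sup>2) \<le> 8 * pi * \<beta> * \<bar>real_of_int m\<bar>"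
  proof (cases "m = 0")
    case False
    define a where "a = \<beta> * \<bar>real_of_int m\<bar>"
    have a: "a > 0" using \<beta>_pos False by (simp add: a_def)
    have le: "(norm (M x powi m - 1))\<^sup>2 \<le> 8 * a * (a / (x\<^sup>2 + a\<^sup>2))" for x
      using M_powi_minus_1_sq[of x m] by (simp only: a_def)
    have [measurable]: "(\<lambda>x. M x powi m) \<in> borel_measurable borel"
      by (intro borel_measurable_continuous_onI continuous_M_powi)
    have ip: "integrable lborel (\<lambda>x. 8 * a * (a / (x\<^sup>2 + a\<^sup>2)))" by (intro integrable_mult_right integrable_poisson a)
    have i: "integrable lborel (\<lambda>x. (norm (M x powi m - 1))\<^sup>2)"
      by (rule Bochner_Integration.integrable_bound[OF ip]) (use le in \<open>auto intro: order_trans[OF _ abs_ge_self]\<close>)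
    have "(LINT x|lborel. (norm (M x powi m - 1))\<^sup>2) \<le> (LINT x|lborel. 8 * a * (a / (x\<^sup>2 + a\<^sup>2)))"
      by (intro integral_mono i ip le)
    also have "\<dots> = 8 * a * (LINT x|lborel. a / (x\<^sup>2 + a\<^sup>2))" by (rule integral_mult_right_zero)
    also have "\<dots> = 8 * pi * \<beta> * \<bar>real_of_int m\<bar>" unfolding integral_poisson[OF a] by (simp add: a_def)
    finally show ?thesis using i by blast
  qed simp
  then show "integrable lborel (\<lambda>x. (norm (M x powi m - 1))\<^sup>2)"
    "(LINT x|lborel. (norm (M x powi m - 1))\<^sup>2) \<le> 8 * pi * \<beta> * \<bar>real_of_int m\<bar>" by blast+
qed

end

text \<open>What Cauchy-Schwarz leaves in both applications: 1 - 2(1+\<epsilon>) and 2 -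
  2(3/2+\<epsilon>) are the same exponent.\<close>

definition zeta_const :: "real \<Rightarrow> real" where
  "zeta_const \<epsilon> = (\<Sum>\<^sub>\<infinity>k::int. (1 + \<bar>real_of_int k\<bar>) powr (- (1 + 2 * \<epsilon>)))"

lemma zeta_const_nonneg: "zeta_const \<epsilon> \<ge> 0"
  unfolding zeta_const_def by (intro infsum_nonneg) simp

lemma sum_le_zeta_const:
  assumes "\<epsilon> > 0" "finite X"
  shows "(\<Sum>k\<in>X. (1 + \<bar>real_of_int k\<bar>) powr (- (1 + 2 * \<epsilon>))) \<le> zeta_const \<epsilon>"
  unfolding zeta_const_def using assms by (intro finite_sum_le_infsum int_weight_summable) auto

section \<open>Summation over the coefficients of the error\<close>

context laurent_series
begin

text \<open>Unlike M^m, the functions M^m - 1 vanish at infinity, so each term is square-integrable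
  and has a principal value transform.\<close>

lemma e_has_sum_minus_1: "((\<lambda>m. E m * (M x powi m - 1)) has_sum e x) UNIV"
  using has_sum_minus[OF e_has_sum[of x] E_sum_0] by (simp add: right_diff_distrib)

text \<open>The majorant \<open>W\<close> does not depend on the truncation, so the series of
  truncated transforms converges uniformly in R >= 0 and the limit R to infinity may be taken
  termwise. Unlike the passage through the derivative, this includes k = 0.\<close>

lemma pv_fourier_estimate:
  assumes \<epsilon>: "\<epsilon> > 0"
    and B: "\<And>X. finite X \<Longrightarrow> (\<Sum>k\<in>X. (1 + \<bar>real_of_int k\<bar>) powr (2 * (3 / 2 + \<epsilon>)) * (norm (E k))\<^sup>2) \<le> B"
  shows "\<exists>L. has_pv_fourier e k L \<and> norm L \<le> pv_const * sqrt (zeta_const \<epsilon> * B)"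
proof -
  let ?\<tau> = "\<lambda>m R. truncated_fourier R (\<lambda>x. M x powi m - 1) k"
  have fin: "(\<Sum>m\<in>X. \<bar>real_of_int m\<bar> * norm (E m)) \<le> sqrt (zeta_const \<epsilon> * B)" if X: "finite X" for X
  proof -
    have "(norm (\<Sum>m\<in>X. norm (E m) * \<bar>real_of_int m\<bar>))\<^sup>2 \<le> zeta_const \<epsilon> * B"
    proof (rule norm_sum_mult_sq_le[where w = "\<lambda>k. (1 + \<bar>real_of_int k\<bar>) powr (2 * (3 / 2 + \<epsilon>))"])
      have "(norm \<bar>real_of_int k\<bar>)\<^sup>2 / (1 + \<bar>real_of_int k\<bar>) powr (2 * (3 / 2 + \<epsilon>)) \<le> (1 + \<bar>real_of_int k\<bar>) powr (- (1 + 2 * \<epsilon>))" for k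
      proof -
        have "(norm \<bar>real_of_int k\<bar>)\<^sup>2 \<le> (1 + \<bar>real_of_int k\<bar>)\<^sup>2" by (intro power_mono) auto
        also have "\<dots> = (1 + \<bar>real_of_int k\<bar>) powr 2" by simp
        also have "\<dots> = (1 + \<bar>real_of_int k\<bar>) powr (- (1 + 2 * \<epsilon>)) * (1 + \<bar>real_of_int k\<bar>) powr (2 * (3 / 2 + \<epsilon>))"
          by (simp flip: powr_add)
        finally show ?thesis by (simp add: pos_divide_le_eq)
      qed
      then show "(\<Sum>k\<in>X. (norm \<bar>real_of_int k\<bar>)\<^sup>2 / (1 + \<bar>real_of_int k\<bar>) powr (2 * (3 / 2 + \<epsilon>))) \<le> zeta_const \<epsilon>"
        by (rule order_trans[OF sum_mono sum_le_zeta_const[OF \<epsilon> X]])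
      show "(\<Sum>k\<in>X. (1 + \<bar>real_of_int k\<bar>) powr (2 * (3 / 2 + \<epsilon>)) * (norm (norm (E k)))\<^sup>2) \<le> B"
        using B[OF X] by simp
    qed simp
    then have "norm (\<Sum>m\<in>X. norm (E m) * \<bar>real_of_int m\<bar>) \<le> sqrt (zeta_const \<epsilon> * B)" by (rule real_le_rsqrt)
    then show ?thesis by (simp add: mult.commute)
  qed
  define W where "W m = pv_const * (\<bar>real_of_int m\<bar> * norm (E m))" for m
  have s1: "(\<lambda>m. \<bar>real_of_int m\<bar> * norm (E m)) summable_on UNIV"
    by (rule nonneg_bdd_above_summable_on) (auto intro!: bdd_aboveI2[where M = "sqrt (zeta_const \<epsilon> * B)"] fin)
  then have Ws: "W summable_on UNIV" unfolding W_def by (rule summable_on_cmult_right)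
  have Wle: "infsum W UNIV \<le> pv_const * sqrt (zeta_const \<epsilon> * B)"
    unfolding W_def infsum_cmult_right' using fin by (intro mult_left_mono pv_const infsum_le_finite_sums s1) auto
  have nb: "norm (E m * ?\<tau> m R) \<le> W m" if "R \<ge> 0" for m R
    using mult_left_mono[OF pv_const(2)[OF that, of m k] norm_ge_zero[of "E m"]]
    by (simp add: W_def norm_mult mult_ac)
  have hs: "((\<lambda>m. E m * ?\<tau> m R) has_sum truncated_fourier R e k) UNIV" for R
  proof -
    have u: "uniform_limit {-R..R} (\<lambda>X x. \<Sum>m\<in>X. E m * (M x powi m - 1)) e (finite_subsets_at_top UNIV)"
    proof (rule Weierstrass_m_test_general'[OF _ e_has_sum_minus_1])
      show "(\<lambda>m. norm (E m) * 2) summable_on UNIV" by (intro summable_on_cmult_left E_summable)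
      show "norm (E m * (M x powi m - 1)) \<le> norm (E m) * 2" for m x
        unfolding norm_mult using norm_triangle_ineq4[of "M x powi m" 1] by (intro mult_left_mono) auto
    qed
    have "((\<lambda>X. truncated_fourier R (\<lambda>x. \<Sum>m\<in>X. E m * (M x powi m - 1)) k) \<longlongrightarrow> truncated_fourier R e k) (finite_subsets_at_top UNIV)"
      by (rule truncated_fourier_uniform_limit[OF u]) (auto intro!: continuous_intros continuous_M_powi)
    moreover have "truncated_fourier R (\<lambda>x. \<Sum>m\<in>X. E m * (M x powi m - 1)) k = (\<Sum>m\<in>X. E m * ?\<tau> m R)" for X
    proof -
      have c: "continuous_on {-R..R} (\<lambda>x. E m * (M x powi m - 1))" for m by (intro continuous_intros continuous_M_powi)
      have "truncated_fourier R (\<lambda>x. \<Sum>m\<in>X. E m * (M x powi m - 1)) k = (\<Sum>m\<in>X. truncated_fourier R (\<lambda>x. E m * (M x powi m - 1)) k)"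
      proof (induction X rule: infinite_finite_induct)
        case (insert m X)
        then show ?case
          using truncated_fourier_add[of R "\<lambda>x. E m * (M x powi m - 1)" "\<lambda>x. \<Sum>m\<in>X. E m * (M x powi m - 1)" k]
          by (simp add: borel_integrable_atLeastAtMost' c continuous_on_sum)
      qed (simp_all add: truncated_fourier_def set_lebesgue_integral_def)
      then show ?thesis by (simp add: truncated_fourier_cmult)
    qed
    ultimately show ?thesis by (simp add: has_sum_def)
  qed
  have "\<forall>m. \<exists>l. (?\<tau> m \<longlongrightarrow> l) at_top" by (intro allI pv_const(3))
  from choice[OF this] obtain l where l: "\<And>m. (?\<tau> m \<longlongrightarrow> l m) at_top" by blast
  have lb: "norm (E m * l m) \<le> W m" for m
  proof (rule tendsto_upperbound)
    show "((\<lambda>R. norm (E m * ?\<tau> m R)) \<longlongrightarrow> norm (E m * l m)) at_top" by (intro tendsto_intros l)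
    show "\<forall>\<^sub>F R in at_top. norm (E m * ?\<tau> m R) \<le> W m" using eventually_ge_at_top[of 0] by eventually_elim (rule nb)
  qed simp
  have "(\<lambda>m. norm (E m * l m)) summable_on UNIV" by (rule summable_on_comparison_test[OF Ws lb]) simp
  then have "((\<lambda>m. E m * l m) has_sum infsum (\<lambda>m. E m * l m) UNIV) UNIV"
    by (rule has_sum_infsum[OF Infinite_Sum.abs_summable_summable])
  then have g: "((\<lambda>X. \<Sum>m\<in>X. E m * l m) \<longlongrightarrow> infsum (\<lambda>m. E m * l m) UNIV) (finite_subsets_at_top UNIV)"
    by (simp add: has_sum_def)
  have u: "uniform_limit {0..} (\<lambda>X R. \<Sum>m\<in>X. E m * ?\<tau> m R) (\<lambda>R. truncated_fourier R e k) (finite_subsets_at_top UNIV)"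
    by (rule Weierstrass_m_test_general'[OF _ hs Ws]) (simp add: nb)
  have lim: "((\<lambda>R. truncated_fourier R e k) \<longlongrightarrow> infsum (\<lambda>m. E m * l m) UNIV) at_top"
  proof (rule swap_uniform_limit'[OF _ g u])
    show "\<forall>\<^sub>F X in finite_subsets_at_top UNIV. ((\<lambda>R. \<Sum>m\<in>X. E m * ?\<tau> m R) \<longlongrightarrow> (\<Sum>m\<in>X. E m * l m)) at_top"
      by (intro always_eventually allI tendsto_sum tendsto_mult tendsto_const l)
    show "\<forall>\<^sub>F R in at_top. R \<in> {0::real..}" using eventually_ge_at_top[of "0::real"] by simp
  qed simp
  have "norm (truncated_fourier R e k) \<le> pv_const * sqrt (zeta_const \<epsilon> * B)" if "R \<ge> 0" for R
    using norm_infsum_le[OF hs has_sum_infsum[OF Ws] nb[OF that]] Wle by (rule order_trans)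
  then have "norm (infsum (\<lambda>m. E m * l m) UNIV) \<le> pv_const * sqrt (zeta_const \<epsilon> * B)"
    by (intro tendsto_upperbound[OF tendsto_norm[OF lim]] eventually_mono[OF eventually_ge_at_top[of 0]]) auto
  then show ?thesis using lim unfolding has_pv_fourier_def by blast
qed

text \<open>Cauchy-Schwarz at each fixed x separates the coefficients from the functions M^k - 1;
  only the latter are integrated, and each contributes O(|k|) against its weight. Fatou's lemma
  passes from the cuts to the error.\<close>

lemma e_energy:
  assumes \<epsilon>: "\<epsilon> > 0"
    and B: "\<And>X. finite X \<Longrightarrow> (\<Sum>k\<in>X. (1 + \<bar>real_of_int k\<bar>) powr (2 * (1 + \<epsilon>)) * (norm (E k))\<^sup>2) \<le> B"
  shows "(\<integral>\<^sup>+x. ennreal ((norm (e x))\<^sup>2) \<partial>lborel) \<le> ennreal (8 * pi * \<beta> * zeta_const \<epsilon> * B)"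
proof (rule nn_integral_tendsto_le)
  let ?S = "\<lambda>N x. \<Sum>k\<in>{- int N..int N}. E k * (M x powi k - 1)"
  let ?w = "\<lambda>k. (1 + \<bar>real_of_int k\<bar>) powr (2 * (1 + \<epsilon>))"
  have B0: "B \<ge> 0" using B[of "{}"] by simp
  have [measurable]: "(\<lambda>x. M x powi m) \<in> borel_measurable borel" for m
    by (intro borel_measurable_continuous_onI continuous_M_powi)
  show "(\<lambda>x. ennreal ((norm (?S N x))\<^sup>2)) \<in> borel_measurable lborel" for N by measurable
  show "AE x in lborel. (\<lambda>N. ennreal ((norm (?S N x))\<^sup>2)) \<longlonglongrightarrow> ennreal ((norm (e x))\<^sup>2)"
    by (intro AE_I2 tendsto_ennreal_norm_sq has_sum_symmetric_limit e_has_sum_minus_1)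
  fix N
  let ?P = "\<lambda>x. \<Sum>k\<in>{- int N..int N}. (norm (M x powi k - 1))\<^sup>2 / ?w k"
  have Pi: "integrable lborel (\<lambda>x. ?P x * B)"
    by (intro integrable_mult_left Bochner_Integration.integrable_sum integrable_divide integrable_M_powi_minus_1_sq)
  have "(norm (?S N x))\<^sup>2 \<le> ?P x * B" for x
    by (rule norm_sum_mult_sq_le[where w = ?w]) (use B[of "{- int N..int N}"] in auto)
  then have "(\<integral>\<^sup>+x. ennreal ((norm (?S N x))\<^sup>2) \<partial>lborel) \<le> (\<integral>\<^sup>+x. ennreal (?P x * B) \<partial>lborel)"
    by (intro nn_integral_mono ennreal_leI)
  also have "\<dots> = ennreal (LINT x|lborel. ?P x * B)"
    using B0 by (intro nn_integral_eq_integral Pi) (auto intro!: mult_nonneg_nonneg sum_nonneg)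
  also have "(LINT x|lborel. ?P x * B) = (\<Sum>k\<in>{- int N..int N}. (LINT x|lborel. (norm (M x powi k - 1))\<^sup>2) / ?w k) * B"
    by (simp add: Bochner_Integration.integral_sum integrable_M_powi_minus_1_sq)
  also have "\<dots> \<le> (\<Sum>k\<in>{- int N..int N}. 8 * pi * \<beta> * (1 + \<bar>real_of_int k\<bar>) powr (- (1 + 2 * \<epsilon>))) * B"
  proof (intro mult_right_mono sum_mono B0)
    fix k :: int
    have "(LINT x|lborel. (norm (M x powi k - 1))\<^sup>2) \<le> 8 * pi * \<beta> * \<bar>real_of_int k\<bar>" by (rule integral_M_powi_minus_1_sq)
    also have "\<dots> \<le> 8 * pi * \<beta> * (1 + \<bar>real_of_int k\<bar>) powr 1" using \<beta>_pos by (intro mult_left_mono) auto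
    also have "(1 + \<bar>real_of_int k\<bar>) powr 1 = (1 + \<bar>real_of_int k\<bar>) powr (- (1 + 2 * \<epsilon>)) * ?w k"
      by (subst powr_add[symmetric]) (simp add: algebra_simps)
    finally show "(LINT x|lborel. (norm (M x powi k - 1))\<^sup>2) / ?w k \<le> 8 * pi * \<beta> * (1 + \<bar>real_of_int k\<bar>) powr (- (1 + 2 * \<epsilon>))"
      by (simp add: pos_divide_le_eq mult.assoc)
  qed
  also have "\<dots> \<le> 8 * pi * \<beta> * zeta_const \<epsilon> * B"
    unfolding sum_distrib_left[symmetric] using \<beta>_pos by (intro mult_right_mono mult_left_mono sum_le_zeta_const \<epsilon> B0) auto
  finally show "(\<integral>\<^sup>+x. ennreal ((norm (?S N x))\<^sup>2) \<partial>lborel) \<le> ennreal (8 * pi * \<beta> * zeta_const \<epsilon> * B)"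
    by (simp add: ennreal_leI)
qed

end

section \<open>The Fourier transform on square-integrable functions\<close>

lemma norm_add_sq_le: "(norm (a + b))\<^sup>2 \<le> 2 * (norm a)\<^sup>2 + 2 * (norm (b::'a::real_normed_vector))\<^sup>2"
proof -
  have "(norm (a + b))\<^sup>2 \<le> (norm a + norm b)\<^sup>2" by (intro power_mono norm_triangle_ineq) simp
  also have "\<dots> \<le> 2 * (norm a)\<^sup>2 + 2 * (norm b)\<^sup>2"
    using sum_squares_bound[of "norm a" "norm b"] by (simp add: power2_sum)
  finally show ?thesis .
qed

lemma truncated_fourier_measurable [measurable]:
  assumes [measurable]: "f \<in> borel_measurable borel"
  shows "truncated_fourier R f \<in> borel_measurable borel"
  unfolding truncated_fourier_eq[abs_def] by measurable

lemma L2_on_UNIV_iff: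
  "L2_on UNIV f \<longleftrightarrow> f \<in> borel_measurable borel \<and> integrable lborel (\<lambda>x. (norm (f x))\<^sup>2)"
  by (simp add: L2_on_def set_borel_measurable_def set_integrable_def)

text \<open>\<open>fourier_L2\<close> is chosen by \<open>SOME\<close>; this allows it to be
  replaced almost everywhere by any transform found explicitly.\<close>

lemma is_fourier_L2_unique:
  assumes g: "is_fourier_L2 f g" and h: "is_fourier_L2 f h"
  shows "AE k in lborel. g k = h k"
proof -
  have [measurable]: "f \<in> borel_measurable borel" "g \<in> borel_measurable borel" "h \<in> borel_measurable borel"
    using g h by (auto simp: is_fourier_L2_def L2_on_UNIV_iff)
  let ?d = "\<lambda>g R. \<integral>\<^sup>+k. ennreal ((norm (truncated_fourier R f k - g k))\<^sup>2) \<partial>lborel"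
  have le: "(\<integral>\<^sup>+k. ennreal ((norm (g k - h k))\<^sup>2) \<partial>lborel) \<le> 2 * ?d g R + 2 * ?d h R" for R
  proof -
    have "(\<integral>\<^sup>+k. ennreal ((norm (g k - h k))\<^sup>2) \<partial>lborel)
        \<le> (\<integral>\<^sup>+k. 2 * ennreal ((norm (truncated_fourier R f k - g k))\<^sup>2) + 2 * ennreal ((norm (truncated_fourier R f k - h k))\<^sup>2) \<partial>lborel)"
    proof (intro nn_integral_mono)
      fix k
      have "(norm (g k - h k))\<^sup>2 \<le> 2 * (norm (truncated_fourier R f k - g k))\<^sup>2 + 2 * (norm (truncated_fourier R f k - h k))\<^sup>2"
        using norm_add_sq_le[of "g k - truncated_fourier R f k" "truncated_fourier R f k - h k"]
        by (simp add: norm_minus_commute)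
      then have "ennreal ((norm (g k - h k))\<^sup>2) \<le> ennreal (2 * (norm (truncated_fourier R f k - g k))\<^sup>2 + 2 * (norm (truncated_fourier R f k - h k))\<^sup>2)"
        by (rule ennreal_leI)
      also have "\<dots> = 2 * ennreal ((norm (truncated_fourier R f k - g k))\<^sup>2) + 2 * ennreal ((norm (truncated_fourier R f k - h k))\<^sup>2)"
        by (simp add: ennreal_mult)
      finally show "ennreal ((norm (g k - h k))\<^sup>2) \<le> 2 * ennreal ((norm (truncated_fourier R f k - g k))\<^sup>2) + 2 * ennreal ((norm (truncated_fourier R f k - h k))\<^sup>2)" .
    qed
    also have "\<dots> = 2 * ?d g R + 2 * ?d h R"
      by (simp add: nn_integral_add nn_integral_cmult)
    finally show ?thesis .
  qed
  have "((\<lambda>R. 2 * ?d g R + 2 * ?d h R) \<longlongrightarrow> 2 * 0 + 2 * 0) at_top"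
    using g h by (intro tendsto_add ennreal_tendsto_cmult) (auto simp: is_fourier_L2_def)
  then have "(\<integral>\<^sup>+k. ennreal ((norm (g k - h k))\<^sup>2) \<partial>lborel) \<le> 2 * 0 + 2 * 0"
    by (rule tendsto_lowerbound) (intro always_eventually allI le, simp)
  then have "(\<integral>\<^sup>+k. ennreal ((norm (g k - h k))\<^sup>2) \<partial>lborel) = 0" by simp
  then have "AE k in lborel. ennreal ((norm (g k - h k))\<^sup>2) = 0" by (subst (asm) nn_integral_0_iff_AE) auto
  then show ?thesis by eventually_elim simp
qed

text \<open>For a square-integrable function whose principal value transform exists almost everywhere,
  the pointwise limit is the \<open>L\<^sup>2\<close> transform: the truncations are Cauchy in \<open>L\<^sup>2\<close> by
  the energy inequality, and Fatou's lemma identifies the limit.\<close>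

lemma pv_fourier_is_fourier_L2:
  assumes f: "continuous_on UNIV f" and f2: "integrable lborel (\<lambda>x. (norm (f x))\<^sup>2)"
    and g [measurable]: "g \<in> borel_measurable borel" and pv: "AE k in lborel. has_pv_fourier f k (g k)"
  shows "is_fourier_L2 f g"
    and "(\<integral>\<^sup>+k. ennreal ((norm (g k))\<^sup>2) \<partial>lborel) \<le> ennreal (2 * pi * (LINT x|lborel. (norm (f x))\<^sup>2))"
proof -
  have [measurable]: "f \<in> borel_measurable borel" by (rule borel_measurable_continuous_onI[OF f])
  have fi: "integrable lborel (\<lambda>x. indicator {-R..R} x * f x)" for R
  proof -
    have "set_integrable lborel {-R..R} f" by (intro borel_integrable_atLeastAtMost' continuous_on_subset[OF f]) simp
    then show ?thesis by (simp add: set_integrable_def scaleR_conv_of_real of_real_indicator)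
  qed
  define u where "u R x = indicator (- {-R..R}) x * (norm (f x))\<^sup>2" for R x :: real
  have ui: "integrable lborel (u R)" for R
    unfolding u_def by (rule Bochner_Integration.integrable_bound[OF f2]) (auto simp: indicator_def)
  have diff: "(\<integral>\<^sup>+k. ennreal ((norm (truncated_fourier R f k - truncated_fourier S f k))\<^sup>2) \<partial>lborel)
      \<le> ennreal (2 * pi * (LINT x|lborel. u R x))" if RS: "R \<le> S" for R S
  proof -
    define h where "h x = indicator {-R..R} x * f x - indicator {-S..S} x * f x" for x
    have hi: "integrable lborel h" unfolding h_def by (intro Bochner_Integration.integrable_diff fi)
    then have [measurable]: "h \<in> borel_measurable borel" using borel_measurable_integrable by force
    have hu: "(norm (h x))\<^sup>2 \<le> u R x" for x using RS by (auto simp: h_def u_def indicator_def)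
    have h2: "integrable lborel (\<lambda>x. (norm (h x))\<^sup>2)"
      by (rule Bochner_Integration.integrable_bound[OF ui[of R]]) (use hu in \<open>auto intro: order_trans[OF _ abs_ge_self]\<close>)
    have "(\<integral>\<^sup>+k. ennreal ((norm (fourier_L1 h k))\<^sup>2) \<partial>lborel) \<le> ennreal (2 * pi * (LINT x|lborel. (norm (h x))\<^sup>2))"
      by (rule fourier_L1_energy[OF hi h2])
    also have "\<dots> \<le> ennreal (2 * pi * (LINT x|lborel. u R x))"
      by (intro ennreal_leI mult_left_mono integral_mono h2 ui hu) simp
    finally show ?thesis unfolding h_def by (simp add: fourier_L1_diff[OF fi fi] truncated_fourier_eq)
  qed
  \<comment> \<open>Sequences starting at \<open>R\<close> keep every later truncation beyond
    \<open>R\<close>, where the difference estimate applies.\<close>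
  have seq: "AE k in lborel. (\<lambda>n. truncated_fourier (R + real n) f k) \<longlonglongrightarrow> g k" for R
    using pv
  proof eventually_elim
    case (elim k)
    have "filterlim (\<lambda>n. R + real n) at_top sequentially"
      by (intro filterlim_tendsto_add_at_top[OF tendsto_const] filterlim_real_sequentially)
    then show ?case using elim unfolding has_pv_fourier_def by (rule filterlim_compose[rotated])
  qed
  have d: "(\<integral>\<^sup>+k. ennreal ((norm (truncated_fourier R f k - g k))\<^sup>2) \<partial>lborel) \<le> ennreal (2 * pi * (LINT x|lborel. u R x))" for R
  proof (rule nn_integral_tendsto_le)
    show "AE k in lborel. (\<lambda>n. ennreal ((norm (truncated_fourier R f k - truncated_fourier (R + real n) f k))\<^sup>2))
        \<longlonglongrightarrow> ennreal ((norm (truncated_fourier R f k - g k))\<^sup>2)"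
      using seq[of R] by eventually_elim (intro tendsto_ennreal_norm_sq tendsto_intros)
    show "(\<integral>\<^sup>+k. ennreal ((norm (truncated_fourier R f k - truncated_fourier (R + real n) f k))\<^sup>2) \<partial>lborel)
      \<le> ennreal (2 * pi * (LINT x|lborel. u R x))" for n by (rule diff) simp
  qed measurable
  have "((\<lambda>R. LINT x|lborel. u R x) \<longlongrightarrow> (LINT x|(lborel :: real measure). 0 :: real)) at_top"
  proof (rule integral_dominated_convergence_at_top[where w = "\<lambda>x. (norm (f x))\<^sup>2"])
    show "AE x in lborel. ((\<lambda>R. u R x) \<longlongrightarrow> 0) at_top"
    proof (intro AE_I2 tendsto_eventually)
      fix x :: real
      show "\<forall>\<^sub>F R in at_top. u R x = 0"
        using eventually_ge_at_top[of "\<bar>x\<bar>"] by eventually_elim (auto simp: u_def indicator_def)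
    qed
    show "\<forall>\<^sub>F R in at_top. AE x in lborel. norm (u R x) \<le> (norm (f x))\<^sup>2"
      by (intro always_eventually allI AE_I2) (auto simp: u_def indicator_def)
  qed (auto simp: u_def f2)
  then have "((\<lambda>R. ennreal (2 * pi * (LINT x|lborel. u R x))) \<longlongrightarrow> ennreal (2 * pi * 0)) at_top"
    by (intro tendsto_ennrealI tendsto_mult tendsto_const) simp
  then have lim0: "((\<lambda>R. ennreal (2 * pi * (LINT x|lborel. u R x))) \<longlongrightarrow> 0) at_top" by simp
  have lim: "((\<lambda>R. \<integral>\<^sup>+k. ennreal ((norm (truncated_fourier R f k - g k))\<^sup>2) \<partial>lborel) \<longlongrightarrow> 0) at_top"
    by (rule tendsto_sandwich[OF _ _ tendsto_const lim0]) (auto simp: d)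
  show en: "(\<integral>\<^sup>+k. ennreal ((norm (g k))\<^sup>2) \<partial>lborel) \<le> ennreal (2 * pi * (LINT x|lborel. (norm (f x))\<^sup>2))"
  proof -
    \<comment> \<open>For R = -1 the interval is empty: the truncation is 0 and the tail is all of
      |f|^2, so the distance bound becomes the energy bound for \<open>g\<close>.\<close>
    have "(LINT x|lborel. u (- 1) x) = (LINT x|lborel. (norm (f x))\<^sup>2)"
      by (intro Bochner_Integration.integral_cong refl) (simp add: u_def)
    moreover have "truncated_fourier (- 1) f k = 0" for k
      by (simp add: truncated_fourier_def set_lebesgue_integral_def)
    ultimately show ?thesis using d[of "- 1"] by simp
  qed
  have "integrable lborel (\<lambda>k. (norm (g k))\<^sup>2)"
    by (rule integrableI_bounded) (use order.strict_trans1[OF en ennreal_less_top] in auto)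
  then show "is_fourier_L2 f g"
    using f2 lim by (simp add: is_fourier_L2_def L2_on_UNIV_iff)
qed

context cayley
begin

text \<open>At r = 0 the ratio \<open>A\<close> of the interpolation argument would be 1 and its
  geometric sums would not be bounded; but 0 is an integer order, already covered.\<close>

lemma fourier_laurent_diff_energy_nonneg:
  assumes "r \<ge> 0"
  shows "\<exists>C\<ge>0. \<forall>c. finite {k. c k \<noteq> 0} \<longrightarrow>
     (\<integral>\<^sup>+k. ennreal ((1 + \<bar>k\<bar>) powr (2 * r) * (norm (fourier_L1 (laurent (diff_coeffs c)) k))\<^sup>2) \<partial>lborel)
       \<le> ennreal (C * weighted_energy (r + 1) c)"
proof (cases "r = 0")
  case True
  have [simp]: "1 + \<bar>k\<bar> \<noteq> 0" for k :: real using abs_ge_zero[of k] by linarith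
  from True show ?thesis using fourier_laurent_diff_energy_nat[of 0] by simp
next
  case False
  then show ?thesis using fourier_laurent_diff_energy[of r] assms by simp
qed

definition interpolation_const :: "real \<Rightarrow> real" where
  "interpolation_const r = (SOME C. C \<ge> 0 \<and> (\<forall>c. finite {k. c k \<noteq> 0} \<longrightarrow>
     (\<integral>\<^sup>+k. ennreal ((1 + \<bar>k\<bar>) powr (2 * r) * (norm (fourier_L1 (laurent (diff_coeffs c)) k))\<^sup>2) \<partial>lborel)
       \<le> ennreal (C * weighted_energy (r + 1) c)))"

lemma interpolation_const:
  assumes "r \<ge> 0"
  shows "interpolation_const r \<ge> 0"
    and "finite {k. c k \<noteq> 0} \<Longrightarrow>
     (\<integral>\<^sup>+k. ennreal ((1 + \<bar>k\<bar>) powr (2 * r) * (norm (fourier_L1 (laurent (diff_coeffs c)) k))\<^sup>2) \<partial>lborel)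
       \<le> ennreal (interpolation_const r * weighted_energy (r + 1) c)"
  using someI_ex[OF fourier_laurent_diff_energy_nonneg[OF assms, unfolded Bex_def]]
  unfolding interpolation_const_def by blast+

end

section \<open>The Sobolev norm of the error on the line\<close>

context laurent_series
begin

text \<open>Passing through the derivative requires an order of at least 1, hence the auxiliary
  \<open>t'\<close>. Low frequencies are controlled by the L2 norm of the error, which uses the
  order 1 + \<epsilon>; high ones by the transform of \<open>G\<close>, weighted with order t' - 1.
  The order 1 serves the construction of \<open>G\<close>.\<close>

lemma sobolev_estimate:
  assumes \<epsilon>: "\<epsilon> > 0" and t: "t \<le> t'" "1 \<le> t'"
    and B: "\<And>r X. r \<in> {1, 1 + \<epsilon>, t'} \<Longrightarrow> finite X \<Longrightarrow>
      (\<Sum>k\<in>X. (1 + \<bar>real_of_int k\<bar>) powr (2 * r) * (norm (E k))\<^sup>2) \<le> B r"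
  shows "e \<in> sobolev_line t"
    and "sobolev_line_norm t e \<le> 2 powr t' * (sqrt (16 * pi\<^sup>2 * \<beta> * zeta_const \<epsilon> * B (1 + \<epsilon>)) + sqrt (interpolation_const (t' - 1) * B t'))"
proof -
  define P where "P = 8 * pi * \<beta> * zeta_const \<epsilon> * B (1 + \<epsilon>)"
  have B0: "B (1 + \<epsilon>) \<ge> 0" "B t' \<ge> 0" using B[of "1 + \<epsilon>" "{}"] B[of t' "{}"] by simp_all
  have P0: "P \<ge> 0" using B0 \<beta>_pos zeta_const_nonneg[of \<epsilon>] by (simp add: P_def)
  have e2: "(\<integral>\<^sup>+x. ennreal ((norm (e x))\<^sup>2) \<partial>lborel) \<le> ennreal P"
    unfolding P_def using B[of "1 + \<epsilon>"] by (intro e_energy \<epsilon>) auto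
  have ei: "integrable lborel (\<lambda>x. (norm (e x))\<^sup>2)"
    by (rule integrableI_bounded) (use order.strict_trans1[OF e2 ennreal_less_top] in auto)
  have eP: "(LINT x|lborel. (norm (e x))\<^sup>2) \<le> P"
    using e2 P0 by (subst (asm) nn_integral_eq_integral[OF ei]) (auto simp: ennreal_le_iff)
  have B1: "\<And>X. finite X \<Longrightarrow> (\<Sum>k\<in>X. (1 + \<bar>real_of_int k\<bar>) powr (2 * (real 0 + 1)) * (norm (E k))\<^sup>2) \<le> B 1"
    using B[of 1] by simp
  obtain G where G: "integrable lborel G" "(\<lambda>N. LINT x|lborel. norm (laurent ((diff_coeffs ^^ Suc 0) (cut N)) x - G x)) \<longlonglongrightarrow> 0"
    using derivative_L1_limit[OF B1] by blast
  then have G': "(\<lambda>N. LINT x|lborel. norm (laurent (diff_coeffs (cut N)) x - G x)) \<longlonglongrightarrow> 0" by simp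
  have [measurable]: "G \<in> borel_measurable borel" using borel_measurable_integrable[OF G(1)] by simp
  \<comment> \<open>At k = 0 the quotient is 0 by convention, which affects only a null set.\<close>
  define g where "g k = fourier_L1 G k / (\<i> * of_real k)" for k
  have [measurable]: "g \<in> borel_measurable borel" unfolding g_def by measurable
  have pv: "AE k in lborel. has_pv_fourier e k (g k)"
    using AE_lborel_singleton[of 0] by eventually_elim (auto simp: g_def intro: pv_fourier_nonzero G G')
  note fL2 = pv_fourier_is_fourier_L2[OF continuous_e ei _ pv, simplified]
  have "is_fourier_L2 e (fourier_L2 e)" unfolding fourier_L2_def by (rule someI[where P = "is_fourier_L2 e", OF fL2(1)])
  then have AEg: "AE k in lborel. fourier_L2 e k = g k" and [measurable]: "fourier_L2 e \<in> borel_measurable borel"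
    using is_fourier_L2_unique[OF _ fL2(1)] by (auto simp: is_fourier_L2_def L2_on_UNIV_iff)
  have r0: "t' - 1 \<ge> 0" using t by simp
  have intG: "(\<integral>\<^sup>+k. ennreal ((1 + \<bar>k\<bar>) powr (2 * (t' - 1)) * (norm (fourier_L1 G k))\<^sup>2) \<partial>lborel) \<le> ennreal (interpolation_const (t' - 1) * B t')"
  proof (rule nn_integral_tendsto_le)
    show "AE k in lborel. (\<lambda>N. ennreal ((1 + \<bar>k\<bar>) powr (2 * (t' - 1)) * (norm (fourier_L1 (laurent (diff_coeffs (cut N))) k))\<^sup>2))
        \<longlonglongrightarrow> ennreal ((1 + \<bar>k\<bar>) powr (2 * (t' - 1)) * (norm (fourier_L1 G k))\<^sup>2)"
      by (intro AE_I2 tendsto_ennrealI tendsto_mult tendsto_const tendsto_power tendsto_norm fourier_L1_tendsto integrable_laurent_diff finite_cut G(1) G')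
    fix N
    have "(\<integral>\<^sup>+k. ennreal ((1 + \<bar>k\<bar>) powr (2 * (t' - 1)) * (norm (fourier_L1 (laurent (diff_coeffs (cut N))) k))\<^sup>2) \<partial>lborel)
        \<le> ennreal (interpolation_const (t' - 1) * weighted_energy (t' - 1 + 1) (cut N))"
      by (rule interpolation_const(2)[OF r0 finite_cut])
    also have "\<dots> \<le> ennreal (interpolation_const (t' - 1) * B t')"
      unfolding weighted_energy_cut using B[of t'] by (intro ennreal_leI mult_left_mono interpolation_const(1)[OF r0]) auto
    finally show "(\<integral>\<^sup>+k. ennreal ((1 + \<bar>k\<bar>) powr (2 * (t' - 1)) * (norm (fourier_L1 (laurent (diff_coeffs (cut N))) k))\<^sup>2) \<partial>lborel)
        \<le> ennreal (interpolation_const (t' - 1) * B t')" .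
  qed measurable
  \<comment> \<open>For |k| <= 1 the weight is at most \<open>4 powr t'\<close>. Otherwise (1+|k|)^2
    <= 4k^2, and 4 is at most \<open>4 powr t'\<close> because t' is at least 1.\<close>
  have pt: "(1 + \<bar>k\<bar>) powr (2 * t) * (norm (g k))\<^sup>2 \<le> 4 powr t' * ((norm (g k))\<^sup>2 + (1 + \<bar>k\<bar>) powr (2 * (t' - 1)) * (norm (fourier_L1 G k))\<^sup>2)"
    if k: "k \<noteq> 0" for k
  proof -
    have FG: "(norm (fourier_L1 G k))\<^sup>2 = \<bar>k\<bar>\<^sup>2 * (norm (g k))\<^sup>2"
      using k by (simp add: g_def norm_divide norm_mult power_divide)
    have four: "(4::real) powr t' = 2 powr (2 * t')" using powr_powr[of 2 2 t'] by simp
    have "(1 + \<bar>k\<bar>) powr (2 * t) \<le> (1 + \<bar>k\<bar>) powr (2 * t')" using t by (intro powr_mono) auto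
    also have "\<dots> \<le> 4 powr t' * (1 + (1 + \<bar>k\<bar>) powr (2 * (t' - 1)) * \<bar>k\<bar>\<^sup>2)"
    proof (cases "\<bar>k\<bar> \<le> 1")
      case True
      have "(1 + \<bar>k\<bar>) powr (2 * t') \<le> 2 powr (2 * t')" using True t by (intro powr_mono2) auto
      also have "\<dots> = 4 powr t' * (1 + 0)" using four by simp
      also have "\<dots> \<le> 4 powr t' * (1 + (1 + \<bar>k\<bar>) powr (2 * (t' - 1)) * \<bar>k\<bar>\<^sup>2)"
        by (intro mult_left_mono add_left_mono) auto
      finally show ?thesis .
    next
      case False
      have "(1 + \<bar>k\<bar>) powr (2 * t') = (1 + \<bar>k\<bar>) powr (2 * (t' - 1)) * (1 + \<bar>k\<bar>) powr 2"
        by (subst powr_add[symmetric]) (simp add: algebra_simps)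
      also have "(1 + \<bar>k\<bar>) powr 2 = (1 + \<bar>k\<bar>)\<^sup>2" by simp
      also have "\<dots> \<le> (2 * \<bar>k\<bar>)\<^sup>2" using False by (intro power_mono) auto
      also have "\<dots> = 4 powr 1 * \<bar>k\<bar>\<^sup>2" by (simp add: power_mult_distrib)
      also have "(4::real) powr 1 \<le> 4 powr t'" using t by (intro powr_mono) auto
      finally have "(1 + \<bar>k\<bar>) powr (2 * t') \<le> (1 + \<bar>k\<bar>) powr (2 * (t' - 1)) * (4 powr t' * \<bar>k\<bar>\<^sup>2)"
        by (simp add: mult_left_mono mult_right_mono)
      also have "\<dots> \<le> 4 powr t' * (1 + (1 + \<bar>k\<bar>) powr (2 * (t' - 1)) * \<bar>k\<bar>\<^sup>2)" by (simp add: distrib_left mult_ac)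
      finally show ?thesis .
    qed
    finally have "(1 + \<bar>k\<bar>) powr (2 * t) * (norm (g k))\<^sup>2 \<le> 4 powr t' * (1 + (1 + \<bar>k\<bar>) powr (2 * (t' - 1)) * \<bar>k\<bar>\<^sup>2) * (norm (g k))\<^sup>2"
      by (rule mult_right_mono) simp
    then show ?thesis unfolding FG by (simp add: algebra_simps)
  qed
  define V where "V = 4 powr t' * (2 * pi * P + interpolation_const (t' - 1) * B t')"
  have IB0: "interpolation_const (t' - 1) * B t' \<ge> 0" using interpolation_const(1)[OF r0] B0 by simp
  have V0: "V \<ge> 0" unfolding V_def by (rule mult_nonneg_nonneg) (use P0 IB0 in simp_all)
  have "(\<integral>\<^sup>+k. ennreal ((1 + \<bar>k\<bar>) powr (2 * t) * (norm (fourier_L2 e k))\<^sup>2) \<partial>lborel)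
      \<le> (\<integral>\<^sup>+k. ennreal (4 powr t') * (ennreal ((norm (g k))\<^sup>2) + ennreal ((1 + \<bar>k\<bar>) powr (2 * (t' - 1)) * (norm (fourier_L1 G k))\<^sup>2)) \<partial>lborel)"
  proof (rule nn_integral_mono_AE)
    show "AE k in lborel. ennreal ((1 + \<bar>k\<bar>) powr (2 * t) * (norm (fourier_L2 e k))\<^sup>2)
      \<le> ennreal (4 powr t') * (ennreal ((norm (g k))\<^sup>2) + ennreal ((1 + \<bar>k\<bar>) powr (2 * (t' - 1)) * (norm (fourier_L1 G k))\<^sup>2))"
      using AEg AE_lborel_singleton[of 0]
    proof eventually_elim
      case (elim k)
      then show ?case using ennreal_leI[OF pt[of k]] by (simp add: ennreal_mult)
    qed
  qed
  also have "\<dots> = ennreal (4 powr t') * ((\<integral>\<^sup>+k. ennreal ((norm (g k))\<^sup>2) \<partial>lborel)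
      + (\<integral>\<^sup>+k. ennreal ((1 + \<bar>k\<bar>) powr (2 * (t' - 1)) * (norm (fourier_L1 G k))\<^sup>2) \<partial>lborel))"
    by (simp add: nn_integral_cmult nn_integral_add)
  also have "\<dots> \<le> ennreal (4 powr t') * (ennreal (2 * pi * P) + ennreal (interpolation_const (t' - 1) * B t'))"
  proof (intro mult_left_mono add_mono intG)
    show "(\<integral>\<^sup>+k. ennreal ((norm (g k))\<^sup>2) \<partial>lborel) \<le> ennreal (2 * pi * P)"
      using fL2(2) by (rule order_trans) (intro ennreal_leI mult_left_mono eP, simp)
  qed simp
  also have "\<dots> = ennreal V"
    unfolding V_def
    using P0 IB0 interpolation_const(1)[OF r0] B0 by (subst ennreal_mult') (auto simp: ennreal_plus[symmetric] simp del: ennreal_plus)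
  finally have VV: "(\<integral>\<^sup>+k. ennreal ((1 + \<bar>k\<bar>) powr (2 * t) * (norm (fourier_L2 e k))\<^sup>2) \<partial>lborel) \<le> ennreal V" .
  have i: "integrable lborel (\<lambda>k. (1 + \<bar>k\<bar>) powr (2 * t) * (norm (fourier_L2 e k))\<^sup>2)"
    by (rule integrableI_bounded) (use order.strict_trans1[OF VV ennreal_less_top] in \<open>auto simp: abs_mult\<close>)
  then show "e \<in> sobolev_line t" using ei by (simp add: sobolev_line_def L2_on_UNIV_iff)
  have "(LINT k|lborel. (1 + \<bar>k\<bar>) powr (2 * t) * (norm (fourier_L2 e k))\<^sup>2) \<le> V"
    using VV V0 by (subst (asm) nn_integral_eq_integral[OF i]) (auto simp: ennreal_le_iff)
  then have "sobolev_line_norm t e \<le> sqrt V" unfolding sobolev_line_norm_def by (rule real_sqrt_le_mono)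
  also have "sqrt V = 2 powr t' * sqrt (2 * pi * P + interpolation_const (t' - 1) * B t')"
  proof -
    have "(4::real) powr t' = (2 powr t')\<^sup>2" using powr_powr[of 2 2 t'] powr_powr[of 2 t' 2] by (simp add: mult.commute)
    then show ?thesis by (simp add: V_def real_sqrt_mult)
  qed
  also have "\<dots> \<le> 2 powr t' * (sqrt (2 * pi * P) + sqrt (interpolation_const (t' - 1) * B t'))"
    using P0 IB0 by (intro mult_left_mono sqrt_add_le_add_sqrt) auto
  also have "2 * pi * P = 16 * pi\<^sup>2 * \<beta> * zeta_const \<epsilon> * B (1 + \<epsilon>)" by (simp add: P_def power2_eq_square)
  finally show "sobolev_line_norm t e \<le> 2 powr t' * (sqrt (16 * pi\<^sup>2 * \<beta> * zeta_const \<epsilon> * B (1 + \<epsilon>)) + sqrt (interpolation_const (t' - 1) * B t'))" .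
qed

end

section \<open>Choice of the constants and assembly of the three estimates\<close>

theorem mainTheorem4:
  fixes \<beta> :: real
  assumes "\<beta> > 0"
  shows
    "(\<exists>(C1 :: real \<Rightarrow> real \<Rightarrow> real) (C2 :: real \<Rightarrow> real \<Rightarrow> real).
        \<forall>(\<epsilon>::real) (s::real) (t::real) (f :: real \<Rightarrow> complex) (n::nat).
          \<epsilon> > 0 \<longrightarrow> s > 1 + \<epsilon> \<longrightarrow> t \<le> s \<longrightarrow> n > 1 \<longrightarrow>
          continuous_on UNIV f \<longrightarrow> (f \<longlongrightarrow> 0) at_infinity \<longrightarrow>
          pullback \<beta> f \<in> sobolev_circle s \<longrightarrow>
            interp_error \<beta> n f \<in> sobolev_line t \<and>
            L2_norm (\<lambda>k. fourier_L2 (interp_error \<beta> n f) k * of_real ((1 + \<bar>k\<bar>) powr t))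
              = sobolev_line_norm t (interp_error \<beta> n f) \<and>
            sobolev_line_norm t (interp_error \<beta> n f)
              \<le> (C1 \<epsilon> s * real n powr (1 + \<epsilon> - s) + C2 s t * real n powr (t - s))
                  * sobolev_circle_norm s (pullback \<beta> f))
     \<and>
     (\<exists>C :: real \<Rightarrow> real \<Rightarrow> real.
        \<forall>(\<epsilon>::real) (s::real) (f :: real \<Rightarrow> complex) (n::nat) (k::real).
          \<epsilon> > 0 \<longrightarrow> s > 3 / 2 + \<epsilon> \<longrightarrow> n > 1 \<longrightarrow>
          continuous_on UNIV f \<longrightarrow> (f \<longlongrightarrow> 0) at_infinity \<longrightarrow>
          pullback \<beta> f \<in> sobolev_circle s \<longrightarrow>
            (\<exists>L. has_pv_fourier (interp_error \<beta> n f) k L \<and>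
                 norm L \<le> C \<epsilon> s * real n powr (3 / 2 + \<epsilon> - s)
                            * sobolev_circle_norm s (pullback \<beta> f)))
     \<and>
     (\<exists>C :: nat \<Rightarrow> real \<Rightarrow> real.
        \<forall>(j::nat) (s::real) (f :: real \<Rightarrow> complex) (n::nat).
          0 < j \<longrightarrow> real j \<le> s \<longrightarrow> n > 1 \<longrightarrow>
          continuous_on UNIV f \<longrightarrow> (f \<longlongrightarrow> 0) at_infinity \<longrightarrow>
          pullback \<beta> f \<in> sobolev_circle s \<longrightarrow>
            (\<exists>Dj. weak_deriv j (interp_error \<beta> n f) Dj \<and> integrable lborel Dj \<and>
               (\<forall>k::real. \<bar>k\<bar> > 0 \<longrightarrow>
                  (\<exists>L. has_pv_fourier (interp_error \<beta> n f) k L \<and>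
                       norm L \<le> \<bar>k\<bar> powi (- int j) * L1_norm Dj \<and>
                       \<bar>k\<bar> powi (- int j) * L1_norm Dj
                         \<le> C j s * \<bar>k\<bar> powi (- int j) * real n powr (real j - s)
                             * sobolev_circle_norm s (pullback \<beta> f)))))"
proof -
  interpret cayley \<beta> by standard (rule assms)
  define A where "A = aliasing_const"
  have A0: "A s \<ge> 0" for s by (simp add: A_def aliasing_const_nonneg)
  have expand: "laurent_series \<beta> (error_coeff n f) (interp_error \<beta> n f)"
    if "n > 1" "continuous_on UNIV f" "(f \<longlongrightarrow> 0) at_infinity" "s \<ge> 1" "pullback \<beta> f \<in> sobolev_circle s" for n f s
    using error_coeff_summable[OF that] error_coeff_has_sum_0[OF that] interp_error_has_sum[OF that]
    by unfold_locales
  have norm0: "sobolev_circle_norm s F \<ge> 0" for s F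
    unfolding sobolev_circle_norm_def by (intro real_sqrt_ge_zero infsum_nonneg) simp
  \<comment> \<open>The energies enter under a square root and are quadratic in n^p and in the norm
    of F, so both leave it linearly.\<close>
  have root: "sqrt (K * (A s * (real n powr p * N)\<^sup>2)) = sqrt (K * A s) * real n powr p * N"
    if "K \<ge> 0" "N \<ge> 0" for K s p N :: real and n
    using that by (simp add: real_sqrt_mult mult_ac)
  show ?thesis
  proof (intro conjI)
    \<comment> \<open>The second summand serves t < 1: the estimate is then made at order t' = 1,
      and its n^(1-s) is absorbed into n^(1+\<epsilon>-s). Bounding \<open>2 powr t'\<close> by
      \<open>2 powr s\<close> keeps this constant free of \<open>t\<close>.\<close>
    define C1 where "C1 \<epsilon> s = 2 powr s * (sqrt (16 * pi\<^sup>2 * \<beta> * zeta_const \<epsilon> * A s) + sqrt (interpolation_const 0 * A s))" for \<epsilon> s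
    define C2 where "C2 s t = 2 powr s * sqrt (interpolation_const (max t 1 - 1) * A s)" for s t
    have C2: "C2 s t \<ge> 0" for s t unfolding C2_def using A0 interpolation_const(1)[of "max t 1 - 1"] by simp
    show "\<exists>C1 C2. \<forall>\<epsilon> s t f n.
          \<epsilon> > 0 \<longrightarrow> s > 1 + \<epsilon> \<longrightarrow> t \<le> s \<longrightarrow> n > 1 \<longrightarrow>
          continuous_on UNIV f \<longrightarrow> (f \<longlongrightarrow> 0) at_infinity \<longrightarrow>
          pullback \<beta> f \<in> sobolev_circle s \<longrightarrow>
            interp_error \<beta> n f \<in> sobolev_line t \<and>
            L2_norm (\<lambda>k. fourier_L2 (interp_error \<beta> n f) k * of_real ((1 + \<bar>k\<bar>) powr t))
              = sobolev_line_norm t (interp_error \<beta> n f) \<and>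
            sobolev_line_norm t (interp_error \<beta> n f)
              \<le> (C1 \<epsilon> s * real n powr (1 + \<epsilon> - s) + C2 s t * real n powr (t - s))
                  * sobolev_circle_norm s (pullback \<beta> f)"
    proof (rule exI[of _ C1], rule exI[of _ C2], intro allI impI)
      fix \<epsilon> s t :: real and f :: "real \<Rightarrow> complex" and n :: nat
      assume \<epsilon>: "\<epsilon> > 0" and s: "s > 1 + \<epsilon>" and t: "t \<le> s" and n: "n > 1"
        and f: "continuous_on UNIV f" "(f \<longlongrightarrow> 0) at_infinity" "pullback \<beta> f \<in> sobolev_circle s"
      have s1: "s \<ge> 1" using \<epsilon> s by simp
      interpret laurent_series \<beta> "error_coeff n f" "interp_error \<beta> n f" by (rule expand[OF n f(1,2) s1 f(3)])
      define N where "N = sobolev_circle_norm s (pullback \<beta> f)"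
      have N0: "N \<ge> 0" by (simp add: N_def norm0)
      define t' where "t' = max t 1"
      have B: "(\<Sum>k\<in>X. (1 + \<bar>real_of_int k\<bar>) powr (2 * r) * (norm (error_coeff n f k))\<^sup>2) \<le> A s * (real n powr (r - s) * N)\<^sup>2"
        if "r \<in> {1, 1 + \<epsilon>, t'}" "finite X" for r X
        unfolding A_def N_def using that \<epsilon> s t by (intro error_coeff_energy[OF n f(1,2) s1 f(3)]) (auto simp: t'_def)
      have mem: "interp_error \<beta> n f \<in> sobolev_line t"
        by (rule sobolev_estimate(1)[OF \<epsilon> _ _ B]) (auto simp: t'_def)
      have "sobolev_line_norm t (interp_error \<beta> n f)
          \<le> 2 powr t' * (sqrt (16 * pi\<^sup>2 * \<beta> * zeta_const \<epsilon> * (A s * (real n powr (1 + \<epsilon> - s) * N)\<^sup>2))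
            + sqrt (interpolation_const (t' - 1) * (A s * (real n powr (t' - s) * N)\<^sup>2)))"
        by (rule sobolev_estimate(2)[OF \<epsilon> _ _ B]) (auto simp: t'_def)
      also have "\<dots> \<le> 2 powr s * (sqrt (16 * pi\<^sup>2 * \<beta> * zeta_const \<epsilon> * (A s * (real n powr (1 + \<epsilon> - s) * N)\<^sup>2))
            + sqrt (interpolation_const (t' - 1) * (A s * (real n powr (t' - s) * N)\<^sup>2)))"
        using A0 zeta_const_nonneg[of \<epsilon>] \<beta>_pos interpolation_const(1)[of "t' - 1"] s1 t
        by (intro mult_right_mono powr_mono add_nonneg_nonneg real_sqrt_ge_zero mult_nonneg_nonneg) (auto simp: t'_def)
      also have "\<dots> = 2 powr s * (sqrt (16 * pi\<^sup>2 * \<beta> * zeta_const \<epsilon> * A s) * real n powr (1 + \<epsilon> - s) * N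
            + sqrt (interpolation_const (t' - 1) * A s) * real n powr (t' - s) * N)"
        using zeta_const_nonneg[of \<epsilon>] \<beta>_pos interpolation_const(1)[of "t' - 1"] N0
        by (subst (1 2) root) (auto simp: t'_def)
      also have "\<dots> \<le> (C1 \<epsilon> s * real n powr (1 + \<epsilon> - s) + C2 s t * real n powr (t - s)) * N"
      proof (cases "t \<ge> 1")
        case True
        then have "t' = t" by (simp add: t'_def)
        moreover have "0 \<le> 2 powr s * sqrt (interpolation_const 0 * A s) * real n powr (1 + \<epsilon> - s) * N"
          using N0 A0 interpolation_const(1)[of 0] by simp
        ultimately show ?thesis using True by (simp add: C1_def C2_def algebra_simps)
      next
        case False
        then have t': "t' = 1" by (simp add: t'_def)
        have "real n powr (t' - s) \<le> real n powr (1 + \<epsilon> - s)" using n \<epsilon> by (intro powr_mono) (auto simp: t')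
        then have "2 powr s * sqrt (interpolation_const 0 * A s) * N * real n powr (t' - s)
            \<le> 2 powr s * sqrt (interpolation_const 0 * A s) * N * real n powr (1 + \<epsilon> - s)"
          using N0 A0 interpolation_const(1)[of 0] by (intro mult_left_mono) auto
        moreover have "0 \<le> C2 s t * real n powr (t - s) * N" using C2 N0 by simp
        ultimately show ?thesis by (simp add: C1_def t' algebra_simps)
      qed
      finally have le: "sobolev_line_norm t (interp_error \<beta> n f)
          \<le> (C1 \<epsilon> s * real n powr (1 + \<epsilon> - s) + C2 s t * real n powr (t - s)) * N" .
      have "(norm (fourier_L2 (interp_error \<beta> n f) k * of_real ((1 + \<bar>k\<bar>) powr t)))\<^sup>2
          = (1 + \<bar>k\<bar>) powr (2 * t) * (norm (fourier_L2 (interp_error \<beta> n f) k))\<^sup>2" for k :: real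
        using powr_powr[of "1 + \<bar>k\<bar>" t 2] by (simp add: norm_mult power_mult_distrib mult.commute)
      then have "L2_norm (\<lambda>k. fourier_L2 (interp_error \<beta> n f) k * of_real ((1 + \<bar>k\<bar>) powr t))
              = sobolev_line_norm t (interp_error \<beta> n f)"
        by (simp only: L2_norm_def sobolev_line_norm_def)
      then show "interp_error \<beta> n f \<in> sobolev_line t \<and>
            L2_norm (\<lambda>k. fourier_L2 (interp_error \<beta> n f) k * of_real ((1 + \<bar>k\<bar>) powr t))
              = sobolev_line_norm t (interp_error \<beta> n f) \<and>
            sobolev_line_norm t (interp_error \<beta> n f)
              \<le> (C1 \<epsilon> s * real n powr (1 + \<epsilon> - s) + C2 s t * real n powr (t - s))
                  * sobolev_circle_norm s (pullback \<beta> f)"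
        using mem le by (simp add: N_def)
    qed
  next
    define C where "C \<epsilon> s = pv_const * sqrt (zeta_const \<epsilon> * A s)" for \<epsilon> s
    show "\<exists>C. \<forall>\<epsilon> s f n k.
          \<epsilon> > 0 \<longrightarrow> s > 3 / 2 + \<epsilon> \<longrightarrow> n > 1 \<longrightarrow>
          continuous_on UNIV f \<longrightarrow> (f \<longlongrightarrow> 0) at_infinity \<longrightarrow>
          pullback \<beta> f \<in> sobolev_circle s \<longrightarrow>
            (\<exists>L. has_pv_fourier (interp_error \<beta> n f) k L \<and>
                 norm L \<le> C \<epsilon> s * real n powr (3 / 2 + \<epsilon> - s) * sobolev_circle_norm s (pullback \<beta> f))"
    proof (intro exI[of _ C] allI impI)
      fix \<epsilon> s k :: real and f :: "real \<Rightarrow> complex" and n :: nat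
      assume \<epsilon>: "\<epsilon> > 0" and s: "s > 3 / 2 + \<epsilon>" and n: "n > 1"
        and f: "continuous_on UNIV f" "(f \<longlongrightarrow> 0) at_infinity" "pullback \<beta> f \<in> sobolev_circle s"
      have s1: "s \<ge> 1" using \<epsilon> s by simp
      interpret laurent_series \<beta> "error_coeff n f" "interp_error \<beta> n f" by (rule expand[OF n f(1,2) s1 f(3)])
      define N where "N = sobolev_circle_norm s (pullback \<beta> f)"
      have B: "(\<Sum>k\<in>X. (1 + \<bar>real_of_int k\<bar>) powr (2 * (3 / 2 + \<epsilon>)) * (norm (error_coeff n f k))\<^sup>2) \<le> A s * (real n powr (3 / 2 + \<epsilon> - s) * N)\<^sup>2"
        if "finite X" for X
        unfolding A_def N_def using that \<epsilon> s by (intro error_coeff_energy[OF n f(1,2) s1 f(3)]) auto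
      from pv_fourier_estimate[OF \<epsilon> B]
      show "\<exists>L. has_pv_fourier (interp_error \<beta> n f) k L \<and>
                 norm L \<le> C \<epsilon> s * real n powr (3 / 2 + \<epsilon> - s) * sobolev_circle_norm s (pullback \<beta> f)"
        using root[OF zeta_const_nonneg[of \<epsilon>] norm0[of s "pullback \<beta> f"], of s n "3 / 2 + \<epsilon> - s"]
        by (simp add: C_def N_def mult.assoc)
    qed
  next
    \<comment> \<open>The index is \<open>j - 1\<close> because \<open>energy_const i\<close>
      controls derivative i + 1.\<close>
    define C where "C j s = 2 * pi * sqrt (energy_const (j - 1) * A s)" for j s
    show "\<exists>C. \<forall>j s f n.
          0 < j \<longrightarrow> real j \<le> s \<longrightarrow> n > 1 \<longrightarrow>
          continuous_on UNIV f \<longrightarrow> (f \<longlongrightarrow> 0) at_infinity \<longrightarrow>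
          pullback \<beta> f \<in> sobolev_circle s \<longrightarrow>
            (\<exists>Dj. weak_deriv j (interp_error \<beta> n f) Dj \<and> integrable lborel Dj \<and>
               (\<forall>k::real. \<bar>k\<bar> > 0 \<longrightarrow>
                  (\<exists>L. has_pv_fourier (interp_error \<beta> n f) k L \<and>
                       norm L \<le> \<bar>k\<bar> powi (- int j) * L1_norm Dj \<and>
                       \<bar>k\<bar> powi (- int j) * L1_norm Dj
                         \<le> C j s * \<bar>k\<bar> powi (- int j) * real n powr (real j - s)
                             * sobolev_circle_norm s (pullback \<beta> f))))"
    proof (intro exI[of _ C] allI impI)
      fix s :: real and f :: "real \<Rightarrow> complex" and j n :: nat
      assume j: "0 < j" and s: "real j \<le> s" and n: "n > 1"
        and f: "continuous_on UNIV f" "(f \<longlongrightarrow> 0) at_infinity" "pullback \<beta> f \<in> sobolev_circle s"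
      have s1: "s \<ge> 1" using j s by linarith
      interpret laurent_series \<beta> "error_coeff n f" "interp_error \<beta> n f" by (rule expand[OF n f(1,2) s1 f(3)])
      define N where "N = sobolev_circle_norm s (pullback \<beta> f)"
      have B: "(\<Sum>k\<in>X. (1 + \<bar>real_of_int k\<bar>) powr (2 * r) * (norm (error_coeff n f k))\<^sup>2) \<le> A s * (real n powr (r - s) * N)\<^sup>2"
        if "r \<in> {1, real j}" "finite X" for r X
        unfolding A_def N_def using that s s1 by (intro error_coeff_energy[OF n f(1,2) s1 f(3)]) auto
      obtain Dj where Dj: "weak_deriv j (interp_error \<beta> n f) Dj" "integrable lborel Dj"
        "L1_norm Dj \<le> 2 * pi * sqrt (energy_const (j - 1) * (A s * (real n powr (real j - s) * N)\<^sup>2))"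
        "\<And>k. \<bar>k\<bar> > 0 \<Longrightarrow> \<exists>L. has_pv_fourier (interp_error \<beta> n f) k L \<and> norm L \<le> \<bar>k\<bar> powi (- int j) * L1_norm Dj"
        using derivative_estimate[OF j B] by blast
      have L1: "L1_norm Dj \<le> C j s * real n powr (real j - s) * N"
        using Dj(3) root[OF energy_const(1)[of "j - 1"] norm0[of s "pullback \<beta> f"], of s n "real j - s"]
        by (simp add: C_def N_def mult.assoc)
      have "\<bar>k\<bar> powi (- int j) * L1_norm Dj \<le> C j s * \<bar>k\<bar> powi (- int j) * real n powr (real j - s) * N" for k :: real
        using mult_left_mono[OF L1, of "\<bar>k\<bar> powi (- int j)"] by (simp add: mult_ac)
      with Dj show "\<exists>Dj. weak_deriv j (interp_error \<beta> n f) Dj \<and> integrable lborel Dj \<and>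
               (\<forall>k::real. \<bar>k\<bar> > 0 \<longrightarrow>
                  (\<exists>L. has_pv_fourier (interp_error \<beta> n f) k L \<and>
                       norm L \<le> \<bar>k\<bar> powi (- int j) * L1_norm Dj \<and>
                       \<bar>k\<bar> powi (- int j) * L1_norm Dj
                         \<le> C j s * \<bar>k\<bar> powi (- int j) * real n powr (real j - s)
                             * sobolev_circle_norm s (pullback \<beta> f)))"
        unfolding N_def by blast
    qed
  qed
qed

end
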